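(* Let $u,w\in\mathcal{D}(E)$ be such that $T=M_wEM_u$ is a bounded operator on $L^2(\Sigma)$. If $T$ is weakly hyponormal and $\ker T\subset\ker T^*$, then $T=\widehat{T}$, where $\widehat{T}$ is the Aluthge transformation of $T$.
   Context: $(X,\Sigma,\mu)$ is a complete $\sigma$-finite measure space and $\mathcal{A}\subseteq\Sigma$ is a $\sigma$-subalgebra such that $\mu|_{\mathcal{A}}$ is $\sigma$-finite. $L^2(\Sigma)=L^2(X,\Sigma,\mu)$ (complex-valued functions). $L^0(\Sigma)$ (resp. $L^0(\mathcal{A})$) denotes the a.e. finite valued $\Sigma$-measurable (resp. $\mathcal{A}$-measurable) functions modulo null sets. $E=E^{\mathcal{A}}$ is the conditional expectation: for $f\ge 0$ measurable or $f\in L^2(\Sigma)$, $E(f)$ is the unique $\mathcal{A}$-measurable function with $\int_A f\,d\mu=\int_A E(f)\,d\mu$ for all $A\in\mathcal{A}$ (for which the integrals are defined). $\mathcal{D}(E)=\{g\in L^0(\Sigma): E(|g|)\in L^0(\mathcal{A})\}$, on which $E$ is defined by linearity. $M_wEM_u$ is the operator $f\mapsto wE(uf)$. For a bounded operator $T$ on a Hilbert space, $|T|=(T^*T)^{1/2}$ and $T=U|T|$ is the polar decomposition with $U$ the partial isometry satisfying $\mathcal{N}(U)=\mathcal{N}(|T|)$ (kernels). The Aluthge transformation of $T$ is $\widehat{T}=|T|^{1/2}U|T|^{1/2}$. $T$ is weakly hyponormal if $|\widehat{T}|\ge |T|\ge |\widehat{T}^*|$. The inclusion $\subset$ is not necessarily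 strict. *)

theory Defs
  imports "HOL-Probability.Probability"
begin

section \<open>Conditional expectation of complex functions\<close>

text \<open>
  A sub-sigma-algebra of a measure \<open>M\<close> is given, as in the library, by a measure \<open>F\<close> with
  \<open>subalgebra M F\<close>; only the space and the measurable sets of \<open>F\<close> matter. Elements of
  \<open>L\<^sup>0(M)\<close> are represented by complex-valued measurable functions.
\<close>

definition cond_exp_dom :: "'a measure \<Rightarrow> 'a measure \<Rightarrow> ('a \<Rightarrow> complex) set" where
  "cond_exp_dom M F =
    {g \<in> borel_measurable M. AE x in M. nn_cond_exp M F (\<lambda>y. ennreal (cmod (g y))) x < \<infinity>}"

text \<open>
  \<open>real_cond_exp\<close> is the difference of the conditional expectations of the positive and negative
  parts, so on \<open>cond_exp_dom\<close> this is the extension of \<open>E\<close> by linearity, also when \<open>g\<close> itself is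
  not integrable.
\<close>

definition complex_cond_exp :: "'a measure \<Rightarrow> 'a measure \<Rightarrow> ('a \<Rightarrow> complex) \<Rightarrow> 'a \<Rightarrow> complex" where
  "complex_cond_exp M F g = (\<lambda>x. Complex (real_cond_exp M F (\<lambda>y. Re (g y)) x)
                                          (real_cond_exp M F (\<lambda>y. Im (g y)) x))"

definition wct_op ::
  "'a measure \<Rightarrow> 'a measure \<Rightarrow> ('a \<Rightarrow> complex) \<Rightarrow> ('a \<Rightarrow> complex) \<Rightarrow> ('a \<Rightarrow> complex) \<Rightarrow> 'a \<Rightarrow> complex"
  where "wct_op M F w u f = (\<lambda>x. w x * complex_cond_exp M F (\<lambda>y. u y * f y) x)"

section \<open>The Hilbert space \<open>L\<^sup>2(M)\<close> and its operators\<close>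

text \<open>
  Elements of \<open>L\<^sup>2(M)\<close> are represented by functions; equality in \<open>L\<^sup>2(M)\<close> is equality almost
  everywhere. An operator is represented by a map on functions, of which only the values on
  \<open>l2_space M\<close>, up to null sets, are relevant.
\<close>

definition l2_space :: "'a measure \<Rightarrow> ('a \<Rightarrow> complex) set" where
  "l2_space M = {f \<in> borel_measurable M. integrable M (\<lambda>x. (cmod (f x))\<^sup>2)}"

definition l2_inner :: "'a measure \<Rightarrow> ('a \<Rightarrow> complex) \<Rightarrow> ('a \<Rightarrow> complex) \<Rightarrow> complex" where
  "l2_inner M f g = (LINT x|M. f x * cnj (g x))"

definition l2_norm :: "'a measure \<Rightarrow> ('a \<Rightarrow> complex) \<Rightarrow> real" where
  "l2_norm M f = sqrt (LINT x|M. (cmod (f x))\<^sup>2)"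

type_synonym 'a fun_op = "('a \<Rightarrow> complex) \<Rightarrow> 'a \<Rightarrow> complex"

text \<open>
  Bounded linear operators on \<open>L\<^sup>2(M)\<close>. Additivity and the norm bound imply that almost everywhere
  equal arguments have almost everywhere equal images.
\<close>

definition l2_bounded_op :: "'a measure \<Rightarrow> 'a fun_op \<Rightarrow> bool" where
  "l2_bounded_op M T \<longleftrightarrow>
     (\<forall>f\<in>l2_space M. T f \<in> l2_space M) \<and>
     (\<forall>f\<in>l2_space M. \<forall>g\<in>l2_space M. AE x in M. T (\<lambda>y. f y + g y) x = T f x + T g x) \<and>
     (\<forall>c. \<forall>f\<in>l2_space M. AE x in M. T (\<lambda>y. c * f y) x = c * T f x) \<and>
     (\<exists>K. \<forall>f\<in>l2_space M. l2_norm M (T f) \<le> K * l2_norm M f)"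

definition l2_op_eq :: "'a measure \<Rightarrow> 'a fun_op \<Rightarrow> 'a fun_op \<Rightarrow> bool" where
  "l2_op_eq M S T \<longleftrightarrow> (\<forall>f\<in>l2_space M. AE x in M. S f x = T f x)"

definition l2_ker :: "'a measure \<Rightarrow> 'a fun_op \<Rightarrow> ('a \<Rightarrow> complex) set" where
  "l2_ker M T = {f \<in> l2_space M. AE x in M. T f x = 0}"

definition l2_positive :: "'a measure \<Rightarrow> 'a fun_op \<Rightarrow> bool" where
  "l2_positive M A \<longleftrightarrow> l2_bounded_op M A \<and>
     (\<forall>f\<in>l2_space M. Im (l2_inner M (A f) f) = 0 \<and> 0 \<le> Re (l2_inner M (A f) f))"

definition l2_op_le :: "'a measure \<Rightarrow> 'a fun_op \<Rightarrow> 'a fun_op \<Rightarrow> bool" where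
  "l2_op_le M A B \<longleftrightarrow> l2_positive M (\<lambda>f x. B f x - A f x)"

text \<open>
  In the following definitions \<open>SOME\<close> picks a representative of an operator which, for bounded
  (respectively positive) arguments, exists and is unique up to \<open>l2_op_eq\<close>.
\<close>

definition l2_adjoint :: "'a measure \<Rightarrow> 'a fun_op \<Rightarrow> 'a fun_op" where
  "l2_adjoint M T = (SOME S. l2_bounded_op M S \<and>
     (\<forall>f\<in>l2_space M. \<forall>g\<in>l2_space M. l2_inner M (T f) g = l2_inner M f (S g)))"

definition l2_sqrt :: "'a measure \<Rightarrow> 'a fun_op \<Rightarrow> 'a fun_op" where
  "l2_sqrt M A = (SOME R. l2_positive M R \<and> l2_op_eq M (\<lambda>f. R (R f)) A)"

definition l2_abs :: "'a measure \<Rightarrow> 'a fun_op \<Rightarrow> 'a fun_op" where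
  "l2_abs M T = l2_sqrt M (\<lambda>f. l2_adjoint M T (T f))"

definition l2_partial_isometry :: "'a measure \<Rightarrow> 'a fun_op \<Rightarrow> bool" where
  "l2_partial_isometry M U \<longleftrightarrow> l2_bounded_op M U \<and>
     (\<forall>f\<in>l2_space M. (\<forall>g\<in>l2_ker M U. l2_inner M f g = 0) \<longrightarrow> l2_norm M (U f) = l2_norm M f)"

definition l2_polar :: "'a measure \<Rightarrow> 'a fun_op \<Rightarrow> 'a fun_op" where
  "l2_polar M T = (SOME U. l2_partial_isometry M U \<and>
     l2_op_eq M T (\<lambda>f. U (l2_abs M T f)) \<and> l2_ker M U = l2_ker M (l2_abs M T))"

definition aluthge :: "'a measure \<Rightarrow> 'a fun_op \<Rightarrow> 'a fun_op" where
  "aluthge M T = (let R = l2_sqrt M (l2_abs M T) in (\<lambda>f. R (l2_polar M T (R f))))"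

definition weakly_hyponormal :: "'a measure \<Rightarrow> 'a fun_op \<Rightarrow> bool" where
  "weakly_hyponormal M T \<longleftrightarrow>
     l2_op_le M (l2_abs M T) (l2_abs M (aluthge M T)) \<and>
     l2_op_le M (l2_abs M (l2_adjoint M (aluthge M T))) (l2_abs M T)"

end

theory Submission
  imports Defs
begin

text \<open>
  Operators \<open>f \<mapsto> \<alpha>E(\<beta>f)\<close> behave like operators of rank one whose scalars are the functions
  measurable in the subalgebra. Boundedness of \<open>T f = wE(uf)\<close> means that \<open>E(\<bar>u\<bar>\<^sup>2)E(\<bar>w\<bar>\<^sup>2)\<close> is
  essentially bounded (\<open>wct_op_bounded_moments\<close>), and this allows one to move the conditional norm
  of \<open>u\<close> over to \<open>w\<close>: \<open>T f = \<omega>E(\<nu>f)\<close>, where \<open>E(\<bar>\<nu>\<bar>\<^sup>2)\<close> is the indicator of a set \<open>S\<close> that carries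
  \<open>\<omega>\<close> and \<open>\<nu>\<close> (\<open>wct_op_normalize\<close>).

  In this form everything is explicit. Let \<open>P\<close> be the projection \<open>f \<mapsto> \<nu>\<^sup>*E(\<nu>f)\<close>, let \<open>b\<close> be the
  conditional norm of \<open>\<omega>\<close>, and \<open>c = E(\<nu>\<omega>)\<close>. Then \<open>T\<^sup>*T = b\<^sup>2P\<close>, so the modulus of \<open>T\<close> is \<open>bP\<close>, and
  its square root is \<open>\<surd>b P\<close> (\<open>T0_abs\<close>, \<open>Q_sqrt\<close>). The Aluthge transform is \<open>cP\<close> (\<open>T0_aluthge\<close>), a
  normal operator with modulus \<open>\<bar>c\<bar>P\<close> (\<open>Pc_abs\<close>). By the conditional Cauchy--Schwarz inequality
  \<open>\<bar>c\<bar> \<le> b\<close>, while weak hyponormality says \<open>\<bar>c\<bar>P \<ge> bP\<close>. Hence equality holds in the Cauchy--Schwarz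
  inequality, which makes \<open>\<omega>\<close> a multiple of \<open>\<nu>\<^sup>*\<close>, namely \<open>\<omega> = c\<nu>\<^sup>*\<close>; so \<open>T = cP\<close>. The last step is
  carried out in integrated form: \<open>\<parallel>(T - cP)f\<parallel>\<^sup>2 = \<integral>(b\<^sup>2 - \<bar>c\<bar>\<^sup>2)\<bar>E(\<nu>f)\<bar>\<^sup>2\<close> (\<open>norm_T0_minus_Pc\<close>,
  \<open>eq_aluthge\<close>).

  Adjoints, square roots and polar decompositions are given by \<open>SOME\<close>. To identify them with the
  explicit operators one needs uniqueness. For adjoints it is immediate. For the positive square
  root it is \<open>l2_positive_sqrt_unique\<close>, proved for arbitrary positive operators without spectral theory.
  For the partial isometry, existence suffices: on the range of the square root of the modulus it
  is determined by continuity (\<open>polar_sqrt\<close>).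
\<close>

section \<open>Conditional expectation beyond integrable functions\<close>

lemma borel_measurable_cnj [measurable (raw)]:
  "g \<in> borel_measurable M \<Longrightarrow> (\<lambda>x. cnj (g x)) \<in> borel_measurable M"
  by (rule borel_measurable_continuous_on[where f = cnj and g = g]) (auto intro: continuous_intros)

context sigma_finite_subalgebra
begin

lemma nn_cond_exp_0: "AE x in M. nn_cond_exp M F (\<lambda>x. 0) x = 0"
  using nn_cond_exp_F_meas[of "\<lambda>x. 0"] by auto

lemma nn_cond_exp_finite_if_nn_integral_finite:
  assumes [measurable]: "g \<in> borel_measurable M" and "(\<integral>\<^sup>+x. g x \<partial>M) < \<infinity>"
  shows "AE x in M. nn_cond_exp M F g x < \<infinity>"
proof -
  have "(\<integral>\<^sup>+x. nn_cond_exp M F g x \<partial>M) = (\<integral>\<^sup>+x. g x \<partial>M)"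
    using nn_cond_exp_intg[of "\<lambda>x. 1" g] by simp
  then have "AE x in M. nn_cond_exp M F g x \<noteq> \<infinity>"
    using assms by (intro nn_integral_PInf_AE) auto
  then show ?thesis by (simp add: less_top)
qed

text \<open>
  The conditional expectation does not depend on how a function is written as a difference of
  nonnegative functions with finite conditional expectations. Linearity on \<open>cond_exp_dom\<close>
  reduces to this: one chooses the decomposition of a sum or of a product that is additive.
\<close>

lemma real_cond_exp_diff_nonneg:
  fixes p q :: "'a \<Rightarrow> real"
  assumes [measurable]: "p \<in> borel_measurable M" "q \<in> borel_measurable M"
    and nn: "\<And>x. 0 \<le> p x" "\<And>x. 0 \<le> q x"
    and fin: "AE x in M. nn_cond_exp M F (\<lambda>x. ennreal (p x)) x < \<infinity>"
             "AE x in M. nn_cond_exp M F (\<lambda>x. ennreal (q x)) x < \<infinity>"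
  shows "AE x in M. real_cond_exp M F (\<lambda>x. p x - q x) x =
    enn2real (nn_cond_exp M F (\<lambda>x. ennreal (p x)) x) - enn2real (nn_cond_exp M F (\<lambda>x. ennreal (q x)) x)"
proof -
  let ?N = "\<lambda>g. nn_cond_exp M F (\<lambda>x. ennreal (g x))"
  let ?g = "\<lambda>x. p x - q x" and ?h = "\<lambda>x. - (p x - q x)"
  have split: "ennreal (?g x) + ennreal (q x) = ennreal (?h x) + ennreal (p x)" for x
    using nn[of x] by (cases "p x \<le> q x")
      (auto simp: ennreal_neg ennreal_plus[symmetric] simp del: ennreal_plus)
  have s1: "AE x in M. ?N ?g x + ?N q x = nn_cond_exp M F (\<lambda>x. ennreal (?g x) + ennreal (q x)) x"
    by (rule nn_cond_exp_sum) auto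
  have s2: "AE x in M. ?N ?h x + ?N p x = nn_cond_exp M F (\<lambda>x. ennreal (?g x) + ennreal (q x)) x"
    unfolding split by (rule nn_cond_exp_sum) auto
  have l1: "AE x in M. ?N ?g x \<le> ?N p x"
    using nn by (intro nn_cond_exp_mono) (auto intro!: ennreal_leI)
  have l2: "AE x in M. ?N ?h x \<le> ?N q x"
    using nn by (intro nn_cond_exp_mono) (auto intro!: ennreal_leI)
  show ?thesis
    using s1 s2 l1 l2 fin
  proof eventually_elim
    case (elim x)
    have f: "?N ?g x < top" "?N ?h x < top" using elim by auto
    have "?N ?g x + ?N q x = ?N ?h x + ?N p x" using elim by simp
    then have "enn2real (?N ?g x + ?N q x) = enn2real (?N ?h x + ?N p x)" by simp
    then have "enn2real (?N ?g x) + enn2real (?N q x) = enn2real (?N ?h x) + enn2real (?N p x)"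
      using f elim by (subst (asm) (1 2) enn2real_plus) (auto simp: less_top)
    then show ?case unfolding real_cond_exp_def by simp
  qed
qed

lemma nn_cond_exp_abs_finite_parts:
  fixes g :: "'a \<Rightarrow> real"
  assumes [measurable]: "g \<in> borel_measurable M"
    and fin: "AE x in M. nn_cond_exp M F (\<lambda>x. ennreal \<bar>g x\<bar>) x < \<infinity>"
  shows "AE x in M. nn_cond_exp M F (\<lambda>x. ennreal (max (g x) 0)) x < \<infinity>"
    and "AE x in M. nn_cond_exp M F (\<lambda>x. ennreal (max (- g x) 0)) x < \<infinity>"
proof -
  have "AE x in M. nn_cond_exp M F (\<lambda>x. ennreal (max (g x) 0)) x \<le> nn_cond_exp M F (\<lambda>x. ennreal \<bar>g x\<bar>) x"
    by (rule nn_cond_exp_mono) (auto intro!: ennreal_leI)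
  then show "AE x in M. nn_cond_exp M F (\<lambda>x. ennreal (max (g x) 0)) x < \<infinity>"
    using fin by eventually_elim auto
  have "AE x in M. nn_cond_exp M F (\<lambda>x. ennreal (max (- g x) 0)) x \<le> nn_cond_exp M F (\<lambda>x. ennreal \<bar>g x\<bar>) x"
    by (rule nn_cond_exp_mono) (auto intro!: ennreal_leI)
  then show "AE x in M. nn_cond_exp M F (\<lambda>x. ennreal (max (- g x) 0)) x < \<infinity>"
    using fin by eventually_elim auto
qed

lemma real_cond_exp_eq_parts:
  "real_cond_exp M F g x = enn2real (nn_cond_exp M F (\<lambda>x. ennreal (max (g x) 0)) x)
     - enn2real (nn_cond_exp M F (\<lambda>x. ennreal (max (- g x) 0)) x)"
proof -
  have "ennreal (max (r::real) 0) = ennreal r" for r by (auto simp: max_def ennreal_neg)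
  then show ?thesis unfolding real_cond_exp_def by simp
qed

lemma real_cond_exp_add_finite:
  fixes g h :: "'a \<Rightarrow> real"
  assumes [measurable]: "g \<in> borel_measurable M" "h \<in> borel_measurable M"
    and g: "AE x in M. nn_cond_exp M F (\<lambda>x. ennreal \<bar>g x\<bar>) x < \<infinity>"
    and h: "AE x in M. nn_cond_exp M F (\<lambda>x. ennreal \<bar>h x\<bar>) x < \<infinity>"
  shows "AE x in M. real_cond_exp M F (\<lambda>x. g x + h x) x = real_cond_exp M F g x + real_cond_exp M F h x"
proof -
  let ?N = "\<lambda>g. nn_cond_exp M F (\<lambda>x. ennreal (g x))"
  let ?p = "\<lambda>g x. max (g x) (0::real)"
  let ?m = "\<lambda>g x. max (- g x) (0::real)"
  note G = nn_cond_exp_abs_finite_parts[OF assms(1) g] and H = nn_cond_exp_abs_finite_parts[OF assms(2) h]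
  have sp: "AE x in M. ?N (?p g) x + ?N (?p h) x = ?N (\<lambda>x. ?p g x + ?p h x) x"
    using nn_cond_exp_sum[of "\<lambda>x. ennreal (?p g x)" "\<lambda>x. ennreal (?p h x)"] by simp
  have sm: "AE x in M. ?N (?m g) x + ?N (?m h) x = ?N (\<lambda>x. ?m g x + ?m h x) x"
    using nn_cond_exp_sum[of "\<lambda>x. ennreal (?m g x)" "\<lambda>x. ennreal (?m h x)"] by simp
  have eq: "g x + h x = (?p g x + ?p h x) - (?m g x + ?m h x)" for x by (auto simp: max_def)
  have "AE x in M. real_cond_exp M F (\<lambda>x. (?p g x + ?p h x) - (?m g x + ?m h x)) x =
     enn2real (?N (\<lambda>x. ?p g x + ?p h x) x) - enn2real (?N (\<lambda>x. ?m g x + ?m h x) x)"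
  proof (rule real_cond_exp_diff_nonneg)
    show "AE x in M. ?N (\<lambda>x. ?p g x + ?p h x) x < \<infinity>"
      using sp G H by eventually_elim (drule sym, simp)
    show "AE x in M. ?N (\<lambda>x. ?m g x + ?m h x) x < \<infinity>"
      using sm G H by eventually_elim (drule sym, simp)
  qed auto
  then show ?thesis
    unfolding eq[symmetric] using sp sm G H
  proof eventually_elim
    case (elim x)
    show ?case
      unfolding elim(1) elim(2)[symmetric] elim(3)[symmetric] real_cond_exp_eq_parts[of g] real_cond_exp_eq_parts[of h]
      using elim by (subst (1 2) enn2real_plus) (auto simp: less_top)
  qed
qed

lemma real_cond_exp_mult_finite:
  fixes a g :: "'a \<Rightarrow> real"
  assumes aF[measurable]: "a \<in> borel_measurable F" and [measurable]: "g \<in> borel_measurable M"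
    and g: "AE x in M. nn_cond_exp M F (\<lambda>x. ennreal \<bar>g x\<bar>) x < \<infinity>"
  shows "AE x in M. real_cond_exp M F (\<lambda>x. a x * g x) x = a x * real_cond_exp M F g x"
    and "AE x in M. nn_cond_exp M F (\<lambda>x. ennreal \<bar>a x * g x\<bar>) x < \<infinity>"
proof -
  let ?N = "\<lambda>g. nn_cond_exp M F (\<lambda>x. ennreal (g x))"
  let ?p = "\<lambda>g x. max (g x) (0::real)"
  let ?m = "\<lambda>g x. max (- g x) (0::real)"
  have aM[measurable]: "a \<in> borel_measurable M" by (rule measurable_from_subalg[OF subalg aF])
  note G = nn_cond_exp_abs_finite_parts[OF assms(2) g]
  have N: "AE x in M. ennreal (c x) * ?N k x = ?N (\<lambda>x. c x * k x) x"
    if "c \<in> borel_measurable F" "k \<in> borel_measurable M" "\<And>x. 0 \<le> c x" "\<And>x. 0 \<le> k x" for c k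
    using nn_cond_exp_prod[of "\<lambda>x. ennreal (c x)" "\<lambda>x. ennreal (k x)"] that
    by (simp add: ennreal_mult)
  have N2: "AE x in M. ?N (\<lambda>x. c x * k x + c' x * k' x) x = ennreal (c x) * ?N k x + ennreal (c' x) * ?N k' x"
    if [measurable]: "c \<in> borel_measurable F" "k \<in> borel_measurable M" "c' \<in> borel_measurable F" "k' \<in> borel_measurable M"
      and nn: "\<And>x. 0 \<le> c x" "\<And>x. 0 \<le> k x" "\<And>x. 0 \<le> c' x" "\<And>x. 0 \<le> k' x" for c k c' k'
  proof -
    have [measurable]: "c \<in> borel_measurable M" "c' \<in> borel_measurable M"
      using that(1,3) by (auto intro: measurable_from_subalg[OF subalg])
    have eq: "ennreal (c x * k x + c' x * k' x) = ennreal (c x * k x) + ennreal (c' x * k' x)" for x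
      using nn by simp
    have "AE x in M. ?N (\<lambda>x. c x * k x) x + ?N (\<lambda>x. c' x * k' x) x
        = nn_cond_exp M F (\<lambda>x. ennreal (c x * k x) + ennreal (c' x * k' x)) x"
      by (rule nn_cond_exp_sum) auto
    moreover have "AE x in M. ennreal (c x) * ?N k x = ?N (\<lambda>x. c x * k x) x"
      "AE x in M. ennreal (c' x) * ?N k' x = ?N (\<lambda>x. c' x * k' x) x"
      by (rule N; use that in simp)+
    ultimately show ?thesis unfolding eq by eventually_elim simp
  qed
  have eq: "a x * g x = (?p a x * ?p g x + ?m a x * ?m g x) - (?p a x * ?m g x + ?m a x * ?p g x)" for x
    by (auto simp: max_def)
  have p: "AE x in M. ?N (\<lambda>x. ?p a x * ?p g x + ?m a x * ?m g x) x
      = ennreal (?p a x) * ?N (?p g) x + ennreal (?m a x) * ?N (?m g) x"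
    by (rule N2) auto
  have m: "AE x in M. ?N (\<lambda>x. ?p a x * ?m g x + ?m a x * ?p g x) x
      = ennreal (?p a x) * ?N (?m g) x + ennreal (?m a x) * ?N (?p g) x"
    by (rule N2) auto
  have "AE x in M. real_cond_exp M F
      (\<lambda>x. (?p a x * ?p g x + ?m a x * ?m g x) - (?p a x * ?m g x + ?m a x * ?p g x)) x =
    enn2real (?N (\<lambda>x. ?p a x * ?p g x + ?m a x * ?m g x) x) - enn2real (?N (\<lambda>x. ?p a x * ?m g x + ?m a x * ?p g x) x)"
  proof (rule real_cond_exp_diff_nonneg)
    show "AE x in M. ?N (\<lambda>x. ?p a x * ?p g x + ?m a x * ?m g x) x < \<infinity>"
      using p G by eventually_elim (auto simp: ennreal_mult_less_top)
    show "AE x in M. ?N (\<lambda>x. ?p a x * ?m g x + ?m a x * ?p g x) x < \<infinity>"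
      using m G by eventually_elim (auto simp: ennreal_mult_less_top)
  qed auto
  then show "AE x in M. real_cond_exp M F (\<lambda>x. a x * g x) x = a x * real_cond_exp M F g x"
    unfolding eq[symmetric] using p m G
  proof eventually_elim
    case (elim x)
    show ?case
      unfolding elim(1) elim(2) elim(3) real_cond_exp_eq_parts[of g]
      using elim by (subst (1 2) enn2real_plus)
        (auto simp: less_top[symmetric] ennreal_mult_eq_top_iff enn2real_mult max_def algebra_simps)
  qed
  have "AE x in M. ennreal \<bar>a x\<bar> * ?N (\<lambda>x. \<bar>g x\<bar>) x = ?N (\<lambda>x. \<bar>a x\<bar> * \<bar>g x\<bar>) x"
    by (rule N) auto
  then show "AE x in M. nn_cond_exp M F (\<lambda>x. ennreal \<bar>a x * g x\<bar>) x < \<infinity>"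
    unfolding abs_mult using g by eventually_elim (drule sym, simp add: ennreal_mult_less_top)
qed

lemma cond_exp_domD:
  assumes "g \<in> cond_exp_dom M F"
  shows "g \<in> borel_measurable M"
    "AE x in M. nn_cond_exp M F (\<lambda>x. ennreal \<bar>Re (g x)\<bar>) x < \<infinity>"
    "AE x in M. nn_cond_exp M F (\<lambda>x. ennreal \<bar>Im (g x)\<bar>) x < \<infinity>"
proof -
  show [measurable]: "g \<in> borel_measurable M" using assms by (simp add: cond_exp_dom_def)
  have fin: "AE x in M. nn_cond_exp M F (\<lambda>x. ennreal (cmod (g x))) x < \<infinity>"
    using assms by (simp add: cond_exp_dom_def)
  have "AE x in M. nn_cond_exp M F (\<lambda>x. ennreal \<bar>Re (g x)\<bar>) x \<le> nn_cond_exp M F (\<lambda>x. ennreal (cmod (g x))) x"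
    by (rule nn_cond_exp_mono) (auto intro!: ennreal_leI abs_Re_le_cmod)
  then show "AE x in M. nn_cond_exp M F (\<lambda>x. ennreal \<bar>Re (g x)\<bar>) x < \<infinity>"
    using fin by eventually_elim auto
  have "AE x in M. nn_cond_exp M F (\<lambda>x. ennreal \<bar>Im (g x)\<bar>) x \<le> nn_cond_exp M F (\<lambda>x. ennreal (cmod (g x))) x"
    by (rule nn_cond_exp_mono) (auto intro!: ennreal_leI abs_Im_le_cmod)
  then show "AE x in M. nn_cond_exp M F (\<lambda>x. ennreal \<bar>Im (g x)\<bar>) x < \<infinity>"
    using fin by eventually_elim auto
qed

lemma cond_exp_domI:
  assumes [measurable]: "g \<in> borel_measurable M" "b \<in> borel_measurable M"
    and le: "AE x in M. ennreal (cmod (g x)) \<le> b x"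
    and fin: "AE x in M. nn_cond_exp M F b x < \<infinity>"
  shows "g \<in> cond_exp_dom M F"
proof -
  have "AE x in M. nn_cond_exp M F (\<lambda>x. ennreal (cmod (g x))) x \<le> nn_cond_exp M F b x"
    by (rule nn_cond_exp_mono) (use le in auto)
  then show ?thesis unfolding cond_exp_dom_def using fin by (auto elim: eventually_elim2)
qed

lemma cond_exp_dom_add:
  assumes "g \<in> cond_exp_dom M F" "h \<in> cond_exp_dom M F"
  shows "(\<lambda>x. g x + h x) \<in> cond_exp_dom M F"
proof -
  have [measurable]: "g \<in> borel_measurable M" "h \<in> borel_measurable M"
    using assms by (auto simp: cond_exp_dom_def)
  show ?thesis
  proof (rule cond_exp_domI[where b="\<lambda>x. ennreal (cmod (g x)) + ennreal (cmod (h x))"])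
    show "AE x in M. ennreal (cmod (g x + h x)) \<le> ennreal (cmod (g x)) + ennreal (cmod (h x))"
      by (auto simp: ennreal_plus[symmetric] norm_triangle_ineq simp del: ennreal_plus intro!: ennreal_leI)
    have "AE x in M. nn_cond_exp M F (\<lambda>x. ennreal (cmod (g x))) x < \<infinity>"
      "AE x in M. nn_cond_exp M F (\<lambda>x. ennreal (cmod (h x))) x < \<infinity>"
      using assms by (auto simp: cond_exp_dom_def)
    moreover have "AE x in M. nn_cond_exp M F (\<lambda>x. ennreal (cmod (g x))) x + nn_cond_exp M F (\<lambda>x. ennreal (cmod (h x))) x
        = nn_cond_exp M F (\<lambda>x. ennreal (cmod (g x)) + ennreal (cmod (h x))) x"
      by (rule nn_cond_exp_sum) auto
    ultimately show "AE x in M. nn_cond_exp M F (\<lambda>x. ennreal (cmod (g x)) + ennreal (cmod (h x))) x < \<infinity>"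
      by eventually_elim (drule sym, simp)
  qed auto
qed

lemma cond_exp_dom_mult:
  assumes [measurable]: "a \<in> borel_measurable F" and "g \<in> cond_exp_dom M F"
  shows "(\<lambda>x. a x * g x) \<in> cond_exp_dom M F"
proof -
  have [measurable]: "g \<in> borel_measurable M" "a \<in> borel_measurable M"
    using assms by (auto simp: cond_exp_dom_def intro: measurable_from_subalg[OF subalg])
  have "AE x in M. ennreal (cmod (a x)) * nn_cond_exp M F (\<lambda>x. ennreal (cmod (g x))) x
      = nn_cond_exp M F (\<lambda>x. ennreal (cmod (a x)) * ennreal (cmod (g x))) x"
    by (rule nn_cond_exp_prod) auto
  moreover have "AE x in M. nn_cond_exp M F (\<lambda>x. ennreal (cmod (g x))) x < \<infinity>"
    using assms by (simp add: cond_exp_dom_def)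
  ultimately have "AE x in M. nn_cond_exp M F (\<lambda>x. ennreal (cmod (a x)) * ennreal (cmod (g x))) x < \<infinity>"
    by eventually_elim (drule sym, simp add: ennreal_mult_less_top)
  then show ?thesis
    by (intro cond_exp_domI[where b="\<lambda>x. ennreal (cmod (a x)) * ennreal (cmod (g x))"])
      (auto simp: norm_mult ennreal_mult)
qed

lemma complex_cond_exp_measurable [measurable]:
  "complex_cond_exp M F g \<in> borel_measurable F" "complex_cond_exp M F g \<in> borel_measurable M"
proof -
  have *: "Complex r i = of_real r + \<i> * of_real i" for r i by (simp add: complex_eq_iff)
  show "complex_cond_exp M F g \<in> borel_measurable F" "complex_cond_exp M F g \<in> borel_measurable M"
    unfolding complex_cond_exp_def * by measurable
qed

lemma complex_cond_exp_cong:
  assumes "AE x in M. g x = h x" and [measurable]: "g \<in> borel_measurable M" "h \<in> borel_measurable M"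
  shows "AE x in M. complex_cond_exp M F g x = complex_cond_exp M F h x"
proof -
  have "AE x in M. real_cond_exp M F (\<lambda>y. Re (g y)) x = real_cond_exp M F (\<lambda>y. Re (h y)) x"
    by (rule real_cond_exp_cong) (use assms in auto)
  moreover have "AE x in M. real_cond_exp M F (\<lambda>y. Im (g y)) x = real_cond_exp M F (\<lambda>y. Im (h y)) x"
    by (rule real_cond_exp_cong) (use assms in auto)
  ultimately show ?thesis unfolding complex_cond_exp_def by eventually_elim auto
qed

lemma complex_cond_exp_zero: "AE x in M. complex_cond_exp M F (\<lambda>x. 0) x = 0"
  using nn_cond_exp_0 unfolding complex_cond_exp_def real_cond_exp_def
  by eventually_elim (simp add: complex_eq_iff)

lemma complex_cond_exp_cnj:
  "complex_cond_exp M F (\<lambda>x. cnj (g x)) x = cnj (complex_cond_exp M F g x)"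
  unfolding complex_cond_exp_def real_cond_exp_def by (simp add: complex_eq_iff)

lemma complex_cond_exp_add:
  assumes "g \<in> cond_exp_dom M F" "h \<in> cond_exp_dom M F"
  shows "AE x in M. complex_cond_exp M F (\<lambda>x. g x + h x) x = complex_cond_exp M F g x + complex_cond_exp M F h x"
proof -
  note G = cond_exp_domD[OF assms(1)] and H = cond_exp_domD[OF assms(2)]
  note [measurable] = G(1) H(1)
  have "AE x in M. real_cond_exp M F (\<lambda>x. Re (g x) + Re (h x)) x
      = real_cond_exp M F (\<lambda>x. Re (g x)) x + real_cond_exp M F (\<lambda>x. Re (h x)) x"
    by (rule real_cond_exp_add_finite) (use G H in auto)
  moreover have "AE x in M. real_cond_exp M F (\<lambda>x. Im (g x) + Im (h x)) x
      = real_cond_exp M F (\<lambda>x. Im (g x)) x + real_cond_exp M F (\<lambda>x. Im (h x)) x"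
    by (rule real_cond_exp_add_finite) (use G H in auto)
  ultimately show ?thesis
    unfolding complex_cond_exp_def by eventually_elim (simp add: complex_eq_iff)
qed

lemma complex_cond_exp_mult:
  assumes [measurable]: "a \<in> borel_measurable F" and "g \<in> cond_exp_dom M F"
  shows "AE x in M. complex_cond_exp M F (\<lambda>x. a x * g x) x = a x * complex_cond_exp M F g x"
proof -
  note G = cond_exp_domD[OF assms(2)]
  have aM: "a \<in> borel_measurable M"
    by (rule measurable_from_subalg[OF subalg]) simp
  note [measurable] = G(1) aM
  let ?R = "real_cond_exp M F"
  have rr: "AE x in M. ?R (\<lambda>x. c x * k x) x = c x * ?R k x"
       "AE x in M. nn_cond_exp M F (\<lambda>x. ennreal \<bar>c x * k x\<bar>) x < \<infinity>"
    if "c \<in> {\<lambda>x. Re (a x), \<lambda>x. Im (a x), \<lambda>x. - Im (a x)}" "k \<in> {\<lambda>x. Re (g x), \<lambda>x. Im (g x)}" for c k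
    by (rule real_cond_exp_mult_finite; use that G in auto)+
  have "AE x in M. ?R (\<lambda>x. Re (a x) * Re (g x) + (- Im (a x)) * Im (g x)) x =
       ?R (\<lambda>x. Re (a x) * Re (g x)) x + ?R (\<lambda>x. (- Im (a x)) * Im (g x)) x"
    by (intro real_cond_exp_add_finite rr) auto
  moreover have "AE x in M. ?R (\<lambda>x. Re (a x) * Im (g x) + Im (a x) * Re (g x)) x =
       ?R (\<lambda>x. Re (a x) * Im (g x)) x + ?R (\<lambda>x. Im (a x) * Re (g x)) x"
    by (intro real_cond_exp_add_finite rr) auto
  moreover have "AE x in M. ?R (\<lambda>x. Re (a x) * Re (g x)) x = Re (a x) * ?R (\<lambda>x. Re (g x)) x"
      "AE x in M. ?R (\<lambda>x. (- Im (a x)) * Im (g x)) x = (- Im (a x)) * ?R (\<lambda>x. Im (g x)) x"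
      "AE x in M. ?R (\<lambda>x. Re (a x) * Im (g x)) x = Re (a x) * ?R (\<lambda>x. Im (g x)) x"
      "AE x in M. ?R (\<lambda>x. Im (a x) * Re (g x)) x = Im (a x) * ?R (\<lambda>x. Re (g x)) x"
    by (rule rr; simp)+
  ultimately show ?thesis
    unfolding complex_cond_exp_def by eventually_elim (simp add: complex_eq_iff)
qed

lemma complex_cond_exp_nonneg:
  fixes r :: "'a \<Rightarrow> real"
  assumes [measurable]: "r \<in> borel_measurable M" and nn: "\<And>x. 0 \<le> r x"
  shows "AE x in M. complex_cond_exp M F (\<lambda>x. of_real (r x)) x
    = of_real (enn2real (nn_cond_exp M F (\<lambda>x. ennreal (r x)) x))"
proof -
  have *: "ennreal (- r x) = 0" for x using nn[of x] by (simp add: ennreal_neg)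
  show ?thesis
    unfolding complex_cond_exp_def real_cond_exp_def using nn_cond_exp_0
    by eventually_elim (simp add: complex_eq_iff *)
qed

text \<open>
  Only the product has to be integrable, not \<open>g\<close>. This is what makes the adjoints of weighted
  operators computable, since their weights are in general not square integrable.
\<close>

lemma complex_cond_exp_intg:
  assumes int: "integrable M (\<lambda>x. a x * g x)"
    and aF[measurable]: "a \<in> borel_measurable F" and [measurable]: "g \<in> borel_measurable M"
  shows "integrable M (\<lambda>x. a x * complex_cond_exp M F g x)"
    and "(\<integral>x. a x * complex_cond_exp M F g x \<partial>M) = (\<integral>x. a x * g x \<partial>M)"
proof -
  have aM[measurable]: "a \<in> borel_measurable M"
    by (rule measurable_from_subalg[OF subalg aF])
  let ?R = "real_cond_exp M F"
  have i: "integrable M (\<lambda>x. c x * k x)"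
    if "c \<in> {\<lambda>x. Re (a x), \<lambda>x. Im (a x)}" "k \<in> {\<lambda>x. Re (g x), \<lambda>x. Im (g x)}" for c k
  proof (rule Bochner_Integration.integrable_bound[OF int])
    have "\<bar>c x\<bar> \<le> cmod (a x)" "\<bar>k x\<bar> \<le> cmod (g x)" for x
      using that abs_Re_le_cmod abs_Im_le_cmod by auto
    then show "AE x in M. norm (c x * k x) \<le> norm (a x * g x)"
      by (auto simp: abs_mult norm_mult intro!: mult_mono)
    show "(\<lambda>x. c x * k x) \<in> borel_measurable M" using that by auto
  qed
  have ii: "integrable M (\<lambda>x. c x * ?R k x)" "(\<integral>x. c x * ?R k x \<partial>M) = (\<integral>x. c x * k x \<partial>M)"
    if "c \<in> {\<lambda>x. Re (a x), \<lambda>x. Im (a x)}" "k \<in> {\<lambda>x. Re (g x), \<lambda>x. Im (g x)}" for c k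
    by (rule real_cond_exp_intg; use that i[OF that] in auto)+
  have eq: "a x * z = complex_of_real (Re (a x) * Re z - Im (a x) * Im z)
     + \<i> * complex_of_real (Re (a x) * Im z + Im (a x) * Re z)" for x z
    by (simp add: complex_eq_iff)
  have lin: "(\<integral>x. complex_of_real (p x) + \<i> * complex_of_real (q x) \<partial>M)
      = complex_of_real (\<integral>x. p x \<partial>M) + \<i> * complex_of_real (\<integral>x. q x \<partial>M)"
    if "integrable M p" "integrable M q" for p q
    using that by simp
  show "integrable M (\<lambda>x. a x * complex_cond_exp M F g x)"
    unfolding eq complex_cond_exp_def complex.sel
    by (intro Bochner_Integration.integrable_add Bochner_Integration.integrable_diff
        integrable_mult_right integrable_of_real ii) auto
  show "(\<integral>x. a x * complex_cond_exp M F g x \<partial>M) = (\<integral>x. a x * g x \<partial>M)"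
    unfolding eq complex_cond_exp_def complex.sel by (subst (1 2) lin) (auto intro!: i ii simp: i ii)
qed

end

section \<open>The geometry of \<open>L\<^sup>2\<close>\<close>

lemma l2_space_mult_integrable:
  assumes "f \<in> l2_space M" "g \<in> l2_space M"
  shows "integrable M (\<lambda>x. f x * g x)"
proof (rule Bochner_Integration.integrable_bound)
  show "integrable M (\<lambda>x. (cmod (f x))\<^sup>2 + (cmod (g x))\<^sup>2)"
    using assms by (auto simp: l2_space_def)
  have "a * b \<le> a\<^sup>2 + b\<^sup>2" for a b :: real
    using zero_le_power2[of "a - b"] zero_le_power2[of a] zero_le_power2[of b] power2_diff[of a b]
    by linarith
  then show "AE x in M. norm (f x * g x) \<le> norm ((cmod (f x))\<^sup>2 + (cmod (g x))\<^sup>2)"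
    by (simp add: norm_mult)
  show "(\<lambda>x. f x * g x) \<in> borel_measurable M"
    using assms by (auto simp: l2_space_def)
qed

lemma l2_space_cnj: "f \<in> l2_space M \<Longrightarrow> (\<lambda>x. cnj (f x)) \<in> l2_space M"
  by (auto simp: l2_space_def intro: borel_measurable_cnj)

lemma l2_inner_integrable:
  "f \<in> l2_space M \<Longrightarrow> g \<in> l2_space M \<Longrightarrow> integrable M (\<lambda>x. f x * cnj (g x))"
  using l2_space_mult_integrable[OF _ l2_space_cnj] by blast

lemma l2_space_scale: "f \<in> l2_space M \<Longrightarrow> (\<lambda>x. c * f x) \<in> l2_space M"
  by (auto simp: l2_space_def norm_mult power_mult_distrib)

lemma l2_space_add:
  assumes "f \<in> l2_space M" "g \<in> l2_space M"
  shows "(\<lambda>x. f x + g x) \<in> l2_space M"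
proof -
  have [measurable]: "f \<in> borel_measurable M" "g \<in> borel_measurable M"
    using assms by (auto simp: l2_space_def)
  have "integrable M (\<lambda>x. (cmod (f x + g x))\<^sup>2)"
  proof (rule Bochner_Integration.integrable_bound)
    show "integrable M (\<lambda>x. 2 * (cmod (f x))\<^sup>2 + 2 * (cmod (g x))\<^sup>2)"
      using assms by (auto simp: l2_space_def)
    have "(cmod (f x + g x))\<^sup>2 \<le> 2 * (cmod (f x))\<^sup>2 + 2 * (cmod (g x))\<^sup>2" for x
    proof -
      have "(cmod (f x + g x))\<^sup>2 \<le> (cmod (f x) + cmod (g x))\<^sup>2"
        by (intro power_mono norm_triangle_ineq) auto
      also have "\<dots> \<le> 2 * (cmod (f x))\<^sup>2 + 2 * (cmod (g x))\<^sup>2"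
        using zero_le_power2[of "cmod (f x) - cmod (g x)"] by (simp add: power2_diff power2_sum)
      finally show ?thesis .
    qed
    then show "AE x in M. norm ((cmod (f x + g x))\<^sup>2) \<le> norm (2 * (cmod (f x))\<^sup>2 + 2 * (cmod (g x))\<^sup>2)"
      by simp
  qed simp
  then show ?thesis by (simp add: l2_space_def)
qed

lemma l2_space_diff:
  assumes "f \<in> l2_space M" "g \<in> l2_space M"
  shows "(\<lambda>x. f x - g x) \<in> l2_space M"
  using l2_space_add[OF assms(1) l2_space_scale[OF assms(2), of "-1"]] by simp

lemma l2_space_uminus: "f \<in> l2_space M \<Longrightarrow> (\<lambda>x. - f x) \<in> l2_space M"
  using l2_space_scale[of f M "-1"] by simp

lemma l2_space_cong_AE:
  assumes "f \<in> l2_space M" "AE x in M. f x = g x" "g \<in> borel_measurable M"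
  shows "g \<in> l2_space M"
proof -
  have "integrable M (\<lambda>x. (cmod (f x))\<^sup>2) \<longleftrightarrow> integrable M (\<lambda>x. (cmod (g x))\<^sup>2)"
    using assms by (intro integrable_cong_AE) (auto simp: l2_space_def)
  then show ?thesis using assms by (simp add: l2_space_def)
qed

lemmas l2_space_intros = l2_space_add l2_space_diff l2_space_scale l2_space_uminus

lemma l2_inner_add_left:
  "f \<in> l2_space M \<Longrightarrow> g \<in> l2_space M \<Longrightarrow> h \<in> l2_space M \<Longrightarrow>
    l2_inner M (\<lambda>x. f x + g x) h = l2_inner M f h + l2_inner M g h"
  by (simp add: l2_inner_def distrib_right l2_inner_integrable)

lemma l2_inner_add_right:
  "f \<in> l2_space M \<Longrightarrow> g \<in> l2_space M \<Longrightarrow> h \<in> l2_space M \<Longrightarrow>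
    l2_inner M h (\<lambda>x. f x + g x) = l2_inner M h f + l2_inner M h g"
  by (simp add: l2_inner_def distrib_left l2_inner_integrable)

lemma l2_inner_diff_left:
  "f \<in> l2_space M \<Longrightarrow> g \<in> l2_space M \<Longrightarrow> h \<in> l2_space M \<Longrightarrow>
    l2_inner M (\<lambda>x. f x - g x) h = l2_inner M f h - l2_inner M g h"
  by (simp add: l2_inner_def left_diff_distrib l2_inner_integrable)

lemma l2_inner_diff_right:
  "f \<in> l2_space M \<Longrightarrow> g \<in> l2_space M \<Longrightarrow> h \<in> l2_space M \<Longrightarrow>
    l2_inner M h (\<lambda>x. f x - g x) = l2_inner M h f - l2_inner M h g"
  by (simp add: l2_inner_def right_diff_distrib l2_inner_integrable)

lemma l2_inner_scale_left: "l2_inner M (\<lambda>x. c * f x) g = c * l2_inner M f g"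
  by (simp add: l2_inner_def mult.assoc)

lemma l2_inner_scale_right: "l2_inner M f (\<lambda>x. c * g x) = cnj c * l2_inner M f g"
proof -
  have "f x * cnj (c * g x) = cnj c * (f x * cnj (g x))" for x by simp
  then show ?thesis unfolding l2_inner_def by (simp only: integral_mult_right_zero)
qed

lemma l2_inner_uminus_left: "l2_inner M (\<lambda>x. - f x) g = - l2_inner M f g"
  by (simp add: l2_inner_def)

lemmas l2_inner_linear = l2_inner_add_left l2_inner_add_right l2_inner_diff_left l2_inner_diff_right
  l2_inner_scale_left l2_inner_scale_right

lemma l2_inner_commute: "l2_inner M g f = cnj (l2_inner M f g)"
  unfolding l2_inner_def Bochner_Integration.integral_cnj[symmetric] by (simp add: mult.commute)

lemma l2_inner_cong_AE:
  assumes "AE x in M. f x = f' x" "AE x in M. g x = g' x"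
    and "f \<in> l2_space M" "f' \<in> l2_space M" "g \<in> l2_space M" "g' \<in> l2_space M"
  shows "l2_inner M f g = l2_inner M f' g'"
  unfolding l2_inner_def
proof (rule integral_cong_AE)
  show "AE x in M. f x * cnj (g x) = f' x * cnj (g' x)"
    using assms(1,2) by eventually_elim simp
qed (use assms in \<open>auto simp: l2_space_def intro!: borel_measurable_times borel_measurable_cnj\<close>)

lemma l2_inner_self:
  "l2_inner M f f = of_real ((l2_norm M f)\<^sup>2)"
proof -
  have "f x * cnj (f x) = of_real ((cmod (f x))\<^sup>2)" for x
    by (metis complex_norm_square of_real_power)
  then have "l2_inner M f f = (\<integral>x. complex_of_real ((cmod (f x))\<^sup>2) \<partial>M)"
    unfolding l2_inner_def by (simp only:)
  then show ?thesis unfolding l2_norm_def by (simp only: integral_complex_of_real) simp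
qed

lemma l2_norm_nonneg [simp]: "0 \<le> l2_norm M f"
  by (simp add: l2_norm_def)

lemma l2_norm_eq_0_iff:
  assumes "f \<in> l2_space M"
  shows "l2_norm M f = 0 \<longleftrightarrow> (AE x in M. f x = 0)"
  using assms unfolding l2_norm_def l2_space_def
  by (simp add: integral_nonneg_eq_0_iff_AE)

lemma l2_norm_cong_AE:
  assumes "AE x in M. f x = g x" "f \<in> borel_measurable M" "g \<in> borel_measurable M"
  shows "l2_norm M f = l2_norm M g"
  unfolding l2_norm_def using assms by (intro arg_cong[where f=sqrt] integral_cong_AE) auto

lemma l2_norm_scale: "l2_norm M (\<lambda>x. c * f x) = cmod c * l2_norm M f"
  by (simp add: l2_norm_def norm_mult power_mult_distrib real_sqrt_mult)

lemma l2_eqI: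
  assumes "f \<in> l2_space M" "g \<in> l2_space M"
    and eq: "\<And>h. h \<in> l2_space M \<Longrightarrow> l2_inner M h f = l2_inner M h g"
  shows "AE x in M. f x = g x"
proof -
  let ?d = "\<lambda>x. f x - g x"
  have d: "?d \<in> l2_space M" by (rule l2_space_diff[OF assms(1,2)])
  have "l2_inner M ?d ?d = 0"
    using l2_inner_diff_right[OF assms(1,2) d] eq[OF d] by simp
  then have "l2_norm M ?d = 0" by (simp add: l2_inner_self)
  then show ?thesis using l2_norm_eq_0_iff[OF d] by simp
qed

lemma l2_Cauchy_Schwarz:
  assumes f: "f \<in> l2_space M" and g: "g \<in> l2_space M"
  shows "cmod (l2_inner M f g) \<le> l2_norm M f * l2_norm M g"
proof (cases "l2_norm M g = 0")
  case True
  then have "AE x in M. g x = 0" using l2_norm_eq_0_iff[OF g] by simp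
  then have "l2_inner M f g = l2_inner M f (\<lambda>x. 0 * g x)"
    using f g by (intro l2_inner_cong_AE l2_space_scale) auto
  then show ?thesis using True by (simp add: l2_inner_scale_right l2_inner_def)
next
  case False
  define n where "n = l2_norm M g"
  have n: "n > 0" using False l2_norm_nonneg[of M g] unfolding n_def by linarith
  define c where "c = l2_inner M f g"
  let ?h = "\<lambda>x. f x - (c / of_real (n\<^sup>2)) * g x"
  have expand: "l2_inner M (\<lambda>x. f x - d * g x) (\<lambda>x. f x - d * g x)
      = l2_inner M f f - cnj d * c - d * cnj c + d * cnj d * of_real (n\<^sup>2)" for d
    using f g l2_inner_commute[of M g f] l2_inner_self[of M g] unfolding c_def n_def
    by (simp add: l2_inner_linear l2_space_intros right_diff_distrib)
  have "l2_inner M ?h ?h = l2_inner M f f - cnj (c / of_real (n\<^sup>2)) * c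
      - (c / of_real (n\<^sup>2)) * cnj c + (c / of_real (n\<^sup>2)) * cnj (c / of_real (n\<^sup>2)) * of_real (n\<^sup>2)"
    by (rule expand)
  also have "\<dots> = l2_inner M f f - (c * cnj c) / of_real (n\<^sup>2)"
    using n by (simp add: field_simps)
  finally have "of_real ((l2_norm M ?h)\<^sup>2) = complex_of_real ((l2_norm M f)\<^sup>2 - (cmod c)\<^sup>2 / n\<^sup>2)"
    unfolding l2_inner_self complex_norm_square[symmetric] by simp
  then have "(l2_norm M ?h)\<^sup>2 = (l2_norm M f)\<^sup>2 - (cmod c)\<^sup>2 / n\<^sup>2" using of_real_eq_iff by blast
  then have "(cmod c)\<^sup>2 / n\<^sup>2 \<le> (l2_norm M f)\<^sup>2" by (metis diff_ge_0_iff_ge zero_le_power2)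
  then have "(cmod c)\<^sup>2 \<le> (l2_norm M f * n)\<^sup>2" using n by (simp add: field_simps)
  then show ?thesis unfolding c_def n_def by (rule power2_le_imp_le) simp
qed

section \<open>Bounded operators\<close>

lemma l2_bounded_op_in: "l2_bounded_op M T \<Longrightarrow> f \<in> l2_space M \<Longrightarrow> T f \<in> l2_space M"
  by (simp add: l2_bounded_op_def)

lemma l2_bounded_op_add: "l2_bounded_op M T \<Longrightarrow> f \<in> l2_space M \<Longrightarrow> g \<in> l2_space M \<Longrightarrow>
    AE x in M. T (\<lambda>y. f y + g y) x = T f x + T g x"
  by (simp add: l2_bounded_op_def)

lemma l2_bounded_op_scale: "l2_bounded_op M T \<Longrightarrow> f \<in> l2_space M \<Longrightarrow>
    AE x in M. T (\<lambda>y. c * f y) x = c * T f x"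
  by (simp add: l2_bounded_op_def)

lemma l2_bounded_op_uminus: "l2_bounded_op M T \<Longrightarrow> f \<in> l2_space M \<Longrightarrow>
    AE x in M. T (\<lambda>y. - f y) x = - T f x"
  using l2_bounded_op_scale[of M T f "-1"] by simp

lemma l2_bounded_op_diff:
  assumes T: "l2_bounded_op M T" and f: "f \<in> l2_space M" and g: "g \<in> l2_space M"
  shows "AE x in M. T (\<lambda>y. f y - g y) x = T f x - T g x"
  using l2_bounded_op_add[OF T f l2_space_uminus[OF g]] l2_bounded_op_uminus[OF T g]
  by eventually_elim simp

lemma l2_bounded_op_bound:
  assumes "l2_bounded_op M T"
  obtains K where "K > 0" "\<And>f. f \<in> l2_space M \<Longrightarrow> l2_norm M (T f) \<le> K * l2_norm M f"
proof -
  obtain K where K: "\<forall>f\<in>l2_space M. l2_norm M (T f) \<le> K * l2_norm M f"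
    using assms by (auto simp: l2_bounded_op_def)
  have "l2_norm M (T f) \<le> (\<bar>K\<bar> + 1) * l2_norm M f" if "f \<in> l2_space M" for f
  proof -
    have "l2_norm M (T f) \<le> K * l2_norm M f" using K that by simp
    also have "\<dots> \<le> (\<bar>K\<bar> + 1) * l2_norm M f" by (rule mult_right_mono) auto
    finally show ?thesis .
  qed
  then show thesis by (intro that[of "\<bar>K\<bar> + 1"]) auto
qed

lemma l2_bounded_op_cong:
  assumes T: "l2_bounded_op M T" and f: "f \<in> l2_space M" and g: "g \<in> l2_space M"
    and eq: "AE x in M. f x = g x"
  shows "AE x in M. T f x = T g x"
proof -
  let ?d = "\<lambda>x. f x - g x"
  have d: "?d \<in> l2_space M" using f g by (rule l2_space_diff)
  obtain K where K: "l2_norm M (T ?d) \<le> K * l2_norm M ?d"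
    using l2_bounded_op_bound[OF T] d by metis
  have "l2_norm M ?d = 0" using eq l2_norm_eq_0_iff[OF d] by simp
  then have "l2_norm M (T ?d) = 0" using K l2_norm_nonneg[of M "T ?d"] by simp
  then have "AE x in M. T ?d x = 0"
    using l2_norm_eq_0_iff[OF l2_bounded_op_in[OF T d]] by simp
  then show ?thesis using l2_bounded_op_diff[OF T f g] by eventually_elim simp
qed

lemma l2_bounded_opI:
  assumes "\<And>f. f \<in> l2_space M \<Longrightarrow> T f \<in> l2_space M"
    and "\<And>f g. f \<in> l2_space M \<Longrightarrow> g \<in> l2_space M \<Longrightarrow> AE x in M. T (\<lambda>y. f y + g y) x = T f x + T g x"
    and "\<And>c f. f \<in> l2_space M \<Longrightarrow> AE x in M. T (\<lambda>y. c * f y) x = c * T f x"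
    and "\<And>f. f \<in> l2_space M \<Longrightarrow> l2_norm M (T f) \<le> K * l2_norm M f"
  shows "l2_bounded_op M T"
  unfolding l2_bounded_op_def using assms by blast

lemma l2_norm_triangle:
  assumes f: "f \<in> l2_space M" and g: "g \<in> l2_space M"
  shows "l2_norm M (\<lambda>x. f x + g x) \<le> l2_norm M f + l2_norm M g"
proof (rule power2_le_imp_le)
  have "complex_of_real ((l2_norm M (\<lambda>x. f x + g x))\<^sup>2) =
      of_real ((l2_norm M f)\<^sup>2 + (l2_norm M g)\<^sup>2) + (l2_inner M f g + cnj (l2_inner M f g))"
    unfolding l2_inner_self[symmetric] of_real_add l2_inner_commute[of M g f, symmetric]
    using f g by (simp add: l2_inner_linear l2_space_intros)
  also have "\<dots> = of_real ((l2_norm M f)\<^sup>2 + (l2_norm M g)\<^sup>2 + 2 * Re (l2_inner M f g))"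
    by (simp add: complex_add_cnj)
  finally have "(l2_norm M (\<lambda>x. f x + g x))\<^sup>2 = (l2_norm M f)\<^sup>2 + (l2_norm M g)\<^sup>2 + 2 * Re (l2_inner M f g)"
    using of_real_eq_iff by blast
  moreover have "Re (l2_inner M f g) \<le> l2_norm M f * l2_norm M g"
    using l2_Cauchy_Schwarz[OF f g] complex_Re_le_cmod order_trans by blast
  ultimately show "(l2_norm M (\<lambda>x. f x + g x))\<^sup>2 \<le> (l2_norm M f + l2_norm M g)\<^sup>2"
    by (simp add: power2_sum)
qed simp

lemma l2_norm_diff_triangle:
  assumes f: "f \<in> l2_space M" and g: "g \<in> l2_space M"
  shows "l2_norm M (\<lambda>x. f x - g x) \<le> l2_norm M f + l2_norm M g"
  using l2_norm_triangle[OF f l2_space_scale[OF g, of "-1"]] l2_norm_scale[of M "-1" g] by simp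

lemma l2_bounded_op_compose:
  assumes S: "l2_bounded_op M S" and T: "l2_bounded_op M T"
  shows "l2_bounded_op M (\<lambda>f. S (T f))"
proof -
  obtain K where K: "K > 0" "\<And>f. f \<in> l2_space M \<Longrightarrow> l2_norm M (S f) \<le> K * l2_norm M f"
    using l2_bounded_op_bound[OF S] by metis
  obtain L where L: "L > 0" "\<And>f. f \<in> l2_space M \<Longrightarrow> l2_norm M (T f) \<le> L * l2_norm M f"
    using l2_bounded_op_bound[OF T] by metis
  note ins = l2_bounded_op_in[OF S] l2_bounded_op_in[OF T] l2_space_intros
  show ?thesis
  proof (rule l2_bounded_opI)
    fix f g assume f: "f \<in> l2_space M" and g: "g \<in> l2_space M"
    show "AE x in M. S (T (\<lambda>y. f y + g y)) x = S (T f) x + S (T g) x"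
      using l2_bounded_op_cong[OF S _ _ l2_bounded_op_add[OF T f g]]
        l2_bounded_op_add[OF S ins(2)[OF f] ins(2)[OF g]] f g
      by (auto simp: ins)
  next
    fix c f assume f: "f \<in> l2_space M"
    show "AE x in M. S (T (\<lambda>y. c * f y)) x = c * S (T f) x"
      using l2_bounded_op_cong[OF S _ _ l2_bounded_op_scale[OF T f, of c]]
        l2_bounded_op_scale[OF S ins(2)[OF f], of c] f
      by (auto simp: ins)
  next
    fix f assume f: "f \<in> l2_space M"
    have "l2_norm M (S (T f)) \<le> K * l2_norm M (T f)" using K f by (simp add: ins)
    also have "\<dots> \<le> K * (L * l2_norm M f)" using K L f by simp
    finally show "l2_norm M (S (T f)) \<le> (K * L) * l2_norm M f" by (simp add: mult.assoc)
  qed (auto simp: ins)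
qed

lemma l2_bounded_op_minus:
  assumes S: "l2_bounded_op M S" and T: "l2_bounded_op M T"
  shows "l2_bounded_op M (\<lambda>f x. S f x - T f x)"
proof -
  obtain K where K: "K > 0" "\<And>f. f \<in> l2_space M \<Longrightarrow> l2_norm M (S f) \<le> K * l2_norm M f"
    using l2_bounded_op_bound[OF S] by metis
  obtain L where L: "L > 0" "\<And>f. f \<in> l2_space M \<Longrightarrow> l2_norm M (T f) \<le> L * l2_norm M f"
    using l2_bounded_op_bound[OF T] by metis
  note ins = l2_bounded_op_in[OF S] l2_bounded_op_in[OF T] l2_space_intros
  show ?thesis
  proof (rule l2_bounded_opI)
    fix f g assume f: "f \<in> l2_space M" and g: "g \<in> l2_space M"
    show "AE x in M. S (\<lambda>y. f y + g y) x - T (\<lambda>y. f y + g y) x = (S f x - T f x) + (S g x - T g x)"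
      using l2_bounded_op_add[OF T f g] l2_bounded_op_add[OF S f g] by eventually_elim simp
  next
    fix c f assume f: "f \<in> l2_space M"
    show "AE x in M. S (\<lambda>y. c * f y) x - T (\<lambda>y. c * f y) x = c * (S f x - T f x)"
      using l2_bounded_op_scale[OF T f, of c] l2_bounded_op_scale[OF S f, of c]
      by eventually_elim (simp add: algebra_simps)
  next
    fix f assume f: "f \<in> l2_space M"
    have "l2_norm M (\<lambda>x. S f x - T f x) \<le> l2_norm M (S f) + l2_norm M (T f)"
      using f by (intro l2_norm_diff_triangle ins)
    also have "\<dots> \<le> (K + L) * l2_norm M f" using K(2)[OF f] L(2)[OF f] by (simp add: algebra_simps)
    finally show "l2_norm M (\<lambda>x. S f x - T f x) \<le> (K + L) * l2_norm M f" .
  qed (auto simp: ins)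
qed

lemma l2_bounded_op_scaled:
  assumes T: "l2_bounded_op M T"
  shows "l2_bounded_op M (\<lambda>f x. c * T f x)"
proof -
  obtain L where L: "L > 0" "\<And>f. f \<in> l2_space M \<Longrightarrow> l2_norm M (T f) \<le> L * l2_norm M f"
    using l2_bounded_op_bound[OF T] by metis
  note ins = l2_bounded_op_in[OF T] l2_space_intros
  show ?thesis
  proof (rule l2_bounded_opI)
    fix f g assume f: "f \<in> l2_space M" and g: "g \<in> l2_space M"
    show "AE x in M. c * T (\<lambda>y. f y + g y) x = c * T f x + c * T g x"
      using l2_bounded_op_add[OF T f g] by eventually_elim (simp add: algebra_simps)
  next
    fix d f assume f: "f \<in> l2_space M"
    show "AE x in M. c * T (\<lambda>y. d * f y) x = d * (c * T f x)"
      using l2_bounded_op_scale[OF T f, of d] by eventually_elim (simp add: algebra_simps)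
  next
    fix f assume f: "f \<in> l2_space M"
    show "l2_norm M (\<lambda>x. c * T f x) \<le> (cmod c * L) * l2_norm M f"
      using L(2)[OF f] by (simp add: l2_norm_scale mult.assoc mult_left_mono)
  qed (auto simp: ins)
qed

section \<open>Positive operators and uniqueness of the positive square root\<close>

lemma l2_positiveD:
  assumes "l2_positive M A"
  shows "l2_bounded_op M A" "f \<in> l2_space M \<Longrightarrow> 0 \<le> Re (l2_inner M (A f) f)"
    "f \<in> l2_space M \<Longrightarrow> Im (l2_inner M (A f) f) = 0"
  using assms by (auto simp: l2_positive_def)

text \<open>
  Polarization: a complex sesquilinear form with a real diagonal is Hermitian.
\<close>

lemma l2_positive_selfadjoint:
  assumes A: "l2_positive M A" and f: "f \<in> l2_space M" and g: "g \<in> l2_space M"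
  shows "l2_inner M (A f) g = l2_inner M f (A g)"
proof -
  note bd = l2_positiveD(1)[OF A]
  note Ain = l2_bounded_op_in[OF bd]
  define B where "B h k = l2_inner M (A h) k" for h k
  have real: "Im (B h h) = 0" if "h \<in> l2_space M" for h
    using l2_positiveD(3)[OF A that] by (simp add: B_def)
  have expand: "B (\<lambda>x. f x + c * g x) (\<lambda>x. f x + c * g x)
      = B f f + cnj c * B f g + c * B g f + c * cnj c * B g g" for c
  proof -
    have "AE x in M. A (\<lambda>x. f x + c * g x) x = A f x + c * A g x"
      using l2_bounded_op_add[OF bd f l2_space_scale[OF g, of c]] l2_bounded_op_scale[OF bd g, of c]
      by eventually_elim simp
    then have "B (\<lambda>x. f x + c * g x) (\<lambda>x. f x + c * g x)
        = l2_inner M (\<lambda>x. A f x + c * A g x) (\<lambda>x. f x + c * g x)"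
      unfolding B_def using f g by (intro l2_inner_cong_AE Ain l2_space_intros) auto
    then show ?thesis
      unfolding B_def using f g by (simp add: l2_inner_linear l2_space_intros Ain algebra_simps)
  qed
  have "Im (B f g) + Im (B g f) = 0"
    using arg_cong[OF expand[of 1], of Im] real[OF l2_space_add[OF f l2_space_scale[OF g, of 1]]] real[OF f] real[OF g]
    by simp
  moreover have "Re (B g f) - Re (B f g) = 0"
    using arg_cong[OF expand[of \<i>], of Im] real[OF l2_space_add[OF f l2_space_scale[OF g, of \<i>]]] real[OF f] real[OF g]
    by simp
  ultimately have "B f g = cnj (B g f)" by (simp add: complex_eq_iff)
  then show ?thesis unfolding B_def using l2_inner_commute[of M f "A g"] by simp
qed

lemma l2_positive_inner_real:
  "l2_positive M A \<Longrightarrow> f \<in> l2_space M \<Longrightarrow> l2_inner M (A f) f = of_real (Re (l2_inner M (A f) f))"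
  using l2_positiveD(3)[of M A f] by (simp add: complex_eq_iff)

text \<open>
  If \<open>\<langle>Af, f\<rangle> = 0\<close> then \<open>\<langle>A(f - tAf), f - tAf\<rangle> = - 2t\<parallel>Af\<parallel>\<^sup>2 + O(t\<^sup>2)\<close>, which would be negative for
  small positive \<open>t\<close> unless \<open>Af = 0\<close>.
\<close>

lemma l2_positive_kernel:
  assumes A: "l2_positive M A" and f: "f \<in> l2_space M" and z: "Re (l2_inner M (A f) f) = 0"
  shows "AE x in M. A f x = 0"
proof -
  note bd = l2_positiveD(1)[OF A]
  note Ain = l2_bounded_op_in[OF bd]
  define N where "N = (l2_norm M (A f))\<^sup>2"
  define m where "m = Re (l2_inner M (A (A f)) (A f))"
  have m: "m \<ge> 0" unfolding m_def using l2_positiveD(2)[OF A] Ain f by simp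
  have ineq: "0 \<le> - 2 * t * N + t\<^sup>2 * m" for t
  proof -
    let ?h = "\<lambda>x. f x - of_real t * A f x"
    have h: "?h \<in> l2_space M" using f by (intro l2_space_intros Ain)
    have "AE x in M. A ?h x = A f x - of_real t * A (A f) x"
      using l2_bounded_op_diff[OF bd f l2_space_scale[OF Ain[OF f], of "of_real t"]]
        l2_bounded_op_scale[OF bd Ain[OF f], of "of_real t"]
      by eventually_elim simp
    then have "l2_inner M (A ?h) ?h = l2_inner M (\<lambda>x. A f x - of_real t * A (A f) x) ?h"
      using f h by (intro l2_inner_cong_AE Ain l2_space_intros) auto
    also have "\<dots> = l2_inner M (A f) f - of_real t * l2_inner M (A f) (A f)
       - of_real t * l2_inner M (A (A f)) f + of_real t * of_real t * l2_inner M (A (A f)) (A f)"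
      using f by (simp add: l2_inner_linear l2_space_intros Ain algebra_simps)
    also have "l2_inner M (A (A f)) f = l2_inner M (A f) (A f)"
      using l2_positive_selfadjoint[OF A Ain[OF f] f] .
    also have "l2_inner M (A f) (A f) = of_real N" by (simp add: l2_inner_self N_def)
    finally have "Re (l2_inner M (A ?h) ?h) = - 2 * t * N + t\<^sup>2 * m"
      using z by (simp add: m_def power2_eq_square)
    then show ?thesis using l2_positiveD(2)[OF A h] by simp
  qed
  \<comment> \<open>the quadratic polynomial in \<open>t\<close> takes the value \<open>- t\<^sup>2(m + 2)\<close> here\<close>
  define t where "t = N / (m + 1)"
  have N: "N = t * (m + 1)" using m by (simp add: t_def)
  have "t\<^sup>2 * (m + 2) \<le> 0" using ineq[of t] unfolding N by (simp add: algebra_simps power2_eq_square)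
  then have "t = 0" using m by (simp add: mult_le_0_iff)
  then have "N = 0" using N by simp
  then show ?thesis using l2_norm_eq_0_iff[OF Ain[OF f]] by (simp add: N_def)
qed

text \<open>
  The product of commuting positive operators is positive. After scaling, \<open>0 \<le> A \<le> 1\<close>; the
  iteration \<open>S\<^sub>0 = A\<close>, \<open>S\<^sub>n\<^sub>+\<^sub>1 = S\<^sub>n - S\<^sub>n\<^sup>2\<close> stays between \<open>0\<close> and \<open>1\<close> and commutes with \<open>B\<close>, and it
  telescopes to \<open>A = (\<Sum>k<n. S\<^sub>k\<^sup>2) + S\<^sub>n\<close>. Every \<open>BS\<^sub>k\<^sup>2 = S\<^sub>kBS\<^sub>k\<close> is positive, and \<open>S\<^sub>nf\<close> tends to \<open>0\<close>
  because the sum of the \<open>\<parallel>S\<^sub>kf\<parallel>\<^sup>2\<close> is bounded by \<open>\<langle>Af, f\<rangle>\<close>. No square root of \<open>A\<close> is used, so the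
  lemma may serve to prove that square roots are unique.
\<close>

lemma l2_positive_commute_nonneg:
  assumes A: "l2_positive M A" and B: "l2_positive M B"
    and com: "l2_op_eq M (\<lambda>f. B (A f)) (\<lambda>f. A (B f))" and f: "f \<in> l2_space M"
  shows "0 \<le> Re (l2_inner M (B (A f)) f)"
proof -
  note Abd = l2_positiveD(1)[OF A] and Bbd = l2_positiveD(1)[OF B]
  note Bin = l2_bounded_op_in[OF Bbd] and Ain = l2_bounded_op_in[OF Abd]
  obtain K where K: "K > 0" "\<And>f. f \<in> l2_space M \<Longrightarrow> l2_norm M (A f) \<le> K * l2_norm M f"
    using l2_bounded_op_bound[OF Abd] by metis
  obtain L where L: "L > 0" "\<And>f. f \<in> l2_space M \<Longrightarrow> l2_norm M (B f) \<le> L * l2_norm M f"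
    using l2_bounded_op_bound[OF Bbd] by metis
  define S where "S = rec_nat (\<lambda>f x. of_real (1 / K) * A f x) (\<lambda>_ S f x. S f x - S (S f) x)"
  have S0: "S 0 = (\<lambda>f x. of_real (1 / K) * A f x)" and SS: "S (Suc n) = (\<lambda>f x. S n f x - S n (S n f) x)" for n
    by (simp_all add: S_def)
  have inv: "l2_positive M (S n) \<and> (\<forall>f\<in>l2_space M. Re (l2_inner M (S n f) f) \<le> (l2_norm M f)\<^sup>2)
      \<and> l2_op_eq M (\<lambda>f. B (S n f)) (\<lambda>f. S n (B f))" for n
  proof (induction n)
    case 0
    have bd: "l2_bounded_op M (S 0)" unfolding S0 by (rule l2_bounded_op_scaled[OF Abd])
    have val: "l2_inner M (S 0 f) f = of_real (1 / K) * l2_inner M (A f) f" if "f \<in> l2_space M" for f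
      unfolding S0 by (rule l2_inner_scale_left)
    have "l2_positive M (S 0)"
      unfolding l2_positive_def using bd val K(1) l2_positiveD(2,3)[OF A] by (simp add: zero_le_divide_iff)
    moreover have "Re (l2_inner M (S 0 f) f) \<le> (l2_norm M f)\<^sup>2" if f: "f \<in> l2_space M" for f
    proof -
      have "Re (l2_inner M (A f) f) \<le> l2_norm M (A f) * l2_norm M f"
        using l2_Cauchy_Schwarz[OF Ain[OF f] f] complex_Re_le_cmod order_trans by blast
      also have "\<dots> \<le> K * l2_norm M f * l2_norm M f"
        by (intro mult_right_mono K f) simp
      finally have "Re (l2_inner M (A f) f) \<le> K * (l2_norm M f)\<^sup>2" by (simp add: power2_eq_square mult.assoc)
      moreover have "Re (l2_inner M (S 0 f) f) = Re (l2_inner M (A f) f) / K" unfolding val[OF f] by simp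
      ultimately show ?thesis using K(1) by (simp add: divide_le_eq mult.commute)
    qed
    moreover have "l2_op_eq M (\<lambda>f. B (S 0 f)) (\<lambda>f. S 0 (B f))"
      unfolding l2_op_eq_def
    proof
      fix f assume f: "f \<in> l2_space M"
      have "AE x in M. B (A f) x = A (B f) x" using com f by (simp add: l2_op_eq_def)
      then show "AE x in M. B (S 0 f) x = S 0 (B f) x"
        using l2_bounded_op_scale[OF Bbd Ain[OF f], of "of_real (1 / K)"] unfolding S0
        by eventually_elim simp
    qed
    ultimately show ?case by simp
  next
    case (Suc n)
    let ?S = "S n"
    have pos: "l2_positive M ?S" and le1: "\<And>f. f \<in> l2_space M \<Longrightarrow> Re (l2_inner M (?S f) f) \<le> (l2_norm M f)\<^sup>2"
      and comS: "\<And>f. f \<in> l2_space M \<Longrightarrow> AE x in M. B (?S f) x = ?S (B f) x"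
      using Suc by (auto simp: l2_op_eq_def)
    note bd = l2_positiveD(1)[OF pos]
    note Sin = l2_bounded_op_in[OF bd]
    have bd': "l2_bounded_op M (S (Suc n))"
      unfolding SS by (rule l2_bounded_op_minus[OF bd l2_bounded_op_compose[OF bd bd]])
    have val: "l2_inner M (S (Suc n) f) f = of_real (Re (l2_inner M (?S f) f) - (l2_norm M (?S f))\<^sup>2)"
      if f: "f \<in> l2_space M" for f
    proof -
      have "l2_inner M (S (Suc n) f) f = l2_inner M (?S f) f - l2_inner M (?S (?S f)) f"
        unfolding SS using f by (intro l2_inner_diff_left Sin)
      also have "l2_inner M (?S (?S f)) f = of_real ((l2_norm M (?S f))\<^sup>2)"
        using l2_positive_selfadjoint[OF pos Sin[OF f] f] by (simp add: l2_inner_self)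
      finally show ?thesis using l2_positive_inner_real[OF pos f] by simp
    qed
    have nonneg: "0 \<le> Re (l2_inner M (?S f) f) - (l2_norm M (?S f))\<^sup>2" if f: "f \<in> l2_space M" for f
    proof -
      \<comment> \<open>\<open>S - S\<^sup>2 = (1 - S) S (1 - S) + S (1 - S) S\<close>\<close>
      let ?k = "?S f"
      let ?h = "\<lambda>x. f x - ?k x"
      have k: "?k \<in> l2_space M" and h: "?h \<in> l2_space M"
        using f by (auto intro!: Sin l2_space_intros)
      have "l2_inner M (?S ?h) ?h = l2_inner M (\<lambda>x. ?k x - ?S ?k x) ?h"
        using l2_bounded_op_diff[OF bd f k] f h k
        by (intro l2_inner_cong_AE Sin l2_space_intros) auto
      also have "\<dots> = l2_inner M ?k f - l2_inner M ?k ?k - l2_inner M (?S ?k) f + l2_inner M (?S ?k) ?k"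
        using f k by (simp add: l2_inner_linear l2_space_intros Sin)
      also have "l2_inner M (?S ?k) f = l2_inner M ?k ?k"
        by (rule l2_positive_selfadjoint[OF pos k f])
      finally have "Re (l2_inner M (?S ?h) ?h) = Re (l2_inner M ?k f) - 2 * (l2_norm M ?k)\<^sup>2 + Re (l2_inner M (?S ?k) ?k)"
        by (simp add: l2_inner_self)
      then show ?thesis using l2_positiveD(2)[OF pos h] le1[OF k] by simp
    qed
    have "l2_positive M (S (Suc n))"
      unfolding l2_positive_def using bd' val nonneg by simp
    moreover have "Re (l2_inner M (S (Suc n) f) f) \<le> (l2_norm M f)\<^sup>2" if f: "f \<in> l2_space M" for f
      unfolding val[OF f] Re_complex_of_real
      using le1[OF f] zero_le_power2[of "l2_norm M (?S f)"] by linarith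
    moreover have "l2_op_eq M (\<lambda>f. B (S (Suc n) f)) (\<lambda>f. S (Suc n) (B f))"
      unfolding l2_op_eq_def
    proof
      fix f assume f: "f \<in> l2_space M"
      have "AE x in M. B (?S (?S f)) x = ?S (B (?S f)) x" by (rule comS[OF Sin[OF f]])
      moreover have "AE x in M. ?S (B (?S f)) x = ?S (?S (B f)) x"
        using f by (intro l2_bounded_op_cong[OF bd] comS Sin Bin)
      moreover note comS[OF f] l2_bounded_op_diff[OF Bbd Sin[OF f] Sin[OF Sin[OF f]]]
      ultimately show "AE x in M. B (S (Suc n) f) x = S (Suc n) (B f) x"
        unfolding SS by eventually_elim simp
    qed
    ultimately show ?case by simp
  qed
  have pos: "l2_positive M (S n)" and comS: "AE x in M. B (S n f) x = S n (B f) x" if "f \<in> l2_space M" for n f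
    using inv[of n] that by (auto simp: l2_op_eq_def)
  note Spos = pos[OF f] and Sbd = l2_positiveD(1)[OF pos[OF f]]
  note Sin = l2_bounded_op_in[OF Sbd]
  have step: "Re (l2_inner M (B (S (Suc n) f)) f) \<le> Re (l2_inner M (B (S n f)) f)"
    and nstep: "(l2_norm M (S n f))\<^sup>2 = Re (l2_inner M (S n f) f) - Re (l2_inner M (S (Suc n) f) f)" for n
  proof -
    have "l2_inner M (B (S (Suc n) f)) f = l2_inner M (\<lambda>x. B (S n f) x - B (S n (S n f)) x) f"
      using l2_bounded_op_diff[OF Bbd Sin[OF f] Sin[OF Sin[OF f]], of n n n] f unfolding SS
      by (intro l2_inner_cong_AE Bin Sin l2_space_intros) auto
    also have "\<dots> = l2_inner M (B (S n f)) f - l2_inner M (B (S n (S n f))) f"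
      using f by (intro l2_inner_diff_left Bin Sin)
    also have "l2_inner M (B (S n (S n f))) f = l2_inner M (S n (B (S n f))) f"
      using f comS[OF Sin[OF f], of n n] by (intro l2_inner_cong_AE Bin Sin) auto
    also have "\<dots> = l2_inner M (B (S n f)) (S n f)"
      using f by (intro l2_positive_selfadjoint[OF Spos] Bin Sin)
    finally show "Re (l2_inner M (B (S (Suc n) f)) f) \<le> Re (l2_inner M (B (S n f)) f)"
      using l2_positiveD(2)[OF B Sin[OF f]] by simp
    have "l2_inner M (S (Suc n) f) f = l2_inner M (S n f) f - l2_inner M (S n (S n f)) f"
      unfolding SS using f by (intro l2_inner_diff_left Sin)
    also have "l2_inner M (S n (S n f)) f = of_real ((l2_norm M (S n f))\<^sup>2)"
      using l2_positive_selfadjoint[OF Spos Sin[OF f] f] by (simp add: l2_inner_self)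
    finally show "(l2_norm M (S n f))\<^sup>2 = Re (l2_inner M (S n f) f) - Re (l2_inner M (S (Suc n) f) f)"
      by simp
  qed
  have sum: "(\<Sum>k<n. (l2_norm M (S k f))\<^sup>2) = Re (l2_inner M (S 0 f) f) - Re (l2_inner M (S n f) f)" for n
    by (induction n) (simp_all add: nstep)
  have "summable (\<lambda>k. (l2_norm M (S k f))\<^sup>2)"
  proof (rule summableI_nonneg_bounded)
    show "(\<Sum>k<n. (l2_norm M (S k f))\<^sup>2) \<le> Re (l2_inner M (S 0 f) f)" for n
      using sum[of n] l2_positiveD(2)[OF Spos f] by simp
  qed simp
  then have "(\<lambda>k. (l2_norm M (S k f))\<^sup>2) \<longlonglongrightarrow> 0" by (rule summable_LIMSEQ_zero)
  then have lim0: "(\<lambda>k. l2_norm M (S k f)) \<longlonglongrightarrow> 0"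
    using tendsto_real_sqrt[of "\<lambda>k. (l2_norm M (S k f))\<^sup>2" 0] by simp
  have mono: "Re (l2_inner M (B (S n f)) f) \<le> Re (l2_inner M (B (S 0 f)) f)" for n
    by (induction n) (auto intro: order_trans[OF step])
  have low: "- (L * l2_norm M f) * l2_norm M (S n f) \<le> Re (l2_inner M (B (S 0 f)) f)" for n
  proof -
    have "- Re (l2_inner M (B (S n f)) f) \<le> l2_norm M (B (S n f)) * l2_norm M f"
      using l2_Cauchy_Schwarz[OF Bin[OF Sin[OF f]] f, of n] abs_Re_le_cmod[of "l2_inner M (B (S n f)) f"]
      by linarith
    also have "\<dots> \<le> L * l2_norm M (S n f) * l2_norm M f"
      by (intro mult_right_mono L Sin f) simp
    finally show ?thesis using mono[of n] by (simp add: algebra_simps)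
  qed
  have "(\<lambda>n. - (L * l2_norm M f) * l2_norm M (S n f)) \<longlonglongrightarrow> - (L * l2_norm M f) * 0"
    by (intro tendsto_intros lim0)
  then have "0 \<le> Re (l2_inner M (B (S 0 f)) f)"
    using low by (intro LIMSEQ_le_const2[of _ "- (L * l2_norm M f) * 0", simplified]) auto
  also have "l2_inner M (B (S 0 f)) f = of_real (1 / K) * l2_inner M (B (A f)) f"
  proof -
    have "l2_inner M (B (S 0 f)) f = l2_inner M (\<lambda>x. of_real (1 / K) * B (A f) x) f"
      using l2_bounded_op_scale[OF Bbd Ain[OF f], of "of_real (1 / K)"] f unfolding S0
      by (intro l2_inner_cong_AE Bin Ain l2_space_intros) auto
    then show ?thesis by (simp only: l2_inner_scale_left)
  qed
  finally show ?thesis using K(1) by (simp add: zero_le_divide_iff)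
qed

text \<open>
  Put \<open>D = R - Q\<close>. From \<open>R\<^sup>2 = Q\<^sup>2\<close> one gets \<open>RD = - DQ\<close> and \<open>DR = - QD\<close>, so \<open>R\<close> commutes with the
  positive operator \<open>D\<^sup>2\<close> and \<open>D\<^sup>2R = - DQD\<close>. The left side is positive as a product of
  commuting positive operators, and the right side is negative; hence \<open>\<langle>QDf, Df\<rangle> = 0\<close> for all \<open>f\<close>.
\<close>

lemma l2_positive_sqrt_diff_kernel:
  assumes R: "l2_positive M R" and Q: "l2_positive M Q"
    and eq: "l2_op_eq M (\<lambda>f. R (R f)) (\<lambda>f. Q (Q f))" and f: "f \<in> l2_space M"
  shows "AE x in M. Q (\<lambda>x. R f x - Q f x) x = 0"
proof -
  note Rbd = l2_positiveD(1)[OF R] and Qbd = l2_positiveD(1)[OF Q]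
  note Rin = l2_bounded_op_in[OF Rbd] and Qin = l2_bounded_op_in[OF Qbd]
  define D where "D = (\<lambda>f x. R f x - Q f x)"
  have Dbd: "l2_bounded_op M D" unfolding D_def by (rule l2_bounded_op_minus[OF Rbd Qbd])
  note Din = l2_bounded_op_in[OF Dbd]
  have Dsa: "l2_inner M (D g) h = l2_inner M g (D h)" if "g \<in> l2_space M" "h \<in> l2_space M" for g h
    unfolding D_def using that l2_positive_selfadjoint[OF R that] l2_positive_selfadjoint[OF Q that]
    by (simp add: l2_inner_linear Rin Qin)
  have RD: "AE x in M. R (D g) x = - D (Q g) x" if g: "g \<in> l2_space M" for g
  proof -
    have "AE x in M. R (R g) x = Q (Q g) x" using eq g by (simp add: l2_op_eq_def)
    then show ?thesis
      using l2_bounded_op_diff[OF Rbd Rin[OF g] Qin[OF g]] unfolding D_def by eventually_elim simp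
  qed
  have DR: "AE x in M. D (R g) x = - Q (D g) x" if g: "g \<in> l2_space M" for g
  proof -
    have "AE x in M. R (R g) x = Q (Q g) x" using eq g by (simp add: l2_op_eq_def)
    then show ?thesis
      using l2_bounded_op_diff[OF Qbd Rin[OF g] Qin[OF g]] unfolding D_def by eventually_elim simp
  qed
  have RDD: "AE x in M. R (D (D g)) x = - D (Q (D g)) x" if g: "g \<in> l2_space M" for g
    using RD[OF Din[OF g]] .
  have DDR: "AE x in M. D (D (R g)) x = - D (Q (D g)) x" if g: "g \<in> l2_space M" for g
    using l2_bounded_op_cong[OF Dbd _ _ DR[OF g]] l2_bounded_op_uminus[OF Dbd Qin[OF Din[OF g]]] g
    by (auto simp: Din Rin Qin l2_space_uminus)
  have pos: "l2_positive M (\<lambda>f. D (D f))"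
    unfolding l2_positive_def using l2_bounded_op_compose[OF Dbd Dbd]
    by (auto simp: Dsa Din l2_inner_self)
  have "0 \<le> Re (l2_inner M (D (D (R f))) f)"
  proof (rule l2_positive_commute_nonneg[OF R pos _ f])
    show "l2_op_eq M (\<lambda>f. D (D (R f))) (\<lambda>f. R (D (D f)))"
      unfolding l2_op_eq_def
    proof
      fix g assume "g \<in> l2_space M"
      from DDR[OF this] RDD[OF this] show "AE x in M. D (D (R g)) x = R (D (D g)) x"
        by eventually_elim simp
    qed
  qed
  also have "l2_inner M (D (D (R f))) f = l2_inner M (\<lambda>x. - D (Q (D f)) x) f"
    using DDR[OF f] f by (intro l2_inner_cong_AE Din Qin Rin l2_space_uminus) auto
  also have "\<dots> = - l2_inner M (Q (D f)) (D f)"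
    using f by (simp add: l2_inner_uminus_left Dsa Din Qin)
  finally have "Re (l2_inner M (Q (D f)) (D f)) = 0"
    using l2_positiveD(2)[OF Q Din[OF f]] by simp
  then have "AE x in M. Q (D f) x = 0" by (rule l2_positive_kernel[OF Q Din[OF f]])
  then show ?thesis by (simp add: D_def)
qed

text \<open>
  By symmetry both \<open>R\<close> and \<open>Q\<close> annihilate the range of \<open>D = R - Q\<close>, so \<open>D\<^sup>2 = 0\<close>, and \<open>D\<close> is
  self-adjoint.
\<close>

theorem l2_positive_sqrt_unique:
  assumes R: "l2_positive M R" and Q: "l2_positive M Q"
    and eq: "l2_op_eq M (\<lambda>f. R (R f)) (\<lambda>f. Q (Q f))"
  shows "l2_op_eq M R Q"
  unfolding l2_op_eq_def
proof
  fix f assume f: "f \<in> l2_space M"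
  note Rbd = l2_positiveD(1)[OF R] and Qbd = l2_positiveD(1)[OF Q]
  note Rin = l2_bounded_op_in[OF Rbd] and Qin = l2_bounded_op_in[OF Qbd]
  let ?d = "\<lambda>x. R f x - Q f x" and ?e = "\<lambda>x. Q f x - R f x"
  have d: "?d \<in> l2_space M" and e: "?e \<in> l2_space M" using f by (auto intro!: l2_space_diff Rin Qin)
  have "l2_op_eq M (\<lambda>f. Q (Q f)) (\<lambda>f. R (R f))"
    using eq unfolding l2_op_eq_def by (simp add: eq_commute)
  from l2_positive_sqrt_diff_kernel[OF Q R this f] have "AE x in M. R ?e x = 0" .
  then have Rd: "AE x in M. R ?d x = 0"
    using l2_bounded_op_uminus[OF Rbd e] by eventually_elim simp
  have Qd: "AE x in M. Q ?d x = 0"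
    by (rule l2_positive_sqrt_diff_kernel[OF R Q eq f])
  have "l2_inner M ?d ?d = l2_inner M (R f) ?d - l2_inner M (Q f) ?d"
    using f d by (intro l2_inner_diff_left Rin Qin)
  also have "\<dots> = l2_inner M f (R ?d) - l2_inner M f (Q ?d)"
    using l2_positive_selfadjoint[OF R f d] l2_positive_selfadjoint[OF Q f d] by simp
  also have "l2_inner M f (R ?d) = l2_inner M f (Q ?d)"
    using Rd Qd f d by (intro l2_inner_cong_AE Rin Qin) auto
  finally have "l2_norm M ?d = 0" by (simp add: l2_inner_self)
  then show "AE x in M. R f x = Q f x" using l2_norm_eq_0_iff[OF d] by simp
qed

section \<open>Identifying adjoint, square root and modulus\<close>

lemma l2_op_eq_sym: "l2_op_eq M S T \<Longrightarrow> l2_op_eq M T S"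
  by (simp add: l2_op_eq_def eq_commute)

lemma l2_op_eq_trans [trans]:
  assumes "l2_op_eq M R S" "l2_op_eq M S T"
  shows "l2_op_eq M R T"
  unfolding l2_op_eq_def
proof
  fix f assume "f \<in> l2_space M"
  then have "AE x in M. R f x = S f x" "AE x in M. S f x = T f x"
    using assms by (auto simp: l2_op_eq_def)
  then show "AE x in M. R f x = T f x" by eventually_elim simp
qed

text \<open>
  An explicit operator with the defining property of an adjoint, a square root or a modulus equals
  the one picked by \<open>SOME\<close>, because each of these is unique up to null sets.
\<close>

lemma l2_adjoint_eqI:
  assumes S: "l2_bounded_op M S"
    and adj: "\<And>f g. f \<in> l2_space M \<Longrightarrow> g \<in> l2_space M \<Longrightarrow> l2_inner M (T f) g = l2_inner M f (S g)"
  shows "l2_op_eq M (l2_adjoint M T) S"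
  unfolding l2_op_eq_def
proof
  fix g assume g: "g \<in> l2_space M"
  let ?A = "l2_adjoint M T"
  have A: "l2_bounded_op M ?A \<and> (\<forall>f\<in>l2_space M. \<forall>g\<in>l2_space M. l2_inner M (T f) g = l2_inner M f (?A g))"
    unfolding l2_adjoint_def by (rule someI[of _ S]) (use assms in auto)
  show "AE x in M. ?A g x = S g x"
    using A adj g by (intro l2_eqI l2_bounded_op_in[OF S] l2_bounded_op_in[of M ?A]) auto
qed

lemma l2_sqrt_eqI:
  assumes R: "l2_positive M R" and eq: "l2_op_eq M (\<lambda>f. R (R f)) A"
  shows "l2_positive M (l2_sqrt M A)" "l2_op_eq M (l2_sqrt M A) R"
proof -
  have *: "l2_positive M (l2_sqrt M A) \<and> l2_op_eq M (\<lambda>f. l2_sqrt M A (l2_sqrt M A f)) A"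
    unfolding l2_sqrt_def by (rule someI[of _ R]) (use assms in auto)
  then show "l2_positive M (l2_sqrt M A)" by simp
  show "l2_op_eq M (l2_sqrt M A) R"
    using * by (intro l2_positive_sqrt_unique[OF _ R] l2_op_eq_trans[OF _ l2_op_eq_sym[OF eq]]) auto
qed

lemma l2_abs_eqI:
  assumes T: "\<And>f. f \<in> l2_space M \<Longrightarrow> T f \<in> l2_space M" and S: "l2_bounded_op M S"
    and adj: "\<And>f g. f \<in> l2_space M \<Longrightarrow> g \<in> l2_space M \<Longrightarrow> l2_inner M (T f) g = l2_inner M f (S g)"
    and R: "l2_positive M R" and eq: "l2_op_eq M (\<lambda>f. R (R f)) (\<lambda>f. S (T f))"
  shows "l2_positive M (l2_abs M T)" "l2_op_eq M (l2_abs M T) R"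
proof -
  have "l2_op_eq M (\<lambda>f. S (T f)) (\<lambda>f. l2_adjoint M T (T f))"
    using l2_adjoint_eqI[OF S adj] T by (auto simp: l2_op_eq_def eq_commute)
  then have "l2_op_eq M (\<lambda>f. R (R f)) (\<lambda>f. l2_adjoint M T (T f))"
    using eq l2_op_eq_trans by blast
  from l2_sqrt_eqI[OF R this]
  show "l2_positive M (l2_abs M T)" "l2_op_eq M (l2_abs M T) R"
    by (simp_all add: l2_abs_def)
qed

section \<open>Weighted conditional expectation operators\<close>

lemma l2_norm_nn_integral:
  assumes "f \<in> l2_space M"
  shows "ennreal ((l2_norm M f)\<^sup>2) = (\<integral>\<^sup>+x. ennreal ((cmod (f x))\<^sup>2) \<partial>M)"
proof -
  have "(\<integral>\<^sup>+x. ennreal ((cmod (f x))\<^sup>2) \<partial>M) = ennreal (\<integral>x. (cmod (f x))\<^sup>2 \<partial>M)"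
    using assms by (intro nn_integral_eq_integral) (auto simp: l2_space_def)
  then show ?thesis by (simp add: l2_norm_def)
qed

lemma l2_spaceI_nn_integral:
  assumes g: "g \<in> borel_measurable M" and f: "f \<in> l2_space M" and C: "C \<ge> 0"
    and le: "(\<integral>\<^sup>+x. ennreal ((cmod (g x))\<^sup>2) \<partial>M) \<le> ennreal C * (\<integral>\<^sup>+x. ennreal ((cmod (f x))\<^sup>2) \<partial>M)"
  shows "g \<in> l2_space M" "l2_norm M g \<le> sqrt C * l2_norm M f"
proof -
  have le': "(\<integral>\<^sup>+x. ennreal ((cmod (g x))\<^sup>2) \<partial>M) \<le> ennreal (C * (l2_norm M f)\<^sup>2)"
    using le C unfolding l2_norm_nn_integral[OF f, symmetric] by (simp add: ennreal_mult)
  then have "(\<integral>\<^sup>+x. ennreal ((cmod (g x))\<^sup>2) \<partial>M) < \<infinity>"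
    using le_less_trans by fastforce
  then have "integrable M (\<lambda>x. (cmod (g x))\<^sup>2)"
    using g by (intro integrableI_nonneg) auto
  then show gl: "g \<in> l2_space M" using g by (simp add: l2_space_def)
  have "(l2_norm M g)\<^sup>2 \<le> C * (l2_norm M f)\<^sup>2"
    using le' C unfolding l2_norm_nn_integral[OF gl, symmetric] by (simp add: ennreal_le_iff)
  also have "\<dots> = (sqrt C * l2_norm M f)\<^sup>2" using C by (simp add: power_mult_distrib)
  finally show "l2_norm M g \<le> sqrt C * l2_norm M f"
    by (rule power2_le_imp_le) (use C in simp)
qed

context sigma_finite_subalgebra
begin

abbreviation cond_moment :: "('a \<Rightarrow> complex) \<Rightarrow> 'a \<Rightarrow> ennreal" where
  "cond_moment g \<equiv> nn_cond_exp M F (\<lambda>x. ennreal ((cmod (g x))\<^sup>2))"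

text \<open>
  The two classes play the role of square integrable and of bounded weights, fibrewise over the
  subalgebra; their elements need not be square integrable.
\<close>

definition cond_l2 :: "('a \<Rightarrow> complex) set" where
  "cond_l2 = {g \<in> borel_measurable M. AE x in M. cond_moment g x < \<infinity>}"

definition cond_bdd :: "real \<Rightarrow> ('a \<Rightarrow> complex) set" where
  "cond_bdd C = {g \<in> borel_measurable M. AE x in M. cond_moment g x \<le> ennreal C}"

lemma F_measurable_M: "a \<in> borel_measurable F \<Longrightarrow> a \<in> borel_measurable M"
  by (rule measurable_from_subalg[OF subalg])

lemma cond_bdd_cond_l2: "g \<in> cond_bdd C \<Longrightarrow> g \<in> cond_l2"
proof -
  assume "g \<in> cond_bdd C"
  then have "g \<in> borel_measurable M" "AE x in M. cond_moment g x \<le> ennreal C"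
    by (auto simp: cond_bdd_def)
  moreover from this(2) have "AE x in M. cond_moment g x < \<infinity>"
    by eventually_elim (simp add: le_less_trans)
  ultimately show ?thesis by (simp add: cond_l2_def)
qed

lemma l2_space_cond_l2:
  assumes "f \<in> l2_space M" shows "f \<in> cond_l2"
proof -
  have "AE x in M. cond_moment f x < \<infinity>"
    using assms l2_norm_nn_integral[OF assms]
    by (intro nn_cond_exp_finite_if_nn_integral_finite) (auto simp: l2_space_def simp flip: l2_norm_nn_integral)
  then show ?thesis using assms by (simp add: cond_l2_def l2_space_def)
qed

lemma cond_l2_cnj: "g \<in> cond_l2 \<Longrightarrow> (\<lambda>x. cnj (g x)) \<in> cond_l2"
  by (auto simp: cond_l2_def intro: borel_measurable_cnj)

lemma cond_bdd_cnj: "g \<in> cond_bdd C \<Longrightarrow> (\<lambda>x. cnj (g x)) \<in> cond_bdd C"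
  by (auto simp: cond_bdd_def intro: borel_measurable_cnj)

lemma cond_l2_mult_dom:
  assumes g: "g \<in> cond_l2" and h: "h \<in> cond_l2"
  shows "(\<lambda>x. g x * h x) \<in> cond_exp_dom M F"
proof (rule cond_exp_domI)
  have [measurable]: "g \<in> borel_measurable M" "h \<in> borel_measurable M"
    using g h by (auto simp: cond_l2_def)
  show "(\<lambda>x. g x * h x) \<in> borel_measurable M"
    "(\<lambda>x. ennreal ((cmod (g x))\<^sup>2) + ennreal ((cmod (h x))\<^sup>2)) \<in> borel_measurable M"
    by measurable
  have "a * b \<le> a\<^sup>2 + b\<^sup>2" for a b :: real
    using zero_le_power2[of "a - b"] zero_le_power2[of a] zero_le_power2[of b] power2_diff[of a b]
    by linarith
  then show "AE x in M. ennreal (cmod (g x * h x)) \<le> ennreal ((cmod (g x))\<^sup>2) + ennreal ((cmod (h x))\<^sup>2)"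
    by (auto simp: norm_mult ennreal_plus[symmetric] simp del: ennreal_plus intro!: ennreal_leI)
  have "AE x in M. cond_moment g x < \<infinity>" "AE x in M. cond_moment h x < \<infinity>"
    using g h by (auto simp: cond_l2_def)
  moreover have "AE x in M. cond_moment g x + cond_moment h x
      = nn_cond_exp M F (\<lambda>x. ennreal ((cmod (g x))\<^sup>2) + ennreal ((cmod (h x))\<^sup>2)) x"
    by (rule nn_cond_exp_sum) auto
  ultimately show "AE x in M. nn_cond_exp M F (\<lambda>x. ennreal ((cmod (g x))\<^sup>2) + ennreal ((cmod (h x))\<^sup>2)) x < \<infinity>"
    by eventually_elim (drule sym, simp)
qed

lemma cond_moment_mult:
  assumes [measurable]: "a \<in> borel_measurable F" "g \<in> borel_measurable M"
  shows "AE x in M. cond_moment (\<lambda>x. a x * g x) x = ennreal ((cmod (a x))\<^sup>2) * cond_moment g x"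
proof -
  have "AE x in M. ennreal ((cmod (a x))\<^sup>2) * cond_moment g x
      = nn_cond_exp M F (\<lambda>x. ennreal ((cmod (a x))\<^sup>2) * ennreal ((cmod (g x))\<^sup>2)) x"
    by (rule nn_cond_exp_prod) auto
  then show ?thesis by (simp add: norm_mult power_mult_distrib ennreal_mult eq_commute)
qed

text \<open>
  Integrate \<open>\<bar>g\<bar>\<^sup>2\<close> over the set where its conditional expectation vanishes.
\<close>

lemma cond_moment_eq_0:
  assumes [measurable]: "g \<in> borel_measurable M"
  shows "AE x in M. cond_moment g x = 0 \<longrightarrow> g x = 0"
proof -
  define i where "i x = (if cond_moment g x = 0 then 1 else 0 :: ennreal)" for x
  have [measurable]: "i \<in> borel_measurable F" unfolding i_def by measurable
  then have [measurable]: "i \<in> borel_measurable M" by (rule F_measurable_M)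
  have "(\<integral>\<^sup>+x. i x * ennreal ((cmod (g x))\<^sup>2) \<partial>M) = (\<integral>\<^sup>+x. i x * cond_moment g x \<partial>M)"
    by (rule nn_cond_exp_intg[symmetric]) auto
  also have "\<dots> = (\<integral>\<^sup>+x. 0 \<partial>M)"
    by (intro nn_integral_cong) (simp add: i_def)
  also have "\<dots> = 0" by simp
  finally have "AE x in M. i x * ennreal ((cmod (g x))\<^sup>2) = 0"
    by (subst (asm) nn_integral_0_iff_AE) auto
  then show ?thesis by eventually_elim (auto simp: i_def split: if_splits)
qed

lemma cond_exp_moment:
  assumes [measurable]: "g \<in> borel_measurable M"
  shows "AE x in M. complex_cond_exp M F (\<lambda>x. g x * cnj (g x)) x = of_real (enn2real (cond_moment g x))"
proof -
  have "complex_of_real ((cmod (g x))\<^sup>2) = g x * cnj (g x)" for x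
    by (metis complex_norm_square of_real_power)
  then show ?thesis using complex_cond_exp_nonneg[of "\<lambda>x. (cmod (g x))\<^sup>2"] by (simp only:) simp
qed

text \<open>
  The conditional Cauchy--Schwarz inequality, in the form of Bessel's inequality: expand the
  conditional second moment of \<open>f - (E(\<beta>f)/C) \<beta>\<^sup>*\<close>, which is nonnegative.
\<close>

lemma cond_Cauchy_Schwarz:
  assumes \<beta>: "\<beta> \<in> cond_bdd C" and C: "C > 0" and f: "f \<in> cond_l2"
  shows "AE x in M. ennreal ((cmod (complex_cond_exp M F (\<lambda>y. \<beta> y * f y) x))\<^sup>2) \<le> ennreal C * cond_moment f x"
proof -
  let ?E = "complex_cond_exp M F"
  have b2: "\<beta> \<in> cond_l2" using \<beta> by (rule cond_bdd_cond_l2)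
  have [measurable]: "\<beta> \<in> borel_measurable M" "f \<in> borel_measurable M"
    using b2 f by (auto simp: cond_l2_def)
  note dom = cond_l2_mult_dom[OF f cond_l2_cnj[OF f]] cond_l2_mult_dom[OF b2 f]
    cond_l2_mult_dom[OF cond_l2_cnj[OF b2] cond_l2_cnj[OF f]] cond_l2_mult_dom[OF b2 cond_l2_cnj[OF b2]]
  define c where "c = ?E (\<lambda>y. \<beta> y * f y)"
  define d where "d x = c x / of_real C" for x
  have [measurable]: "c \<in> borel_measurable F" unfolding c_def by measurable
  then have [measurable]: "d \<in> borel_measurable F" unfolding d_def by measurable
  have [measurable]: "d \<in> borel_measurable M" by (rule F_measurable_M) simp
  let ?g = "\<lambda>x. f x - d x * cnj (\<beta> x)"
  have expand: "?g x * cnj (?g x) = ((f x * cnj (f x) + (- d x) * (cnj (\<beta> x) * cnj (f x)))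
      + (- cnj (d x)) * (\<beta> x * f x)) + (d x * cnj (d x)) * (\<beta> x * cnj (\<beta> x))" for x
    by (simp add: algebra_simps)
  have m[measurable]: "(\<lambda>x. - d x) \<in> borel_measurable F" "(\<lambda>x. - cnj (d x)) \<in> borel_measurable F"
    "(\<lambda>x. d x * cnj (d x)) \<in> borel_measurable F" by measurable
  note D = dom(1) cond_exp_dom_mult[OF m(1) dom(3)] cond_exp_dom_mult[OF m(2) dom(2)] cond_exp_dom_mult[OF m(3) dom(4)]
  have a1: "AE x in M. ?E (\<lambda>x. ?g x * cnj (?g x)) x = ?E (\<lambda>x. (f x * cnj (f x) + (- d x) * (cnj (\<beta> x) * cnj (f x)))
      + (- cnj (d x)) * (\<beta> x * f x)) x + ?E (\<lambda>x. (d x * cnj (d x)) * (\<beta> x * cnj (\<beta> x))) x"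
    unfolding expand by (intro complex_cond_exp_add cond_exp_dom_add D)
  have a2: "AE x in M. ?E (\<lambda>x. (f x * cnj (f x) + (- d x) * (cnj (\<beta> x) * cnj (f x)))
      + (- cnj (d x)) * (\<beta> x * f x)) x = ?E (\<lambda>x. (f x * cnj (f x) + (- d x) * (cnj (\<beta> x) * cnj (f x)))) x
       + ?E (\<lambda>x. (- cnj (d x)) * (\<beta> x * f x)) x"
    by (intro complex_cond_exp_add cond_exp_dom_add D)
  have a3: "AE x in M. ?E (\<lambda>x. (f x * cnj (f x) + (- d x) * (cnj (\<beta> x) * cnj (f x)))) x
      = ?E (\<lambda>x. f x * cnj (f x)) x + ?E (\<lambda>x. (- d x) * (cnj (\<beta> x) * cnj (f x))) x"
    by (intro complex_cond_exp_add cond_exp_dom_add D)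
  note e = complex_cond_exp_mult[OF m(1) dom(3)] complex_cond_exp_mult[OF m(2) dom(2)] complex_cond_exp_mult[OF m(3) dom(4)]
  have cc: "?E (\<lambda>x. cnj (\<beta> x) * cnj (f x)) x = cnj (c x)" for x
    unfolding c_def complex_cond_exp_cnj[symmetric] by simp
  have pos: "AE x in M. ?E (\<lambda>x. ?g x * cnj (?g x)) x = of_real (enn2real (cond_moment ?g x))"
    by (rule cond_exp_moment) measurable
  have mf: "AE x in M. ?E (\<lambda>x. f x * cnj (f x)) x = of_real (enn2real (cond_moment f x))"
    and mb: "AE x in M. ?E (\<lambda>x. \<beta> x * cnj (\<beta> x)) x = of_real (enn2real (cond_moment \<beta> x))"
    by (rule cond_exp_moment; measurable)+
  have bC: "AE x in M. cond_moment \<beta> x \<le> ennreal C" using \<beta> by (simp add: cond_bdd_def)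
  have fin: "AE x in M. cond_moment f x < \<infinity>" using f by (simp add: cond_l2_def)
  show ?thesis
    unfolding c_def[symmetric]
    using a1 a2 a3 e pos mf mb bC fin
  proof eventually_elim
    case (elim x)
    define p where "p = enn2real (cond_moment f x)"
    define q where "q = enn2real (cond_moment \<beta> x)"
    define r where "r = enn2real (cond_moment ?g x)"
    have "complex_of_real r = of_real p + (- d x) * cnj (c x) + (- cnj (d x)) * c x + (d x * cnj (d x)) * of_real q"
      using elim(1-9) unfolding cc c_def[symmetric] p_def q_def r_def by metis
    also have "\<dots> = of_real (p - 2 * (cmod (c x))\<^sup>2 / C + (cmod (c x))\<^sup>2 / C\<^sup>2 * q)"
    proof -
      have "(- d x) * cnj (c x) + (- cnj (d x)) * c x + (d x * cnj (d x)) * of_real q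
          = - 2 * (c x * cnj (c x)) / of_real C + (c x * cnj (c x)) / of_real (C\<^sup>2) * of_real q"
        unfolding d_def using C by (simp add: field_simps power2_eq_square)
      also have "c x * cnj (c x) = of_real ((cmod (c x))\<^sup>2)"
        by (metis complex_norm_square of_real_power)
      finally show ?thesis by (simp add: algebra_simps)
    qed
    finally have "r = p - 2 * (cmod (c x))\<^sup>2 / C + (cmod (c x))\<^sup>2 / C\<^sup>2 * q" using of_real_eq_iff by blast
    moreover have "q \<le> C" using elim(10) C unfolding q_def by (simp add: enn2real_leI)
    then have "(cmod (c x))\<^sup>2 / C\<^sup>2 * q \<le> (cmod (c x))\<^sup>2 / C\<^sup>2 * C" by (intro mult_left_mono) auto
    then have "(cmod (c x))\<^sup>2 / C\<^sup>2 * q \<le> (cmod (c x))\<^sup>2 / C" using C by (simp add: power2_eq_square)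
    moreover have "r \<ge> 0" by (simp add: r_def)
    ultimately have "(cmod (c x))\<^sup>2 / C \<le> p" by simp
    then have "(cmod (c x))\<^sup>2 \<le> C * p" using C by (simp add: field_simps)
    moreover have "ennreal p = cond_moment f x" using elim(11) by (simp add: p_def)
    ultimately show ?case using C by (metis ennreal_leI ennreal_mult enn2real_nonneg less_imp_le p_def)
  qed
qed

lemma wct_op_measurable [measurable]:
  "\<alpha> \<in> borel_measurable M \<Longrightarrow> wct_op M F \<alpha> \<beta> f \<in> borel_measurable M"
  unfolding wct_op_def by (intro borel_measurable_times complex_cond_exp_measurable(2))

text \<open>
  Take the conditional expectation of \<open>\<bar>\<alpha>\<bar>\<^sup>2\<close> first, then use the conditional Cauchy--Schwarz inequality:
  \<open>\<parallel>\<alpha>E(\<beta>f)\<parallel>\<^sup>2 = \<integral>E(\<bar>\<alpha>\<bar>\<^sup>2)\<bar>E(\<beta>f)\<bar>\<^sup>2 \<le> CD \<integral>E(\<bar>f\<bar>\<^sup>2)\<close>.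
\<close>

lemma wct_op_l2:
  assumes \<alpha>: "\<alpha> \<in> cond_bdd C" and \<beta>: "\<beta> \<in> cond_bdd D" and C: "C \<ge> 0" and D: "D > 0" and f: "f \<in> l2_space M"
  shows "wct_op M F \<alpha> \<beta> f \<in> l2_space M" "l2_norm M (wct_op M F \<alpha> \<beta> f) \<le> sqrt (C * D) * l2_norm M f"
proof -
  let ?c = "complex_cond_exp M F (\<lambda>y. \<beta> y * f y)"
  have [measurable]: "\<alpha> \<in> borel_measurable M" "f \<in> borel_measurable M"
    using \<alpha> f by (auto simp: cond_bdd_def l2_space_def)
  have "(\<integral>\<^sup>+x. ennreal ((cmod (wct_op M F \<alpha> \<beta> f x))\<^sup>2) \<partial>M)
      = (\<integral>\<^sup>+x. ennreal ((cmod (?c x))\<^sup>2) * ennreal ((cmod (\<alpha> x))\<^sup>2) \<partial>M)"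
    by (simp add: wct_op_def norm_mult power_mult_distrib ennreal_mult mult.commute)
  also have "\<dots> = (\<integral>\<^sup>+x. ennreal ((cmod (?c x))\<^sup>2) * cond_moment \<alpha> x \<partial>M)"
    by (rule nn_cond_exp_intg[symmetric]) auto
  also have "\<dots> \<le> (\<integral>\<^sup>+x. ennreal (C * D) * cond_moment f x \<partial>M)"
  proof (rule nn_integral_mono_AE)
    have "AE x in M. cond_moment \<alpha> x \<le> ennreal C" using \<alpha> by (simp add: cond_bdd_def)
    then show "AE x in M. ennreal ((cmod (?c x))\<^sup>2) * cond_moment \<alpha> x \<le> ennreal (C * D) * cond_moment f x"
      using cond_Cauchy_Schwarz[OF \<beta> D l2_space_cond_l2[OF f]]
    proof eventually_elim
      case (elim x)
      have "ennreal ((cmod (?c x))\<^sup>2) * cond_moment \<alpha> x \<le> (ennreal D * cond_moment f x) * ennreal C"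
        by (intro mult_mono elim) auto
      then show ?case using C D by (simp add: ennreal_mult mult_ac)
    qed
  qed
  also have "\<dots> = ennreal (C * D) * (\<integral>\<^sup>+x. cond_moment f x \<partial>M)"
    by (rule nn_integral_cmult) auto
  also have "(\<integral>\<^sup>+x. cond_moment f x \<partial>M) = (\<integral>\<^sup>+x. ennreal ((cmod (f x))\<^sup>2) \<partial>M)"
    using nn_cond_exp_intg[of "\<lambda>x. 1" "\<lambda>x. ennreal ((cmod (f x))\<^sup>2)"] by simp
  finally have "(\<integral>\<^sup>+x. ennreal ((cmod (wct_op M F \<alpha> \<beta> f x))\<^sup>2) \<partial>M)
     \<le> ennreal (C * D) * (\<integral>\<^sup>+x. ennreal ((cmod (f x))\<^sup>2) \<partial>M)" .
  from l2_spaceI_nn_integral[OF _ f _ this]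
  show "wct_op M F \<alpha> \<beta> f \<in> l2_space M" "l2_norm M (wct_op M F \<alpha> \<beta> f) \<le> sqrt (C * D) * l2_norm M f"
    using C D by auto
qed

lemma wct_op_bounded:
  assumes \<alpha>: "\<alpha> \<in> cond_bdd C" and \<beta>: "\<beta> \<in> cond_bdd D" and C: "C \<ge> 0" and D: "D > 0"
  shows "l2_bounded_op M (wct_op M F \<alpha> \<beta>)"
proof (rule l2_bounded_opI)
  have b2: "\<beta> \<in> cond_l2" using \<beta> by (rule cond_bdd_cond_l2)
  note dom = cond_l2_mult_dom[OF b2 l2_space_cond_l2]
  fix f g assume f: "f \<in> l2_space M" and g: "g \<in> l2_space M"
  show "AE x in M. wct_op M F \<alpha> \<beta> (\<lambda>y. f y + g y) x = wct_op M F \<alpha> \<beta> f x + wct_op M F \<alpha> \<beta> g x"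
    using complex_cond_exp_add[OF dom[OF f] dom[OF g]]
    unfolding wct_op_def by eventually_elim (simp add: distrib_left)
next
  have b2: "\<beta> \<in> cond_l2" using \<beta> by (rule cond_bdd_cond_l2)
  note dom = cond_l2_mult_dom[OF b2 l2_space_cond_l2]
  fix c f assume f: "f \<in> l2_space M"
  show "AE x in M. wct_op M F \<alpha> \<beta> (\<lambda>y. c * f y) x = c * wct_op M F \<alpha> \<beta> f x"
    using complex_cond_exp_mult[OF borel_measurable_const dom[OF f], of c]
    unfolding wct_op_def mult.left_commute[of "\<beta> _" c] by eventually_elim simp
next
  fix f assume f: "f \<in> l2_space M"
  show "wct_op M F \<alpha> \<beta> f \<in> l2_space M" "l2_norm M (wct_op M F \<alpha> \<beta> f) \<le> sqrt (C * D) * l2_norm M f"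
    using wct_op_l2[OF assms f] by auto
qed

lemma wct_op_adjoint:
  assumes \<alpha>: "\<alpha> \<in> cond_bdd C" and \<beta>: "\<beta> \<in> cond_bdd D" and C: "C > 0" and D: "D > 0"
    and f: "f \<in> l2_space M" and g: "g \<in> l2_space M"
  shows "l2_inner M (wct_op M F \<alpha> \<beta> f) g = l2_inner M f (wct_op M F (\<lambda>x. cnj (\<beta> x)) (\<lambda>x. cnj (\<alpha> x)) g)"
proof -
  let ?E = "complex_cond_exp M F"
  have [measurable]: "\<alpha> \<in> borel_measurable M" "\<beta> \<in> borel_measurable M" "f \<in> borel_measurable M" "g \<in> borel_measurable M"
    using \<alpha> \<beta> f g by (auto simp: cond_bdd_def l2_space_def)
  have cn: "cnj (?E (\<lambda>y. cnj (\<alpha> y) * g y) x) = ?E (\<lambda>y. \<alpha> y * cnj (g y)) x" for x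
    unfolding complex_cond_exp_cnj[symmetric] by simp
  have l: "wct_op M F \<alpha> \<beta> f x * cnj (g x) = ?E (\<lambda>y. \<beta> y * f y) x * (\<alpha> x * cnj (g x))" for x
    by (simp add: wct_op_def)
  have r: "f x * cnj (wct_op M F (\<lambda>x. cnj (\<beta> x)) (\<lambda>x. cnj (\<alpha> x)) g x) = ?E (\<lambda>y. \<alpha> y * cnj (g y)) x * (\<beta> x * f x)" for x
    by (simp add: wct_op_def cn)
  have "l2_inner M (wct_op M F \<alpha> \<beta> f) g = (\<integral>x. ?E (\<lambda>y. \<beta> y * f y) x * ?E (\<lambda>y. \<alpha> y * cnj (g y)) x \<partial>M)"
    unfolding l2_inner_def l
  proof (rule complex_cond_exp_intg(2)[symmetric])
    show "integrable M (\<lambda>x. ?E (\<lambda>y. \<beta> y * f y) x * (\<alpha> x * cnj (g x)))"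
      using l2_inner_integrable[OF wct_op_l2(1)[OF \<alpha> \<beta> _ D f] g] C unfolding l by simp
  qed auto
  also have "\<dots> = (\<integral>x. ?E (\<lambda>y. \<alpha> y * cnj (g y)) x * ?E (\<lambda>y. \<beta> y * f y) x \<partial>M)"
    by (simp add: mult.commute)
  also have "\<dots> = l2_inner M f (wct_op M F (\<lambda>x. cnj (\<beta> x)) (\<lambda>x. cnj (\<alpha> x)) g)"
    unfolding l2_inner_def r
  proof (rule complex_cond_exp_intg(2))
    show "integrable M (\<lambda>x. ?E (\<lambda>y. \<alpha> y * cnj (g y)) x * (\<beta> x * f x))"
      using l2_inner_integrable[OF f wct_op_l2(1)[OF cond_bdd_cnj[OF \<beta>] cond_bdd_cnj[OF \<alpha>] _ C g]] D unfolding r by simp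
  qed auto
  finally show ?thesis .
qed

text \<open>
  Operators of the form \<open>f \<mapsto> \<alpha>E(\<beta>f)\<close> compose like operators of rank one, with functions measurable
  in the subalgebra as scalars.
\<close>

lemma wct_op_compose:
  assumes \<beta>: "\<beta> \<in> cond_l2" and \<gamma>: "\<gamma> \<in> cond_l2"
  shows "AE x in M. wct_op M F \<alpha> \<beta> (wct_op M F \<gamma> \<delta> f) x
    = wct_op M F (\<lambda>x. \<alpha> x * complex_cond_exp M F (\<lambda>y. \<beta> y * \<gamma> y) x) \<delta> f x"
  using complex_cond_exp_mult[OF complex_cond_exp_measurable(1)[of "\<lambda>y. \<delta> y * f y"] cond_l2_mult_dom[OF \<beta> \<gamma>]]
  unfolding wct_op_def by eventually_elim (simp add: mult_ac)

lemma wct_op_cong_left: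
  "AE x in M. \<alpha> x = \<alpha>' x \<Longrightarrow> AE x in M. wct_op M F \<alpha> \<beta> f x = wct_op M F \<alpha>' \<beta> f x"
  unfolding wct_op_def by (auto elim: eventually_mono)

lemma wct_op_mult_right:
  assumes a: "a \<in> borel_measurable F" and \<beta>: "\<beta> \<in> cond_l2" and f: "f \<in> l2_space M"
  shows "AE x in M. wct_op M F \<alpha> (\<lambda>x. a x * \<beta> x) f x = wct_op M F (\<lambda>x. a x * \<alpha> x) \<beta> f x"
  using complex_cond_exp_mult[OF a cond_l2_mult_dom[OF \<beta> l2_space_cond_l2[OF f]]]
  unfolding wct_op_def by eventually_elim (simp add: mult_ac)

end

section \<open>Operators in normalized form\<close>

text \<open>
  The operator to be studied is \<open>f \<mapsto> \<omega>E(\<nu>f)\<close>. The right weight has conditional norm \<open>1\<close> on \<open>S\<close> and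
  vanishes elsewhere, so that \<open>\<nu>\<close> behaves like a unit vector over each point of \<open>S\<close>; all of the size
  of the operator sits in the left weight.
\<close>

locale normalized_wct = sigma_finite_subalgebra M F for M F :: "'a measure" +
  fixes \<nu> \<omega> :: "'a \<Rightarrow> complex" and S :: "'a set" and C :: real
  assumes nu_measurable [measurable]: "\<nu> \<in> borel_measurable M"
    and S_sets [measurable]: "S \<in> sets F"
    and nu_moment: "AE x in M. cond_moment \<nu> x = indicator S x"
    and omega_bdd: "\<omega> \<in> cond_bdd C" and C_pos: "C > 0"
    and omega_off: "AE x in M. x \<notin> S \<longrightarrow> \<omega> x = 0"
begin

abbreviation E :: "('a \<Rightarrow> complex) \<Rightarrow> 'a \<Rightarrow> complex" where "E \<equiv> complex_cond_exp M F"

text \<open>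
  \<open>P 1\<close> is the orthogonal projection onto the closed submodule generated by the conjugate of \<open>\<nu>\<close>,
  and \<open>P a\<close> is that projection followed by multiplication with \<open>a\<close>. The map \<open>a \<mapsto> P a\<close> is a
  homomorphism of *-algebras, which reduces square roots of operators to square roots of functions.
\<close>

definition P :: "('a \<Rightarrow> complex) \<Rightarrow> ('a \<Rightarrow> complex) \<Rightarrow> 'a \<Rightarrow> complex" where
  "P a = wct_op M F (\<lambda>x. a x * cnj (\<nu> x)) \<nu>"

definition ess_bdd :: "real \<Rightarrow> ('a \<Rightarrow> complex) set" where
  "ess_bdd K = {a \<in> borel_measurable F. AE x in M. cmod (a x) \<le> K}"

lemma omega_measurable [measurable]: "\<omega> \<in> borel_measurable M"
  using omega_bdd by (simp add: cond_bdd_def)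

lemma nu_bdd: "\<nu> \<in> cond_bdd 1"
  unfolding cond_bdd_def using nu_moment by (auto simp: indicator_def elim!: eventually_mono)

lemma nu_l2: "\<nu> \<in> cond_l2" and omega_l2: "\<omega> \<in> cond_l2"
  using cond_bdd_cond_l2[OF nu_bdd] cond_bdd_cond_l2[OF omega_bdd] by auto

lemma nu_off: "AE x in M. x \<notin> S \<longrightarrow> \<nu> x = 0"
  using nu_moment cond_moment_eq_0[OF nu_measurable] by eventually_elim (auto simp: indicator_def)

lemma E_nu_nu: "AE x in M. E (\<lambda>x. \<nu> x * cnj (\<nu> x)) x = indicator S x"
  using cond_exp_moment[OF nu_measurable] nu_moment by eventually_elim (auto simp: indicator_def)

lemma weighted_cond_bdd:
  assumes a: "a \<in> borel_measurable F" and g: "g \<in> borel_measurable M"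
    and le: "AE x in M. ennreal ((cmod (a x))\<^sup>2) * cond_moment g x \<le> ennreal K"
  shows "(\<lambda>x. a x * g x) \<in> cond_bdd K"
proof -
  have "AE x in M. cond_moment (\<lambda>x. a x * g x) x \<le> ennreal K"
    using cond_moment_mult[OF a g] le by eventually_elim simp
  then show ?thesis using F_measurable_M[OF a] g by (simp add: cond_bdd_def)
qed

lemma P_weight_bdd:
  assumes a: "a \<in> ess_bdd K"
  shows "(\<lambda>x. a x * cnj (\<nu> x)) \<in> cond_bdd (K\<^sup>2)"
proof (rule weighted_cond_bdd)
  show "a \<in> borel_measurable F" using a by (simp add: ess_bdd_def)
  have "AE x in M. cmod (a x) \<le> K" using a by (simp add: ess_bdd_def)
  moreover have "AE x in M. cond_moment (\<lambda>x. cnj (\<nu> x)) x \<le> 1"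
    using nu_moment by (auto simp: indicator_def elim!: eventually_mono)
  ultimately show "AE x in M. ennreal ((cmod (a x))\<^sup>2) * cond_moment (\<lambda>x. cnj (\<nu> x)) x \<le> ennreal (K\<^sup>2)"
  proof eventually_elim
    case (elim x)
    have "ennreal ((cmod (a x))\<^sup>2) * cond_moment (\<lambda>x. cnj (\<nu> x)) x \<le> ennreal (K\<^sup>2) * 1"
      using elim by (intro mult_mono ennreal_leI power_mono) auto
    then show ?case by simp
  qed
qed (auto intro: borel_measurable_cnj)

lemma P_measurable: "a \<in> borel_measurable F \<Longrightarrow> P a f \<in> borel_measurable M"
  unfolding P_def by (intro wct_op_measurable borel_measurable_times borel_measurable_cnj F_measurable_M nu_measurable)

lemma P_bounded: "a \<in> ess_bdd K \<Longrightarrow> l2_bounded_op M (P a)"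
  unfolding P_def by (rule wct_op_bounded[OF P_weight_bdd nu_bdd]) auto

lemma P_norm:
  assumes "a \<in> ess_bdd K" "K \<ge> 0" "f \<in> l2_space M"
  shows "l2_norm M (P a f) \<le> K * l2_norm M f"
  using wct_op_l2(2)[OF P_weight_bdd[OF assms(1)] nu_bdd _ _ assms(3)] assms(2) by (simp add: P_def)

text \<open>
  On \<open>S\<close> one has \<open>E(\<nu> a \<nu>\<^sup>*) = a\<close>; outside \<open>S\<close> the left weight vanishes.
\<close>

lemma wct_P:
  assumes a: "a \<in> ess_bdd K" and off: "AE x in M. x \<notin> S \<longrightarrow> \<alpha> x = 0"
  shows "AE x in M. wct_op M F \<alpha> \<nu> (P a f) x = wct_op M F (\<lambda>x. \<alpha> x * a x) \<nu> f x"
proof -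
  have aF: "a \<in> borel_measurable F" using a by (simp add: ess_bdd_def)
  have "AE x in M. E (\<lambda>x. a x * (\<nu> x * cnj (\<nu> x))) x = a x * E (\<lambda>x. \<nu> x * cnj (\<nu> x)) x"
    by (rule complex_cond_exp_mult[OF aF cond_l2_mult_dom[OF nu_l2 cond_l2_cnj[OF nu_l2]]])
  then have "AE x in M. \<alpha> x * E (\<lambda>x. \<nu> x * (a x * cnj (\<nu> x))) x = \<alpha> x * a x"
    unfolding mult.left_commute[of "\<nu> _" "a _"] using E_nu_nu off
    by eventually_elim (auto simp: indicator_def)
  then have "AE x in M. wct_op M F (\<lambda>x. \<alpha> x * E (\<lambda>x. \<nu> x * (a x * cnj (\<nu> x))) x) \<nu> f x
      = wct_op M F (\<lambda>x. \<alpha> x * a x) \<nu> f x"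
    by (rule wct_op_cong_left)
  then show ?thesis
    using wct_op_compose[OF nu_l2 cond_bdd_cond_l2[OF P_weight_bdd[OF a]], of \<alpha> \<nu> f]
    unfolding P_def by eventually_elim simp
qed

lemma P_P:
  assumes b: "b \<in> ess_bdd K"
  shows "AE x in M. P a (P b f) x = P (\<lambda>x. a x * b x) f x"
proof -
  have "AE x in M. x \<notin> S \<longrightarrow> a x * cnj (\<nu> x) = 0" using nu_off by eventually_elim auto
  from wct_P[OF b this, of f] show ?thesis unfolding P_def[of a] P_def[of "\<lambda>x. a x * b x"] by (simp add: mult_ac)
qed

lemma P_adjoint:
  assumes a: "a \<in> ess_bdd K" and K: "K > 0" and f: "f \<in> l2_space M" and g: "g \<in> l2_space M"
  shows "l2_inner M (P a f) g = l2_inner M f (P (\<lambda>x. cnj (a x)) g)"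
proof -
  have aF: "(\<lambda>x. cnj (a x)) \<in> borel_measurable F" using a by (simp add: ess_bdd_def borel_measurable_cnj)
  have ca: "(\<lambda>x. cnj (a x)) \<in> ess_bdd K" using a by (simp add: ess_bdd_def borel_measurable_cnj)
  have "l2_inner M (P a f) g = l2_inner M f (wct_op M F (\<lambda>x. cnj (\<nu> x)) (\<lambda>x. cnj (a x * cnj (\<nu> x))) g)"
    unfolding P_def using K by (intro wct_op_adjoint[OF P_weight_bdd[OF a] nu_bdd _ _ f g]) auto
  also have "\<dots> = l2_inner M f (P (\<lambda>x. cnj (a x)) g)"
  proof (rule l2_inner_cong_AE)
    have "AE x in M. wct_op M F (\<lambda>x. cnj (\<nu> x)) (\<lambda>x. cnj (a x) * \<nu> x) g x
        = wct_op M F (\<lambda>x. cnj (a x) * cnj (\<nu> x)) \<nu> g x"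
      by (rule wct_op_mult_right[OF aF nu_l2 g])
    then show "AE x in M. wct_op M F (\<lambda>x. cnj (\<nu> x)) (\<lambda>x. cnj (a x * cnj (\<nu> x))) g x = P (\<lambda>x. cnj (a x)) g x"
      by (simp add: P_def)
    show "wct_op M F (\<lambda>x. cnj (\<nu> x)) (\<lambda>x. cnj (a x * cnj (\<nu> x))) g \<in> l2_space M"
      using K by (intro wct_op_l2(1)[OF cond_bdd_cnj[OF nu_bdd] cond_bdd_cnj[OF P_weight_bdd[OF a]] _ _ g]) auto
    show "P (\<lambda>x. cnj (a x)) g \<in> l2_space M" by (rule l2_bounded_op_in[OF P_bounded[OF ca] g])
  qed (use f in auto)
  finally show ?thesis .
qed

abbreviation Q :: "('a \<Rightarrow> real) \<Rightarrow> ('a \<Rightarrow> complex) \<Rightarrow> 'a \<Rightarrow> complex" where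
  "Q r \<equiv> P (\<lambda>x. of_real (r x))"

definition ess_bdd_nonneg :: "real \<Rightarrow> ('a \<Rightarrow> real) set" where
  "ess_bdd_nonneg K = {r \<in> borel_measurable F. (\<forall>x. 0 \<le> r x) \<and> (AE x in M. r x \<le> K)}"

lemma ess_bdd_nonneg_of_real: "r \<in> ess_bdd_nonneg K \<Longrightarrow> (\<lambda>x. of_real (r x)) \<in> ess_bdd K"
  by (auto simp: ess_bdd_nonneg_def ess_bdd_def elim: eventually_mono)

lemma ess_bdd_nonneg_sqrt: "r \<in> ess_bdd_nonneg K \<Longrightarrow> (\<lambda>x. sqrt (r x)) \<in> ess_bdd_nonneg (sqrt K)"
  by (auto simp: ess_bdd_nonneg_def elim: eventually_mono)

lemma Q_Q_sqrt:
  assumes "r \<in> ess_bdd_nonneg K"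
  shows "AE x in M. Q (\<lambda>x. sqrt (r x)) (Q (\<lambda>x. sqrt (r x)) f) x = Q r f x"
proof -
  have "complex_of_real (sqrt (r x)) * complex_of_real (sqrt (r x)) = of_real (r x)" for x
    using assms by (simp add: ess_bdd_nonneg_def flip: of_real_mult)
  with P_P[OF ess_bdd_nonneg_of_real[OF ess_bdd_nonneg_sqrt[OF assms]], of "\<lambda>x. of_real (sqrt (r x))" f]
  show ?thesis by simp
qed

lemma Q_form:
  assumes r: "r \<in> ess_bdd_nonneg K" and K: "K > 0" and f: "f \<in> l2_space M"
  shows "l2_inner M (Q r f) f = of_real ((l2_norm M (Q (\<lambda>x. sqrt (r x)) f))\<^sup>2)"
proof -
  let ?s = "\<lambda>x. sqrt (r x)"
  have s: "(\<lambda>x. complex_of_real (?s x)) \<in> ess_bdd (sqrt K)"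
    by (rule ess_bdd_nonneg_of_real[OF ess_bdd_nonneg_sqrt[OF r]])
  note sin = l2_bounded_op_in[OF P_bounded[OF s]]
  have "l2_inner M (Q r f) f = l2_inner M (Q ?s (Q ?s f)) f"
    using Q_Q_sqrt[OF r, of f] f
    by (intro l2_inner_cong_AE sin l2_bounded_op_in[OF P_bounded[OF ess_bdd_nonneg_of_real[OF r]]]) (auto simp: eq_commute)
  also have "\<dots> = l2_inner M (Q ?s f) (Q ?s f)"
    using P_adjoint[OF s _ sin[OF f] f] K by simp
  finally show ?thesis by (simp add: l2_inner_self)
qed

lemma Q_positive:
  assumes r: "r \<in> ess_bdd_nonneg K" and K: "K > 0"
  shows "l2_positive M (Q r)"
  unfolding l2_positive_def using P_bounded[OF ess_bdd_nonneg_of_real[OF r]] Q_form[OF r K]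
  by (simp flip: of_real_power)

lemma Q_sqrt:
  assumes r: "r \<in> ess_bdd_nonneg K" and K: "K > 0" and A: "l2_op_eq M A (Q r)"
  shows "l2_positive M (l2_sqrt M A)" "l2_op_eq M (l2_sqrt M A) (Q (\<lambda>x. sqrt (r x)))"
proof -
  have p: "l2_positive M (Q (\<lambda>x. sqrt (r x)))" using K by (intro Q_positive[OF ess_bdd_nonneg_sqrt[OF r]]) simp
  have "l2_op_eq M (\<lambda>f. Q (\<lambda>x. sqrt (r x)) (Q (\<lambda>x. sqrt (r x)) f)) (Q r)"
    unfolding l2_op_eq_def using Q_Q_sqrt[OF r] by blast
  from l2_sqrt_eqI[OF p l2_op_eq_trans[OF this l2_op_eq_sym[OF A]]]
  show "l2_positive M (l2_sqrt M A)" "l2_op_eq M (l2_sqrt M A) (Q (\<lambda>x. sqrt (r x)))" .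
qed

section \<open>Modulus and polar decomposition\<close>

text \<open>
  The function \<open>b\<close> is the conditional norm of \<open>\<omega>\<close>; it turns out to be the weight of the modulus. The
  function \<open>c\<close> is the conditional inner product of \<open>\<omega>\<close> with the conjugate of \<open>\<nu>\<close>; it turns out to be
  the weight of the Aluthge transform.
\<close>

definition b :: "'a \<Rightarrow> real" where "b x = sqrt (enn2real (cond_moment \<omega> x))"

definition c :: "'a \<Rightarrow> complex" where "c = E (\<lambda>x. \<nu> x * \<omega> x)"

lemma b_measurable [measurable]: "b \<in> borel_measurable F" unfolding b_def by measurable

lemma b_nonneg [simp]: "0 \<le> b x" by (simp add: b_def)

lemma c_measurable [measurable]: "c \<in> borel_measurable F" unfolding c_def by measurable

lemma b_square: "AE x in M. ennreal ((b x)\<^sup>2) = cond_moment \<omega> x"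
  using omega_l2 unfolding cond_l2_def b_def by (auto elim!: eventually_mono)

lemma b_bdd: "b \<in> ess_bdd_nonneg (sqrt C)"
proof -
  have "AE x in M. cond_moment \<omega> x \<le> ennreal C" using omega_bdd by (simp add: cond_bdd_def)
  then have "AE x in M. b x \<le> sqrt C"
    by eventually_elim (use C_pos in \<open>simp add: b_def enn2real_leI\<close>)
  then show ?thesis by (simp add: ess_bdd_nonneg_def)
qed

lemma omega_eq_0: "AE x in M. b x = 0 \<longrightarrow> \<omega> x = 0"
  using b_square cond_moment_eq_0[OF omega_measurable] by eventually_elim (metis ennreal_0 power_zero_numeral)

text \<open>
  The conditional Cauchy--Schwarz inequality for \<open>\<nu>\<close> and \<open>\<omega>\<close>. The weak hyponormality will force
  equality in it.
\<close>

lemma c_le_b: "AE x in M. cmod (c x) \<le> b x"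
  using cond_Cauchy_Schwarz[OF nu_bdd zero_less_one omega_l2] b_square
proof eventually_elim
  case (elim x)
  have "ennreal ((cmod (c x))\<^sup>2) \<le> ennreal ((b x)\<^sup>2)" using elim unfolding c_def by simp
  then have "(cmod (c x))\<^sup>2 \<le> (b x)\<^sup>2" by (simp add: ennreal_le_iff)
  then show ?case by (rule power2_le_imp_le) simp
qed

lemma c_bdd: "c \<in> ess_bdd (sqrt C)" "(\<lambda>x. cmod (c x)) \<in> ess_bdd_nonneg (sqrt C)"
proof -
  have "AE x in M. b x \<le> sqrt C" using b_bdd by (simp add: ess_bdd_nonneg_def)
  then have "AE x in M. cmod (c x) \<le> sqrt C" using c_le_b by eventually_elim simp
  then show "c \<in> ess_bdd (sqrt C)" "(\<lambda>x. cmod (c x)) \<in> ess_bdd_nonneg (sqrt C)"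
    by (auto simp: ess_bdd_def ess_bdd_nonneg_def)
qed

abbreviation T0 :: "('a \<Rightarrow> complex) \<Rightarrow> 'a \<Rightarrow> complex" where "T0 \<equiv> wct_op M F \<omega> \<nu>"

abbreviation T0_adj :: "('a \<Rightarrow> complex) \<Rightarrow> 'a \<Rightarrow> complex" where
  "T0_adj \<equiv> wct_op M F (\<lambda>x. cnj (\<nu> x)) (\<lambda>x. cnj (\<omega> x))"

lemma T0_bounded: "l2_bounded_op M T0"
  using C_pos by (intro wct_op_bounded[OF omega_bdd nu_bdd]) auto

lemma T0_adj_bounded: "l2_bounded_op M T0_adj"
  using C_pos by (intro wct_op_bounded[OF cond_bdd_cnj[OF nu_bdd] cond_bdd_cnj[OF omega_bdd]]) auto

lemma T0_adjoint: "f \<in> l2_space M \<Longrightarrow> g \<in> l2_space M \<Longrightarrow> l2_inner M (T0 f) g = l2_inner M f (T0_adj g)"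
  using C_pos by (intro wct_op_adjoint[OF omega_bdd nu_bdd]) auto

text \<open>
  The left weight enters \<open>T\<^sup>*T\<close> only through its conditional norm.
\<close>

lemma weight_adj_compose:
  assumes \<gamma>: "\<gamma> \<in> cond_l2" and r: "AE x in M. cond_moment \<gamma> x = ennreal (r x)" and nn: "\<And>x. 0 \<le> r x"
  shows "AE x in M. wct_op M F (\<lambda>x. cnj (\<nu> x)) (\<lambda>x. cnj (\<gamma> x)) (wct_op M F \<gamma> \<nu> f) x = Q r f x"
proof -
  have m: "\<gamma> \<in> borel_measurable M" using \<gamma> by (simp add: cond_l2_def)
  have "AE x in M. E (\<lambda>x. cnj (\<gamma> x) * \<gamma> x) x = of_real (r x)"
    using cond_exp_moment[OF m] r unfolding mult.commute[of "cnj (\<gamma> _)"]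
    by eventually_elim (simp add: nn)
  then have "AE x in M. cnj (\<nu> x) * E (\<lambda>x. cnj (\<gamma> x) * \<gamma> x) x = of_real (r x) * cnj (\<nu> x)"
    by eventually_elim simp
  from wct_op_cong_left[OF this]
  have "AE x in M. wct_op M F (\<lambda>x. cnj (\<nu> x) * E (\<lambda>x. cnj (\<gamma> x) * \<gamma> x) x) \<nu> f x = Q r f x"
    unfolding P_def .
  then show ?thesis
    using wct_op_compose[OF cond_l2_cnj[OF \<gamma>] \<gamma>, of "\<lambda>x. cnj (\<nu> x)" \<nu> f] by eventually_elim simp
qed

lemma T0_adj_T0: "AE x in M. T0_adj (T0 f) x = Q (\<lambda>x. (b x)\<^sup>2) f x"
  by (rule weight_adj_compose[OF omega_l2]) (use b_square in \<open>auto simp: eq_commute\<close>)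

lemma Q_Q_square:
  assumes "r \<in> ess_bdd_nonneg K"
  shows "AE x in M. Q r (Q r f) x = Q (\<lambda>x. (r x)\<^sup>2) f x"
  using P_P[OF ess_bdd_nonneg_of_real[OF assms], of "\<lambda>x. of_real (r x)" f] by (simp add: power2_eq_square)

lemma T0_abs:
  assumes T: "l2_op_eq M T T0" and Tmap: "\<forall>f\<in>l2_space M. T f \<in> l2_space M"
  shows "l2_positive M (l2_abs M T)" "l2_op_eq M (l2_abs M T) (Q b)"
proof -
  note Tin = bspec[OF Tmap]
  have adj: "l2_inner M (T f) g = l2_inner M f (T0_adj g)" if "f \<in> l2_space M" "g \<in> l2_space M" for f g
  proof -
    have "l2_inner M (T f) g = l2_inner M (T0 f) g"
      using T that by (intro l2_inner_cong_AE Tin l2_bounded_op_in[OF T0_bounded]) (auto simp: l2_op_eq_def)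
    then show ?thesis using T0_adjoint[OF that] by simp
  qed
  have "l2_op_eq M (\<lambda>f. Q b (Q b f)) (\<lambda>f. T0_adj (T f))"
    unfolding l2_op_eq_def
  proof
    fix f assume f: "f \<in> l2_space M"
    have "AE x in M. T0_adj (T f) x = T0_adj (T0 f) x"
      using T f by (intro l2_bounded_op_cong[OF T0_adj_bounded] Tin l2_bounded_op_in[OF T0_bounded]) (auto simp: l2_op_eq_def)
    then show "AE x in M. Q b (Q b f) x = T0_adj (T f) x"
      using T0_adj_T0[of f] Q_Q_square[OF b_bdd, of f] by eventually_elim simp
  qed
  then show "l2_positive M (l2_abs M T)" "l2_op_eq M (l2_abs M T) (Q b)"
    using l2_abs_eqI[OF Tin T0_adj_bounded adj Q_positive[OF b_bdd]] C_pos by auto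
qed

lemma Pc_abs:
  assumes T: "l2_op_eq M T (P c)" and Tmap: "\<forall>f\<in>l2_space M. T f \<in> l2_space M"
  shows "l2_positive M (l2_abs M T)" "l2_op_eq M (l2_abs M T) (Q (\<lambda>x. cmod (c x)))"
proof -
  note Tin = bspec[OF Tmap]
  let ?m = "\<lambda>x. cmod (c x)"
  note c = c_bdd(1)
  have cc: "(\<lambda>x. cnj (c x)) \<in> ess_bdd (sqrt C)" using c by (simp add: ess_bdd_def borel_measurable_cnj)
  have adj: "l2_inner M (T f) g = l2_inner M f (P (\<lambda>x. cnj (c x)) g)" if "f \<in> l2_space M" "g \<in> l2_space M" for f g
  proof -
    have "l2_inner M (T f) g = l2_inner M (P c f) g"
      using T that by (intro l2_inner_cong_AE Tin l2_bounded_op_in[OF P_bounded[OF c]]) (auto simp: l2_op_eq_def)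
    then show ?thesis using P_adjoint[OF c _ that] C_pos by simp
  qed
  have "l2_op_eq M (\<lambda>f. Q ?m (Q ?m f)) (\<lambda>f. P (\<lambda>x. cnj (c x)) (T f))"
    unfolding l2_op_eq_def
  proof
    fix f assume f: "f \<in> l2_space M"
    have "AE x in M. P (\<lambda>x. cnj (c x)) (T f) x = P (\<lambda>x. cnj (c x)) (P c f) x"
      using T f by (intro l2_bounded_op_cong[OF P_bounded[OF cc]] Tin l2_bounded_op_in[OF P_bounded[OF c]]) (auto simp: l2_op_eq_def)
    moreover have "cnj (c x) * c x = of_real ((cmod (c x))\<^sup>2)" for x
      by (metis complex_norm_square mult.commute of_real_power)
    then have "AE x in M. P (\<lambda>x. cnj (c x)) (P c f) x = Q (\<lambda>x. (?m x)\<^sup>2) f x"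
      using P_P[OF c, of "\<lambda>x. cnj (c x)" f] by (simp only:)
    ultimately show "AE x in M. Q ?m (Q ?m f) x = P (\<lambda>x. cnj (c x)) (T f) x"
      using Q_Q_square[OF c_bdd(2), of f] by eventually_elim simp
  qed
  then show "l2_positive M (l2_abs M T)" "l2_op_eq M (l2_abs M T) (Q ?m)"
    using l2_abs_eqI[OF Tin P_bounded[OF cc] adj Q_positive[OF c_bdd(2)]] C_pos by auto
qed

lemma E_nu_P:
  assumes a: "a \<in> ess_bdd K"
  shows "AE x in M. E (\<lambda>y. \<nu> y * P a f y) x = indicator S x * a x * E (\<lambda>y. \<nu> y * f y) x"
proof -
  have aF: "a \<in> borel_measurable F" using a by (simp add: ess_bdd_def)
  define h where "h = E (\<lambda>y. \<nu> y * f y)"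
  have h: "(\<lambda>x. a x * h x) \<in> borel_measurable F" unfolding h_def using aF by measurable
  have eq: "\<nu> y * P a f y = (a y * h y) * (\<nu> y * cnj (\<nu> y))" for y
    by (simp add: P_def wct_op_def h_def)
  show ?thesis
    unfolding h_def[symmetric] eq
    using complex_cond_exp_mult[OF h cond_l2_mult_dom[OF nu_l2 cond_l2_cnj[OF nu_l2]]] E_nu_nu
    by eventually_elim simp
qed

lemma omega_div_b:
  "(\<lambda>x. inverse (of_real (b x)) * \<omega> x) \<in> cond_bdd 1"
  "AE x in M. cond_moment (\<lambda>x. inverse (of_real (b x)) * \<omega> x) x = ennreal (if b x = 0 then 0 else 1)"
proof -
  have iF: "(\<lambda>x. inverse (complex_of_real (b x))) \<in> borel_measurable F" by measurable
  show eq: "AE x in M. cond_moment (\<lambda>x. inverse (of_real (b x)) * \<omega> x) x = ennreal (if b x = 0 then 0 else 1)"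
    using cond_moment_mult[OF iF omega_measurable] b_square
  proof eventually_elim
    case (elim x)
    show ?case
      unfolding elim(1) elim(2)[symmetric]
      by (cases "b x = 0") (simp_all add: norm_inverse power_inverse ennreal_mult[symmetric])
  qed
  have "(\<lambda>x. inverse (complex_of_real (b x)) * \<omega> x) \<in> borel_measurable M"
    using F_measurable_M[OF iF] omega_measurable by (rule borel_measurable_times)
  then show "(\<lambda>x. inverse (of_real (b x)) * \<omega> x) \<in> cond_bdd 1"
    using eq by (auto simp: cond_bdd_def elim!: eventually_mono)
qed

text \<open>
  Where \<open>b = 0\<close> the inverse is \<open>0\<close>, so \<open>U0\<close> has the right weight \<open>\<nu>\<close> and a left weight of
  conditional norm \<open>1\<close> or \<open>0\<close>: it is a partial isometry. It shows that a polar decomposition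
  exists, so that \<open>l2_polar\<close> has its defining properties.
\<close>

definition U0 :: "('a \<Rightarrow> complex) \<Rightarrow> 'a \<Rightarrow> complex" where
  "U0 = wct_op M F (\<lambda>x. inverse (of_real (b x)) * \<omega> x) \<nu>"

lemma U0_bounded: "l2_bounded_op M U0"
  unfolding U0_def by (rule wct_op_bounded[OF omega_div_b(1) nu_bdd]) auto

lemma U0_off: "AE x in M. x \<notin> S \<longrightarrow> inverse (of_real (b x)) * \<omega> x = 0"
  using omega_off by eventually_elim auto

abbreviation e :: "'a \<Rightarrow> real" where "e x \<equiv> (if b x = 0 then 0 else 1)"

lemma e_bdd: "e \<in> ess_bdd_nonneg 1"
  unfolding ess_bdd_nonneg_def by simp

lemma U0_form:
  assumes f: "f \<in> l2_space M"
  shows "of_real ((l2_norm M (U0 f))\<^sup>2) = l2_inner M f (Q e f)"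
proof -
  let ?g = "\<lambda>x. inverse (of_real (b x)) * \<omega> x"
  let ?U = "wct_op M F (\<lambda>x. cnj (\<nu> x)) (\<lambda>x. cnj (?g x))"
  have Ubd: "l2_bounded_op M ?U"
    by (rule wct_op_bounded[OF cond_bdd_cnj[OF nu_bdd] cond_bdd_cnj[OF omega_div_b(1)]]) auto
  have "of_real ((l2_norm M (U0 f))\<^sup>2) = l2_inner M f (?U (U0 f))"
    unfolding l2_inner_self[symmetric] U0_def
    by (rule wct_op_adjoint[OF omega_div_b(1) nu_bdd _ _ f l2_bounded_op_in[OF U0_bounded[unfolded U0_def] f]]) auto
  also have "\<dots> = l2_inner M f (Q e f)"
  proof (rule l2_inner_cong_AE)
    show "AE x in M. ?U (U0 f) x = Q e f x"
      unfolding U0_def by (rule weight_adj_compose[OF cond_bdd_cond_l2[OF omega_div_b(1)] omega_div_b(2)]) simp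
  qed (use f Ubd U0_bounded P_bounded[OF ess_bdd_nonneg_of_real[OF e_bdd]] in \<open>auto intro: l2_bounded_op_in\<close>)
  finally show ?thesis .
qed

text \<open>
  As \<open>Q e\<close> is the initial projection of \<open>U0\<close>, the vector \<open>f - Q e f\<close> lies in the kernel. If \<open>f\<close> is
  orthogonal to the kernel, then \<open>\<parallel>f\<parallel>\<^sup>2 = \<langle>f, Q e f\<rangle> = \<parallel>U0 f\<parallel>\<^sup>2\<close>.
\<close>

lemma U0_partial_isometry: "l2_partial_isometry M U0"
  unfolding l2_partial_isometry_def
proof (intro conjI ballI impI)
  show "l2_bounded_op M U0" by (rule U0_bounded)
  fix f assume f: "f \<in> l2_space M" and orth: "\<forall>g\<in>l2_ker M U0. l2_inner M f g = 0"
  let ?g = "\<lambda>x. f x - Q e f x"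
  have Qf: "Q e f \<in> l2_space M"
    by (rule l2_bounded_op_in[OF P_bounded[OF ess_bdd_nonneg_of_real[OF e_bdd]] f])
  have g: "?g \<in> l2_space M" by (rule l2_space_diff[OF f Qf])
  have "AE x in M. wct_op M F (\<lambda>x. inverse (of_real (b x)) * \<omega> x * of_real (e x)) \<nu> f x = U0 f x"
    unfolding U0_def by (rule wct_op_cong_left) auto
  then have "AE x in M. U0 (Q e f) x = U0 f x"
    using wct_P[OF ess_bdd_nonneg_of_real[OF e_bdd] U0_off, of f] unfolding U0_def
    by eventually_elim simp
  then have "AE x in M. U0 ?g x = 0"
    using l2_bounded_op_diff[OF U0_bounded f Qf] by eventually_elim simp
  then have "?g \<in> l2_ker M U0" using g by (simp add: l2_ker_def)
  then have "l2_inner M f f = l2_inner M f (Q e f)"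
    using orth l2_inner_diff_right[OF f Qf f] by simp
  then have "complex_of_real ((l2_norm M f)\<^sup>2) = of_real ((l2_norm M (U0 f))\<^sup>2)"
    using U0_form[OF f] by (simp add: l2_inner_self)
  then have "(l2_norm M f)\<^sup>2 = (l2_norm M (U0 f))\<^sup>2" using of_real_eq_iff by blast
  then show "l2_norm M (U0 f) = l2_norm M f" by (metis l2_norm_nonneg power2_eq_imp_eq)
qed

lemma U0_Qb: "AE x in M. U0 (Q b f) x = T0 f x"
proof -
  have "AE x in M. inverse (of_real (b x)) * \<omega> x * of_real (b x) = \<omega> x"
    using omega_eq_0 by eventually_elim auto
  from wct_op_cong_left[OF this] wct_P[OF ess_bdd_nonneg_of_real[OF b_bdd] U0_off, of f]
  show ?thesis unfolding U0_def by eventually_elim simp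
qed

text \<open>
  Both kernels consist of the \<open>f\<close> with \<open>E(\<nu>f) = 0\<close> where \<open>b \<noteq> 0\<close>: for \<open>Q b\<close> because
  \<open>E(\<nu> Q b f) = b E(\<nu>f)\<close>.
\<close>

lemma U0_kernel:
  assumes f: "f \<in> l2_space M"
  shows "(AE x in M. U0 f x = 0) \<longleftrightarrow> (AE x in M. Q b f x = 0)"
proof
  assume "AE x in M. U0 f x = 0"
  then have "l2_norm M (U0 f) = 0"
    using l2_norm_eq_0_iff[OF l2_bounded_op_in[OF U0_bounded f]] by simp
  then have "Re (l2_inner M (Q e f) f) = 0"
    using U0_form[OF f] l2_inner_commute[of M "Q e f" f] by simp
  then have "AE x in M. Q e f x = 0"
    by (rule l2_positive_kernel[OF Q_positive[OF e_bdd zero_less_one] f])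
  then have "AE x in M. b x * Q e f x = 0" by eventually_elim simp
  moreover have "of_real (b x) * Q e f x = Q b f x" for x
    by (simp add: P_def wct_op_def)
  ultimately show "AE x in M. Q b f x = 0" by simp
next
  assume z: "AE x in M. Q b f x = 0"
  note bb = ess_bdd_nonneg_of_real[OF b_bdd]
  have Qf: "Q b f \<in> borel_measurable M"
    using l2_bounded_op_in[OF P_bounded[OF bb] f] by (simp add: l2_space_def)
  have "AE x in M. E (\<lambda>y. \<nu> y * Q b f y) x = E (\<lambda>y. 0 * \<nu> y) x"
    by (rule complex_cond_exp_cong) (use z Qf in auto)
  moreover have "AE x in M. E (\<lambda>y. 0 * \<nu> y) x = 0"
    using complex_cond_exp_zero by simp
  ultimately show "AE x in M. U0 f x = 0"
    using E_nu_P[OF bb, of f] U0_off unfolding U0_def wct_op_def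
    by eventually_elim (auto simp: indicator_def split: if_splits)
qed

lemma T0_polar:
  assumes T: "l2_op_eq M T T0" and Tmap: "\<forall>f\<in>l2_space M. T f \<in> l2_space M"
  shows "l2_bounded_op M (l2_polar M T)" "l2_op_eq M T (\<lambda>f. l2_polar M T (l2_abs M T f))"
proof -
  note A = T0_abs[OF T Tmap]
  note Ain = l2_bounded_op_in[OF l2_positiveD(1)[OF A(1)]]
  note Qin = l2_bounded_op_in[OF P_bounded[OF ess_bdd_nonneg_of_real[OF b_bdd]]]
  have "l2_partial_isometry M (l2_polar M T) \<and>
     l2_op_eq M T (\<lambda>f. l2_polar M T (l2_abs M T f)) \<and> l2_ker M (l2_polar M T) = l2_ker M (l2_abs M T)"
    unfolding l2_polar_def
  proof (rule someI[of _ U0], intro conjI)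
    show "l2_partial_isometry M U0" by (rule U0_partial_isometry)
    show "l2_op_eq M T (\<lambda>f. U0 (l2_abs M T f))"
      unfolding l2_op_eq_def
    proof
      fix f assume f: "f \<in> l2_space M"
      have "AE x in M. T f x = T0 f x" using T f by (simp add: l2_op_eq_def)
      moreover have "AE x in M. U0 (l2_abs M T f) x = U0 (Q b f) x"
        using A(2) f by (intro l2_bounded_op_cong[OF U0_bounded] Ain Qin) (auto simp: l2_op_eq_def)
      moreover note U0_Qb[of f]
      ultimately show "AE x in M. T f x = U0 (l2_abs M T f) x" by eventually_elim simp
    qed
    have "(AE x in M. l2_abs M T f x = 0) \<longleftrightarrow> (AE x in M. Q b f x = 0)" if "f \<in> l2_space M" for f
    proof -
      have "AE x in M. l2_abs M T f x = Q b f x" using A(2) that by (simp add: l2_op_eq_def)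
      then show ?thesis by (intro eventually_subst) (auto elim!: eventually_mono)
    qed
    then show "l2_ker M U0 = l2_ker M (l2_abs M T)"
      unfolding l2_ker_def using U0_kernel by blast
  qed
  then show "l2_bounded_op M (l2_polar M T)" "l2_op_eq M T (\<lambda>f. l2_polar M T (l2_abs M T f))"
    by (auto simp: l2_partial_isometry_def)
qed

section \<open>The Aluthge transformation\<close>

text \<open>
  The product of the partial isometry and the square root of the modulus; formally
  \<open>(\<omega>/b) \<surd>b = \<omega>/\<surd>b\<close>.
\<close>

definition V0 :: "('a \<Rightarrow> complex) \<Rightarrow> 'a \<Rightarrow> complex" where
  "V0 = wct_op M F (\<lambda>x. of_real (inverse (sqrt (b x))) * \<omega> x) \<nu>"

lemma V0_weight: "(\<lambda>x. of_real (inverse (sqrt (b x))) * \<omega> x) \<in> cond_bdd (sqrt C)"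
proof (rule weighted_cond_bdd)
  have "AE x in M. b x \<le> sqrt C" using b_bdd by (simp add: ess_bdd_nonneg_def)
  then show "AE x in M. ennreal ((cmod (complex_of_real (inverse (sqrt (b x)))))\<^sup>2) * cond_moment \<omega> x \<le> ennreal (sqrt C)"
    using b_square
  proof eventually_elim
    case (elim x)
    have "(inverse (sqrt (b x)))\<^sup>2 = inverse (b x)" by (simp add: power_inverse)
    then have "(inverse (sqrt (b x)))\<^sup>2 * (b x)\<^sup>2 = b x"
      by (cases "b x = 0") (simp_all add: power2_eq_square[of "b x"])
    then show ?case
      unfolding elim(2)[symmetric] norm_of_real using elim(1)
      by (simp add: ennreal_mult[symmetric] ennreal_leI del: power_inverse)
  qed
  show "(\<lambda>x. complex_of_real (inverse (sqrt (b x)))) \<in> borel_measurable F" by measurable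
qed simp

lemma V0_bounded: "l2_bounded_op M V0"
  unfolding V0_def using C_pos by (intro wct_op_bounded[OF V0_weight nu_bdd]) auto

text \<open>
  The polar part \<open>U\<close> is known on the range of \<open>Q b\<close> only, which need not contain the range of the
  square root \<open>Q (\<surd>b)\<close>. Cutting \<open>\<surd>b\<close> off where \<open>b \<le> \<epsilon>\<^sup>2\<close> makes it a multiple of \<open>b\<close>, with the bounded
  factor \<open>a = 1/\<surd>b\<close>; the part that is cut off has norm at most \<open>\<epsilon>\<close>, both for \<open>Q (\<surd>b)\<close> and for \<open>V0\<close>.
\<close>

lemma cut_bound:
  assumes f: "f \<in> l2_space M" and \<epsilon>: "\<epsilon> > 0"
    and U: "l2_bounded_op M U" and UT: "\<And>f. f \<in> l2_space M \<Longrightarrow> AE x in M. U (Q b f) x = T0 f x"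
    and K: "\<And>f. f \<in> l2_space M \<Longrightarrow> l2_norm M (U f) \<le> K * l2_norm M f"
    and K0: "K \<ge> 0"
  shows "l2_norm M (\<lambda>x. U (Q (\<lambda>x. sqrt (b x)) f) x - V0 f x) \<le> (K + 1) * \<epsilon> * l2_norm M f"
proof -
  let ?s = "\<lambda>x. sqrt (b x)"
  define a where "a x = (if b x > \<epsilon>\<^sup>2 then inverse (sqrt (b x)) else 0)" for x
  have aF[measurable]: "a \<in> borel_measurable F" unfolding a_def by measurable
  have ab: "a \<in> ess_bdd_nonneg (inverse \<epsilon>)"
  proof -
    have "a x \<le> inverse \<epsilon>" for x
    proof (cases "b x > \<epsilon>\<^sup>2")
      case True
      then have "sqrt (b x) \<ge> \<epsilon>" using \<epsilon> by (simp add: real_le_rsqrt)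
      then show ?thesis using \<epsilon> True by (simp add: a_def le_imp_inverse_le)
    qed (use \<epsilon> in \<open>simp add: a_def\<close>)
    then show ?thesis by (simp add: ess_bdd_nonneg_def) (simp add: a_def)
  qed
  have sb: "?s \<in> ess_bdd_nonneg (sqrt (sqrt C))" by (rule ess_bdd_nonneg_sqrt[OF b_bdd])
  note aC = ess_bdd_nonneg_of_real[OF ab] and sC = ess_bdd_nonneg_of_real[OF sb]
    and bC = ess_bdd_nonneg_of_real[OF b_bdd]
  note Qain = l2_bounded_op_in[OF P_bounded[OF aC]] and Qsin = l2_bounded_op_in[OF P_bounded[OF sC]]
    and Qbin = l2_bounded_op_in[OF P_bounded[OF bC]] and Uin = l2_bounded_op_in[OF U]
  \<comment> \<open>what remains of the weight where \<open>b\<close> is small\<close>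
  define d where "d x = ?s x - b x * a x" for x
  have d_eq: "d x = (if b x > \<epsilon>\<^sup>2 then 0 else sqrt (b x))" for x
  proof (cases "b x > \<epsilon>\<^sup>2")
    case True
    then have "b x > 0" using \<epsilon> by (metis less_trans zero_less_power)
    then have "b x * inverse (sqrt (b x)) = sqrt (b x)"
      by (metis divide_inverse real_div_sqrt less_imp_le)
    then show ?thesis using True by (simp add: d_def a_def)
  qed (simp add: d_def a_def)
  have small: "sqrt (b x) \<le> \<epsilon>" if "\<not> b x > \<epsilon>\<^sup>2" for x
    using that \<epsilon> by (simp add: real_le_lsqrt)
  have dF[measurable]: "d \<in> borel_measurable F" unfolding d_def by measurable
  have db: "d \<in> ess_bdd_nonneg \<epsilon>"
    unfolding ess_bdd_nonneg_def using small \<epsilon> by (auto simp: d_eq)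
  note dC = ess_bdd_nonneg_of_real[OF db]
  let ?h = "Q b (Q a f)"
  have h: "?h \<in> l2_space M" by (intro Qbin Qain f)
  have "Q d f x = Q ?s f x - P (\<lambda>x. of_real (b x) * of_real (a x)) f x" for x
    by (simp add: P_def wct_op_def d_def algebra_simps)
  then have d1: "AE x in M. Q ?s f x - ?h x = Q d f x"
    using P_P[OF aC, of "\<lambda>x. of_real (b x)" f] by simp
  have n1: "l2_norm M (\<lambda>x. Q ?s f x - ?h x) \<le> \<epsilon> * l2_norm M f"
  proof -
    have "l2_norm M (\<lambda>x. Q ?s f x - ?h x) = l2_norm M (Q d f)"
      using l2_space_diff[OF Qsin[OF f] h] l2_bounded_op_in[OF P_bounded[OF dC] f]
      by (intro l2_norm_cong_AE d1) (auto simp: l2_space_def)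
    also have "\<dots> \<le> \<epsilon> * l2_norm M f" using P_norm[OF dC _ f] \<epsilon> by simp
    finally show ?thesis .
  qed
  have Uh: "AE x in M. U ?h x = wct_op M F (\<lambda>x. \<omega> x * of_real (a x)) \<nu> f x"
    using UT[OF Qain[OF f]] wct_P[OF aC omega_off, of f] by eventually_elim simp
  \<comment> \<open>the part of the left weight of \<open>V0\<close> that the cut-off removes\<close>
  define i where "i x = (if b x > \<epsilon>\<^sup>2 then 0 else inverse (sqrt (b x)))" for x
  have iF: "(\<lambda>x. complex_of_real (i x)) \<in> borel_measurable F" unfolding i_def by measurable
  have ib: "(\<lambda>x. of_real (i x) * \<omega> x) \<in> cond_bdd (\<epsilon>\<^sup>2)"
  proof (rule weighted_cond_bdd[OF iF omega_measurable])
    show "AE x in M. ennreal ((cmod (complex_of_real (i x)))\<^sup>2) * cond_moment \<omega> x \<le> ennreal (\<epsilon>\<^sup>2)"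
      using b_square
    proof eventually_elim
      case (elim x)
      have "(i x)\<^sup>2 * (b x)\<^sup>2 \<le> \<epsilon>\<^sup>2"
      proof -
        have "(inverse (sqrt (b x)))\<^sup>2 = inverse (b x)" by (simp add: power_inverse)
        then show ?thesis
          by (cases "b x = 0") (auto simp: i_def power2_eq_square[of "b x"] simp flip: mult.assoc)
      qed
      then show ?case unfolding elim(1)[symmetric] by (simp add: ennreal_mult[symmetric] ennreal_leI)
    qed
  qed
  have d2: "AE x in M. V0 f x - U ?h x = wct_op M F (\<lambda>x. of_real (i x) * \<omega> x) \<nu> f x"
    using Uh by eventually_elim (simp add: V0_def wct_op_def i_def a_def algebra_simps)
  have V0f: "V0 f \<in> l2_space M" by (rule l2_bounded_op_in[OF V0_bounded f])
  have n2: "l2_norm M (\<lambda>x. V0 f x - U ?h x) \<le> \<epsilon> * l2_norm M f"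
  proof -
    have w: "wct_op M F (\<lambda>x. of_real (i x) * \<omega> x) \<nu> f \<in> l2_space M"
      "l2_norm M (wct_op M F (\<lambda>x. of_real (i x) * \<omega> x) \<nu> f) \<le> sqrt (\<epsilon>\<^sup>2 * 1) * l2_norm M f"
      by (rule wct_op_l2[OF ib nu_bdd _ _ f]; simp)+
    have "l2_norm M (\<lambda>x. V0 f x - U ?h x) = l2_norm M (wct_op M F (\<lambda>x. of_real (i x) * \<omega> x) \<nu> f)"
      using l2_space_diff[OF V0f Uin[OF h]] w(1)
      by (intro l2_norm_cong_AE d2) (auto simp: l2_space_def)
    then show ?thesis using w(2) \<epsilon> by simp
  qed
  let ?d = "\<lambda>x. Q ?s f x - ?h x"
  have dl: "?d \<in> l2_space M" by (rule l2_space_diff[OF Qsin[OF f] h])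
  have "l2_norm M (\<lambda>x. U (Q ?s f) x - V0 f x) = l2_norm M (\<lambda>x. U ?d x - (V0 f x - U ?h x))"
  proof (rule l2_norm_cong_AE)
    show "AE x in M. U (Q ?s f) x - V0 f x = U ?d x - (V0 f x - U ?h x)"
      using l2_bounded_op_diff[OF U Qsin[OF f] h] by eventually_elim simp
  qed (use l2_space_diff[OF Uin[OF Qsin[OF f]] V0f] l2_space_diff[OF Uin[OF dl] l2_space_diff[OF V0f Uin[OF h]]]
      in \<open>auto simp: l2_space_def\<close>)
  also have "\<dots> \<le> l2_norm M (U ?d) + l2_norm M (\<lambda>x. V0 f x - U ?h x)"
    by (rule l2_norm_diff_triangle[OF Uin[OF dl] l2_space_diff[OF V0f Uin[OF h]]])
  also have "\<dots> \<le> K * (\<epsilon> * l2_norm M f) + \<epsilon> * l2_norm M f"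
    using K[OF dl] n2 mult_left_mono[OF n1 K0] by linarith
  finally show ?thesis by (simp add: algebra_simps)
qed

lemma polar_sqrt:
  assumes f: "f \<in> l2_space M"
    and U: "l2_bounded_op M U" and UT: "\<And>f. f \<in> l2_space M \<Longrightarrow> AE x in M. U (Q b f) x = T0 f x"
  shows "AE x in M. U (Q (\<lambda>x. sqrt (b x)) f) x = V0 f x"
proof -
  obtain K where K: "K > 0" "\<And>f. f \<in> l2_space M \<Longrightarrow> l2_norm M (U f) \<le> K * l2_norm M f"
    using l2_bounded_op_bound[OF U] by metis
  let ?g = "\<lambda>x. U (Q (\<lambda>x. sqrt (b x)) f) x - V0 f x"
  note sC = ess_bdd_nonneg_of_real[OF ess_bdd_nonneg_sqrt[OF b_bdd]]
  have g: "?g \<in> l2_space M"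
    by (rule l2_space_diff[OF l2_bounded_op_in[OF U l2_bounded_op_in[OF P_bounded[OF sC] f]] l2_bounded_op_in[OF V0_bounded f]])
  define L where "L = (K + 1) * l2_norm M f"
  have le: "l2_norm M ?g \<le> L * \<epsilon>" if "\<epsilon> > 0" for \<epsilon>
    using cut_bound[OF f that U UT K(2) less_imp_le[OF K(1)]] by (simp add: L_def mult_ac)
  have "L \<ge> 0" using K(1) by (simp add: L_def)
  have "l2_norm M ?g \<le> 0 + e" if "e > 0" for e
  proof -
    have "l2_norm M ?g \<le> L * (e / (L + 1))" using le[of "e / (L + 1)"] that \<open>L \<ge> 0\<close> by simp
    also have "\<dots> \<le> e" using that \<open>L \<ge> 0\<close> by (simp add: field_simps)
    finally show ?thesis by simp
  qed
  then have "l2_norm M ?g \<le> 0" by (rule field_le_epsilon)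
  then have "l2_norm M ?g = 0" using l2_norm_nonneg[of M ?g] by linarith
  then show ?thesis using l2_norm_eq_0_iff[OF g] by simp
qed

text \<open>
  With the square root \<open>R = Q (\<surd>b)\<close> of the modulus, \<open>RUR = RV0\<close> has the left weight
  \<open>\<surd>b \<nu>\<^sup>* E(\<nu>\<omega>/\<surd>b) = c \<nu>\<^sup>*\<close>. So the Aluthge transform has the form \<open>P c\<close>, and is normal.
\<close>

lemma T0_aluthge:
  assumes T: "l2_op_eq M T T0" and Tmap: "\<forall>f\<in>l2_space M. T f \<in> l2_space M"
  shows "l2_op_eq M (aluthge M T) (P c)" "\<forall>f\<in>l2_space M. aluthge M T f \<in> l2_space M"
proof -
  let ?s = "\<lambda>x. sqrt (b x)"
  define R where "R = l2_sqrt M (l2_abs M T)"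
  define U where "U = l2_polar M T"
  note A = T0_abs[OF T Tmap] and pol = T0_polar[OF T Tmap, folded U_def]
  have "sqrt C > 0" using C_pos by simp
  note R = Q_sqrt[OF b_bdd this A(2), folded R_def]
  note Rbd = l2_positiveD(1)[OF R(1)]
  note sC = ess_bdd_nonneg_of_real[OF ess_bdd_nonneg_sqrt[OF b_bdd]]
  note Rin = l2_bounded_op_in[OF Rbd] and Uin = l2_bounded_op_in[OF pol(1)]
    and Qsin = l2_bounded_op_in[OF P_bounded[OF sC]] and Vin = l2_bounded_op_in[OF V0_bounded]
    and Ain = l2_bounded_op_in[OF l2_positiveD(1)[OF A(1)]]
    and Qbin = l2_bounded_op_in[OF P_bounded[OF ess_bdd_nonneg_of_real[OF b_bdd]]]
  have al: "aluthge M T = (\<lambda>f. R (U (R f)))" by (simp add: aluthge_def R_def U_def Let_def)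
  show "\<forall>f\<in>l2_space M. aluthge M T f \<in> l2_space M" unfolding al by (intro ballI Rin Uin)
  have UT: "AE x in M. U (Q b g) x = T0 g x" if g: "g \<in> l2_space M" for g
  proof -
    have "AE x in M. T g x = T0 g x" "AE x in M. T g x = U (l2_abs M T g) x"
      using T pol(2) g by (auto simp: l2_op_eq_def)
    moreover have "AE x in M. U (l2_abs M T g) x = U (Q b g) x"
      using A(2) g by (intro l2_bounded_op_cong[OF pol(1)] Ain Qbin) (auto simp: l2_op_eq_def)
    ultimately show ?thesis by eventually_elim simp
  qed
  show "l2_op_eq M (aluthge M T) (P c)"
    unfolding l2_op_eq_def al
  proof
    fix f assume f: "f \<in> l2_space M"
    have "AE x in M. R f x = Q ?s f x" using R(2) f by (simp add: l2_op_eq_def)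
    then have "AE x in M. U (R f) x = U (Q ?s f) x"
      using f by (intro l2_bounded_op_cong[OF pol(1)] Rin Qsin)
    moreover have "AE x in M. U (Q ?s f) x = V0 f x"
      by (rule polar_sqrt[OF f pol(1)]) (rule UT)
    ultimately have "AE x in M. U (R f) x = V0 f x" by eventually_elim simp
    then have "AE x in M. R (U (R f)) x = R (V0 f) x"
      using f by (intro l2_bounded_op_cong[OF Rbd] Rin Uin Vin)
    moreover have "AE x in M. R (V0 f) x = Q ?s (V0 f) x" using R(2) Vin[OF f] by (simp add: l2_op_eq_def)
    moreover have "AE x in M. Q ?s (V0 f) x = P c f x"
    proof -
      let ?i = "\<lambda>x. complex_of_real (inverse (sqrt (b x)))"
      have iF: "?i \<in> borel_measurable F" by measurable
      have "AE x in M. E (\<lambda>x. ?i x * (\<nu> x * \<omega> x)) x = ?i x * c x"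
        unfolding c_def by (rule complex_cond_exp_mult[OF iF cond_l2_mult_dom[OF nu_l2 omega_l2]])
      then have "AE x in M. of_real (?s x) * cnj (\<nu> x) * E (\<lambda>x. \<nu> x * (?i x * \<omega> x)) x = c x * cnj (\<nu> x)"
        unfolding mult.left_commute[of "\<nu> _" "?i _"] using c_le_b
      proof eventually_elim
        case (elim x)
        show ?case
        proof (cases "b x = 0")
          case True
          then have "c x = 0" using elim(2) by simp
          then show ?thesis using elim(1) by simp
        next
          case False
          then have "complex_of_real (sqrt (b x)) \<noteq> 0" by simp
          then show ?thesis unfolding elim(1) by (simp add: field_simps)
        qed
      qed
      from wct_op_cong_left[OF this]
        wct_op_compose[OF nu_l2 cond_bdd_cond_l2[OF V0_weight], of "\<lambda>x. of_real (?s x) * cnj (\<nu> x)" \<nu> f]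
      show ?thesis unfolding P_def V0_def by eventually_elim simp
    qed
    ultimately show "AE x in M. R (U (R f)) x = P c f x" by eventually_elim simp
  qed
qed

section \<open>Rigidity\<close>

lemma Q_add: "Q (\<lambda>x. r x + s x) f x = Q r f x + Q s f x"
  by (simp add: P_def wct_op_def algebra_simps)

lemma P_cnj_T0: "AE x in M. P (\<lambda>x. cnj (c x)) (T0 f) x = Q (\<lambda>x. (cmod (c x))\<^sup>2) f x"
proof -
  have cc: "cnj (c x) * c x = of_real ((cmod (c x))\<^sup>2)" for x
    by (metis complex_norm_square mult.commute of_real_power)
  have "AE x in M. P (\<lambda>x. cnj (c x)) (T0 f) x = wct_op M F (\<lambda>x. cnj (c x) * cnj (\<nu> x) * c x) \<nu> f x"
    unfolding P_def c_def by (rule wct_op_compose[OF nu_l2 omega_l2])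
  moreover have "(\<lambda>x. cnj (c x) * cnj (\<nu> x) * c x) = (\<lambda>x. of_real ((cmod (c x))\<^sup>2) * cnj (\<nu> x))"
    unfolding cc[symmetric] by (simp add: mult_ac)
  ultimately show ?thesis unfolding P_def by simp
qed

lemma P_cnj_P: "AE x in M. P (\<lambda>x. cnj (c x)) (P c f) x = Q (\<lambda>x. (cmod (c x))\<^sup>2) f x"
proof -
  have "cnj (c x) * c x = of_real ((cmod (c x))\<^sup>2)" for x
    by (metis complex_norm_square mult.commute of_real_power)
  then show ?thesis using P_P[OF c_bdd(1), of "\<lambda>x. cnj (c x)" f] by (simp only:)
qed

text \<open>
  Pythagoras: \<open>c \<nu>\<^sup>*\<close> is the conditional orthogonal projection of \<open>\<omega>\<close> onto \<open>\<nu>\<^sup>*\<close>, so the squared norm of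
  the difference is the difference of the squared norms, namely \<open>\<integral>(b\<^sup>2 - \<bar>c\<bar>\<^sup>2)\<bar>E(\<nu>f)\<bar>\<^sup>2\<close>.
\<close>

lemma norm_T0_minus_Pc:
  assumes f: "f \<in> l2_space M"
  shows "(l2_norm M (\<lambda>x. T0 f x - P c f x))\<^sup>2
    = Re (l2_inner M f (Q (\<lambda>x. (b x)\<^sup>2) f)) - Re (l2_inner M f (Q (\<lambda>x. (cmod (c x))\<^sup>2) f))"
proof -
  let ?m = "\<lambda>x. (cmod (c x))\<^sup>2" and ?b = "\<lambda>x. (b x)\<^sup>2"
  have cc: "(\<lambda>x. cnj (c x)) \<in> ess_bdd (sqrt C)" using c_bdd(1) by (simp add: ess_bdd_def borel_measurable_cnj)
  note T0in = l2_bounded_op_in[OF T0_bounded] and Pin = l2_bounded_op_in[OF P_bounded[OF c_bdd(1)]]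
    and Pcin = l2_bounded_op_in[OF P_bounded[OF cc]] and Tain = l2_bounded_op_in[OF T0_adj_bounded]
  have Qm: "Q ?m f \<in> l2_space M"
    by (rule l2_space_cong_AE[OF Pcin[OF Pin[OF f]] P_cnj_P])
      (rule P_measurable, measurable)
  have Qb: "Q ?b f \<in> l2_space M"
    by (rule l2_space_cong_AE[OF Tain[OF T0in[OF f]] T0_adj_T0])
      (rule P_measurable, measurable)
  have TT: "l2_inner M (T0 f) (T0 f) = l2_inner M f (Q ?b f)"
    unfolding T0_adjoint[OF f T0in[OF f]] by (intro l2_inner_cong_AE T0_adj_T0 f Tain T0in Qb) simp
  have PT: "l2_inner M (P c f) (T0 f) = l2_inner M f (Q ?m f)"
    using C_pos P_adjoint[OF c_bdd(1) _ f T0in[OF f]] l2_inner_cong_AE[OF _ P_cnj_T0 f f Pcin[OF T0in[OF f]] Qm]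
    by simp
  have PP: "l2_inner M (P c f) (P c f) = l2_inner M f (Q ?m f)"
    using C_pos P_adjoint[OF c_bdd(1) _ f Pin[OF f]] l2_inner_cong_AE[OF _ P_cnj_P f f Pcin[OF Pin[OF f]] Qm]
    by simp
  have "complex_of_real ((l2_norm M (\<lambda>x. T0 f x - P c f x))\<^sup>2)
      = l2_inner M f (Q ?b f) - cnj (l2_inner M f (Q ?m f)) - l2_inner M f (Q ?m f) + l2_inner M f (Q ?m f)"
    unfolding l2_inner_self[symmetric] TT[symmetric] PT[symmetric] l2_inner_commute[of M "T0 f" "P c f", symmetric]
    using f PP PT by (simp add: l2_inner_linear l2_space_intros T0in Pin)
  from arg_cong[OF this, of Re] show ?thesis by simp
qed

text \<open>
  The two moduli are \<open>Q b\<close> and \<open>Q \<bar>c\<bar>\<close>. Comparing them on vectors of the form \<open>Q r f\<close> with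
  \<open>r\<^sup>2 = b + \<bar>c\<bar>\<close> turns \<open>b \<le> \<bar>c\<bar>\<close> into \<open>\<integral>(b\<^sup>2 - \<bar>c\<bar>\<^sup>2)\<bar>E(\<nu>f)\<bar>\<^sup>2 \<le> 0\<close>, and the integral is the squared
  distance of the operator from its Aluthge transform at \<open>f\<close>.
\<close>

theorem eq_aluthge:
  assumes T: "l2_op_eq M T T0" and Tmap: "\<forall>f\<in>l2_space M. T f \<in> l2_space M"
    and le: "l2_op_le M (l2_abs M T) (l2_abs M (aluthge M T))"
  shows "l2_op_eq M T (aluthge M T)"
proof -
  let ?m = "\<lambda>x. cmod (c x)"
  define r where "r x = sqrt (b x + ?m x)" for x
  note A = T0_abs[OF T Tmap] and al = T0_aluthge[OF T Tmap]
  note B = Pc_abs[OF al]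
  note bC = ess_bdd_nonneg_of_real[OF b_bdd] and mC = ess_bdd_nonneg_of_real[OF c_bdd(2)]
  note Qbin = l2_bounded_op_in[OF P_bounded[OF bC]] and Qmin = l2_bounded_op_in[OF P_bounded[OF mC]]
    and Ain = l2_bounded_op_in[OF l2_positiveD(1)[OF A(1)]] and Bin = l2_bounded_op_in[OF l2_positiveD(1)[OF B(1)]]
  have sum: "(\<lambda>x. b x + ?m x) \<in> ess_bdd_nonneg (2 * sqrt C)"
  proof -
    have "AE x in M. b x \<le> sqrt C" "AE x in M. ?m x \<le> sqrt C"
      using b_bdd c_bdd(2) by (auto simp: ess_bdd_nonneg_def)
    then have "AE x in M. b x + ?m x \<le> 2 * sqrt C" by eventually_elim simp
    then show ?thesis by (simp add: ess_bdd_nonneg_def)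
  qed
  have rb: "r \<in> ess_bdd_nonneg (sqrt (2 * sqrt C))" unfolding r_def by (rule ess_bdd_nonneg_sqrt[OF sum])
  note rC = ess_bdd_nonneg_of_real[OF rb]
  note Qrin = l2_bounded_op_in[OF P_bounded[OF rC]]
  have rpos: "sqrt (2 * sqrt C) > 0" using C_pos by simp
  have comp: "Re (l2_inner M (Q b g) g) \<le> Re (l2_inner M (Q ?m g) g)" if g: "g \<in> l2_space M" for g
  proof -
    have "0 \<le> Re (l2_inner M (\<lambda>x. l2_abs M (aluthge M T) g x - l2_abs M T g x) g)"
      using le g by (simp add: l2_op_le_def l2_positive_def)
    also have "l2_inner M (\<lambda>x. l2_abs M (aluthge M T) g x - l2_abs M T g x) g
        = l2_inner M (l2_abs M (aluthge M T) g) g - l2_inner M (l2_abs M T g) g"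
      by (rule l2_inner_diff_left[OF Bin[OF g] Ain[OF g] g])
    also have "l2_inner M (l2_abs M (aluthge M T) g) g = l2_inner M (Q ?m g) g"
      using B(2) g by (intro l2_inner_cong_AE Bin Qmin) (auto simp: l2_op_eq_def)
    also have "l2_inner M (l2_abs M T g) g = l2_inner M (Q b g) g"
      using A(2) g by (intro l2_inner_cong_AE Ain Qbin) (auto simp: l2_op_eq_def)
    finally show ?thesis by simp
  qed
  \<comment> \<open>\<open>r q r = q b + q \<bar>c\<bar>\<close>; needed for \<open>q = b\<close> and for \<open>q = \<bar>c\<bar>\<close>, where the mixed terms agree\<close>
  have sandwich: "Re (l2_inner M (Q q (Q r f)) (Q r f)) = Re (l2_inner M f (Q (\<lambda>x. q x * b x) f)) + Re (l2_inner M f (Q (\<lambda>x. q x * ?m x) f))"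
    if q: "q \<in> ess_bdd_nonneg (sqrt C)" and f: "f \<in> l2_space M" for q f
  proof -
    note qC = ess_bdd_nonneg_of_real[OF q]
    note Qqin = l2_bounded_op_in[OF P_bounded[OF qC]]
    have in2: "Q (\<lambda>x. q x * p x) f \<in> l2_space M" if p: "p \<in> ess_bdd_nonneg (sqrt C)" for p
    proof (rule l2_space_cong_AE[OF Qqin[OF l2_bounded_op_in[OF P_bounded[OF ess_bdd_nonneg_of_real[OF p]] f]]])
      show "AE x in M. Q q (Q p f) x = Q (\<lambda>x. q x * p x) f x"
        using P_P[OF ess_bdd_nonneg_of_real[OF p], of "\<lambda>x. of_real (q x)" f] by simp
      show "Q (\<lambda>x. q x * p x) f \<in> borel_measurable M"
        using p q unfolding ess_bdd_nonneg_def by (intro P_measurable) auto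
    qed
    have rr: "r x * (q x * r x) = q x * b x + q x * ?m x" for x
      unfolding r_def by (simp add: algebra_simps flip: real_sqrt_mult)
    have e1: "AE x in M. Q q (Q r f) x = Q (\<lambda>x. q x * r x) f x"
      using P_P[OF rC, of "\<lambda>x. of_real (q x)" f] by simp
    have qr: "(\<lambda>x. complex_of_real (q x * r x)) \<in> ess_bdd (sqrt C * sqrt (2 * sqrt C))"
    proof -
      have nn: "\<And>x. 0 \<le> q x" "\<And>x. 0 \<le> r x" using q rb by (auto simp: ess_bdd_nonneg_def)
      have "AE x in M. q x \<le> sqrt C" "AE x in M. r x \<le> sqrt (2 * sqrt C)"
        using q rb by (auto simp: ess_bdd_nonneg_def)
      then have "AE x in M. cmod (complex_of_real (q x * r x)) \<le> sqrt C * sqrt (2 * sqrt C)"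
      proof eventually_elim
        case (elim x)
        then have "q x * r x \<le> sqrt C * sqrt (2 * sqrt C)" using nn C_pos by (intro mult_mono) auto
        then show ?case using nn by (simp only: norm_of_real) simp
      qed
      then show ?thesis using q rb by (auto simp: ess_bdd_def ess_bdd_nonneg_def)
    qed
    have "AE x in M. Q r (Q q (Q r f)) x = Q r (Q (\<lambda>x. q x * r x) f) x"
      by (intro l2_bounded_op_cong[OF P_bounded[OF rC]] e1 Qqin Qrin f l2_bounded_op_in[OF P_bounded[OF qr]])
    moreover have "AE x in M. Q r (Q (\<lambda>x. q x * r x) f) x = Q (\<lambda>x. q x * b x + q x * ?m x) f x"
      using P_P[OF qr, of "\<lambda>x. of_real (r x)" f] unfolding of_real_mult[symmetric] rr .
    ultimately have e2: "AE x in M. Q r (Q q (Q r f)) x = Q (\<lambda>x. q x * b x) f x + Q (\<lambda>x. q x * ?m x) f x"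
      unfolding Q_add by eventually_elim simp
    have "l2_inner M (Q q (Q r f)) (Q r f) = cnj (l2_inner M (Q r f) (Q q (Q r f)))"
      by (rule l2_inner_commute)
    also have "l2_inner M (Q r f) (Q q (Q r f)) = l2_inner M f (Q r (Q q (Q r f)))"
      using P_adjoint[OF rC rpos f Qqin[OF Qrin[OF f]]] by simp
    also have "\<dots> = l2_inner M f (\<lambda>x. Q (\<lambda>x. q x * b x) f x + Q (\<lambda>x. q x * ?m x) f x)"
      by (intro l2_inner_cong_AE e2 f Qrin Qqin l2_space_add in2 b_bdd c_bdd(2)) simp
    also have "\<dots> = l2_inner M f (Q (\<lambda>x. q x * b x) f) + l2_inner M f (Q (\<lambda>x. q x * ?m x) f)"
      by (intro l2_inner_add_right in2 b_bdd c_bdd(2) f)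
    finally show ?thesis by simp
  qed
  show ?thesis
    unfolding l2_op_eq_def
  proof
    fix f assume f: "f \<in> l2_space M"
    have "Re (l2_inner M f (Q (\<lambda>x. (b x)\<^sup>2) f)) \<le> Re (l2_inner M f (Q (\<lambda>x. (?m x)\<^sup>2) f))"
      using comp[OF Qrin[OF f]] sandwich[OF b_bdd f] sandwich[OF c_bdd(2) f]
      by (simp add: power2_eq_square mult.commute[of "?m _" "b _"])
    then have "(l2_norm M (\<lambda>x. T0 f x - P c f x))\<^sup>2 \<le> 0"
      using norm_T0_minus_Pc[OF f] by simp
    then have "AE x in M. T0 f x - P c f x = 0"
      using l2_norm_eq_0_iff[OF l2_space_diff[OF l2_bounded_op_in[OF T0_bounded f] l2_bounded_op_in[OF P_bounded[OF c_bdd(1)] f]]]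
      by simp
    moreover have "AE x in M. T f x = T0 f x" "AE x in M. aluthge M T f x = P c f x"
      using T al(1) f by (auto simp: l2_op_eq_def)
    ultimately show "AE x in M. T f x = aluthge M T f x" by eventually_elim simp
  qed
qed

end

section \<open>Reduction of a bounded operator to normalized form\<close>

context sigma_finite_subalgebra
begin

text \<open>
  The upper bound on \<open>h\<close> makes its integrals finite, so that they can be subtracted on the sets of
  finite measure that exhaust \<open>{x. h x < g x}\<close>.
\<close>

lemma AE_le_if_set_nn_integrals_le:
  assumes g[measurable]: "g \<in> borel_measurable F" and h[measurable]: "h \<in> borel_measurable F"
    and bd: "AE x in M. h x \<le> ennreal B"
    and le: "\<And>A. A \<in> sets F \<Longrightarrow> emeasure M A < \<infinity> \<Longrightarrow>
      (\<integral>\<^sup>+x. indicator A x * g x \<partial>M) \<le> (\<integral>\<^sup>+x. indicator A x * h x \<partial>M)"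
  shows "AE x in M. g x \<le> h x"
proof -
  have [measurable]: "g \<in> borel_measurable M" "h \<in> borel_measurable M"
    using g h by (auto intro: measurable_from_subalg[OF subalg])
  have sp: "space F = space M" using subalg by (simp add: subalgebra_def)
  obtain A :: "nat \<Rightarrow> 'a set" where A: "range A \<subseteq> sets (restr_to_subalg M F)"
    "(\<Union>i. A i) = space (restr_to_subalg M F)" "\<And>i. emeasure (restr_to_subalg M F) (A i) \<noteq> \<infinity>"
    using sigma_finite_measure.sigma_finite[OF sigma_fin_subalg] by metis
  have AF: "A i \<in> sets F" for i using A(1) sets_restr_to_subalg[OF subalg] by auto
  have Afin: "emeasure M (A i) < \<infinity>" for i
    using A(3)[of i] emeasure_restr_to_subalg[OF subalg AF[of i]] by (simp add: less_top)
  have cover: "(\<Union>i. A i) = space M" using A(2) by (simp add: space_restr_to_subalg)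
  define N where "N = {x \<in> space F. h x < g x}"
  have NF: "N \<in> sets F" unfolding N_def by measurable
  have "AE x in M. x \<notin> N \<inter> A i" for i
  proof -
    let ?B = "N \<inter> A i"
    have BF: "?B \<in> sets F" using NF AF by auto
    have [measurable]: "?B \<in> sets M" using BF subalg by (auto simp: subalgebra_def)
    have "emeasure M ?B \<le> emeasure M (A i)"
      using AF[of i] subalg by (intro emeasure_mono) (auto simp: subalgebra_def)
    then have Bfin: "emeasure M ?B < \<infinity>" using Afin[of i] le_less_trans by blast
    have "(\<integral>\<^sup>+x. indicator ?B x * h x \<partial>M) \<le> (\<integral>\<^sup>+x. ennreal B * indicator ?B x \<partial>M)"
      using bd by (intro nn_integral_mono_AE) (auto elim!: eventually_mono simp: indicator_def)
    also have "\<dots> = ennreal B * emeasure M ?B" by (rule nn_integral_cmult_indicator) simp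
    also have "\<dots> < \<infinity>" using Bfin by (simp add: ennreal_mult_less_top)
    finally have hfin: "(\<integral>\<^sup>+x. indicator ?B x * h x \<partial>M) < \<infinity>" .
    have "(\<integral>\<^sup>+x. indicator ?B x * g x - indicator ?B x * h x \<partial>M)
        = (\<integral>\<^sup>+x. indicator ?B x * g x \<partial>M) - (\<integral>\<^sup>+x. indicator ?B x * h x \<partial>M)"
    proof (rule nn_integral_diff)
      show "AE x in M. indicator ?B x * h x \<le> indicator ?B x * g x"
        by (auto simp: indicator_def N_def)
    qed (use hfin in \<open>simp_all add: less_top\<close>)
    also have "\<dots> = 0" using le[OF BF Bfin] le_less_trans[OF le[OF BF Bfin] hfin] by (simp add: diff_eq_0_iff_ennreal)
    finally have "AE x in M. indicator ?B x * g x - indicator ?B x * h x = 0"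
      by (subst (asm) nn_integral_0_iff_AE) auto
    then show ?thesis using bd
    proof eventually_elim
      case (elim x)
      show ?case
      proof
        assume x: "x \<in> ?B"
        then have "g x - h x = 0" using elim(1) by simp
        moreover have "h x < g x" using x by (simp add: N_def)
        ultimately show False by (auto simp: diff_eq_0_iff_ennreal)
      qed
    qed
  qed
  then have "AE x in M. \<forall>i. x \<notin> N \<inter> A i" unfolding AE_all_countable by blast
  then show ?thesis using AE_space
  proof eventually_elim
    case (elim x)
    then obtain i where "x \<in> A i" using cover by blast
    then have "x \<notin> N" using elim(1) by blast
    then show ?case using elim(2) sp by (simp add: N_def not_less)
  qed
qed

text \<open>
  Test the operator on the conjugate of \<open>u\<close>, cut off where \<open>\<bar>u\<bar> > n\<close> and outside a set \<open>A\<close> of the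
  subalgebra. With \<open>Q\<^sub>n = E(\<bar>u\<bar>\<^sup>2; \<bar>u\<bar> \<le> n)\<close> the norm bound reads
  \<open>\<integral>\<^sub>A Q\<^sub>n\<^sup>2E(\<bar>w\<bar>\<^sup>2) \<le> K\<^sup>2\<integral>\<^sub>A Q\<^sub>n\<close>. As \<open>A\<close> is arbitrary, \<open>Q\<^sub>nE(\<bar>w\<bar>\<^sup>2) \<le> K\<^sup>2\<close>; let \<open>n\<close> tend to infinity. The
  product is taken in \<open>[0, \<infinity>]\<close>, so where \<open>E(\<bar>u\<bar>\<^sup>2) = \<infinity>\<close> the bound says that \<open>w = 0\<close>.
\<close>

lemma wct_op_bounded_moments:
  assumes [measurable]: "u \<in> borel_measurable M" "w \<in> borel_measurable M"
    and T: "l2_bounded_op M (wct_op M F w u)"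
  obtains C where "C > 0" "AE x in M. cond_moment u x * cond_moment w x \<le> ennreal C"
proof -
  obtain K where K: "K > 0" "\<And>f. f \<in> l2_space M \<Longrightarrow> l2_norm M (wct_op M F w u f) \<le> K * l2_norm M f"
    using l2_bounded_op_bound[OF T] by metis
  let ?V = "cond_moment u" and ?W = "cond_moment w"
  define q where "q n x = (if cmod (u x) \<le> real n then (cmod (u x))\<^sup>2 else 0)" for n x
  define Q where "Q n = nn_cond_exp M F (\<lambda>x. ennreal (q n x))" for n
  have qm[measurable]: "q n \<in> borel_measurable M" for n unfolding q_def by measurable
  have QF[measurable]: "Q n \<in> borel_measurable F" for n unfolding Q_def by measurable
  have QM[measurable]: "Q n \<in> borel_measurable M" for n unfolding Q_def by measurable
  have q0: "0 \<le> q n x" for n x by (simp add: q_def)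
  have qn: "q n x \<le> (real n)\<^sup>2" for n x by (simp add: q_def power_mono)
  have Qbd: "AE x in M. Q n x \<le> ennreal ((real n)\<^sup>2)" for n
  proof -
    have "AE x in M. Q n x \<le> nn_cond_exp M F (\<lambda>x. ennreal ((real n)\<^sup>2)) x"
      unfolding Q_def by (intro nn_cond_exp_mono) (auto intro!: ennreal_leI qn)
    then show ?thesis
      using nn_cond_exp_F_meas[OF borel_measurable_const, of "ennreal ((real n)\<^sup>2)"] by eventually_elim simp
  qed
  have test: "(\<integral>\<^sup>+x. indicator A x * ((Q n x)\<^sup>2 * ?W x) \<partial>M) \<le> (\<integral>\<^sup>+x. indicator A x * (ennreal (K\<^sup>2) * Q n x) \<partial>M)"
    if A[measurable]: "A \<in> sets F" and Afin: "emeasure M A < \<infinity>" for A n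
  proof -
    have AM[measurable]: "A \<in> sets M" using A subalg by (auto simp: subalgebra_def)
    define f where "f x = (if cmod (u x) \<le> real n then indicator A x * cnj (u x) else 0)" for x
    have fm[measurable]: "f \<in> borel_measurable M" unfolding f_def by measurable
    have f2: "(cmod (f x))\<^sup>2 = indicator A x * q n x" for x
      by (simp add: f_def q_def indicator_def)
    have f2': "ennreal ((cmod (f x))\<^sup>2) = indicator A x * ennreal (q n x)" for x
      unfolding f2 by (simp add: indicator_def)
    have uf: "u x * f x = of_real (indicator A x * q n x)" for x
    proof -
      have "u x * cnj (u x) = of_real ((cmod (u x))\<^sup>2)" by (metis complex_norm_square of_real_power)
      then show ?thesis by (simp add: f_def q_def indicator_def del: of_real_power)
    qed
    have fl: "f \<in> l2_space M"
    proof -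
      have "integrable M (\<lambda>x. (cmod (f x))\<^sup>2)"
      proof (rule Bochner_Integration.integrable_bound)
        show "integrable M (\<lambda>x. (real n)\<^sup>2 * indicator A x)" using Afin by simp
        show "AE x in M. norm ((cmod (f x))\<^sup>2) \<le> norm ((real n)\<^sup>2 * indicat_real A x)"
          using qn q0 by (auto simp: f2 indicator_def)
      qed simp
      then show ?thesis by (simp add: l2_space_def)
    qed
    have "AE x in M. complex_cond_exp M F (\<lambda>y. u y * f y) x
        = of_real (enn2real (nn_cond_exp M F (\<lambda>x. ennreal (indicator A x * q n x)) x))"
      unfolding uf by (rule complex_cond_exp_nonneg) (auto simp: q0)
    moreover have "AE x in M. indicator A x * Q n x = nn_cond_exp M F (\<lambda>x. ennreal (indicator A x * q n x)) x"
    proof -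
      have "ennreal (indicator A x * q n x) = indicator A x * ennreal (q n x)" for x
        by (simp add: indicator_def)
      then show ?thesis unfolding Q_def by (simp only:) (rule nn_cond_exp_prod; measurable)
    qed
    ultimately have Tf: "AE x in M. ennreal ((cmod (wct_op M F w u f x))\<^sup>2) = indicator A x * (Q n x)\<^sup>2 * ennreal ((cmod (w x))\<^sup>2)"
      using Qbd[of n]
    proof eventually_elim
      case (elim x)
      have "Q n x < \<infinity>" using elim(3) by (simp add: le_less_trans)
      then have "ennreal (enn2real (Q n x)) = Q n x" by simp
      then have "ennreal ((enn2real (Q n x))\<^sup>2) = (Q n x)\<^sup>2"
        by (simp add: ennreal_power[symmetric])
      then show ?case
        unfolding wct_op_def elim(1) elim(2)[symmetric]
        by (simp add: norm_mult power_mult_distrib ennreal_mult indicator_def mult.commute)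
    qed
    have "(\<integral>\<^sup>+x. indicator A x * ((Q n x)\<^sup>2 * ?W x) \<partial>M) = (\<integral>\<^sup>+x. (indicator A x * (Q n x)\<^sup>2) * ?W x \<partial>M)"
      by (simp add: mult.assoc)
    also have "\<dots> = (\<integral>\<^sup>+x. (indicator A x * (Q n x)\<^sup>2) * ennreal ((cmod (w x))\<^sup>2) \<partial>M)"
      by (rule nn_cond_exp_intg) auto
    also have "\<dots> = (\<integral>\<^sup>+x. ennreal ((cmod (wct_op M F w u f x))\<^sup>2) \<partial>M)"
      using Tf by (intro nn_integral_cong_AE) (auto elim!: eventually_mono)
    also have "\<dots> = ennreal ((l2_norm M (wct_op M F w u f))\<^sup>2)"
      by (rule l2_norm_nn_integral[OF l2_bounded_op_in[OF T fl], symmetric])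
    also have "\<dots> \<le> ennreal ((K * l2_norm M f)\<^sup>2)"
      by (intro ennreal_leI power_mono K(2)[OF fl]) simp
    also have "\<dots> = ennreal (K\<^sup>2) * ennreal ((l2_norm M f)\<^sup>2)"
      by (simp add: power_mult_distrib ennreal_mult)
    also have "ennreal ((l2_norm M f)\<^sup>2) = (\<integral>\<^sup>+x. indicator A x * ennreal (q n x) \<partial>M)"
      unfolding l2_norm_nn_integral[OF fl] f2' ..
    also have "\<dots> = (\<integral>\<^sup>+x. indicator A x * Q n x \<partial>M)"
      unfolding Q_def by (rule nn_cond_exp_intg[symmetric]) auto
    also have "ennreal (K\<^sup>2) * \<dots> = (\<integral>\<^sup>+x. ennreal (K\<^sup>2) * (indicator A x * Q n x) \<partial>M)"
      by (rule nn_integral_cmult[symmetric]) measurable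
    finally show ?thesis by (simp add: mult.left_commute)
  qed
  have QW: "AE x in M. Q n x * ?W x \<le> ennreal (K\<^sup>2)" for n
  proof -
    have "AE x in M. (Q n x)\<^sup>2 * ?W x \<le> ennreal (K\<^sup>2) * Q n x"
    proof (rule AE_le_if_set_nn_integrals_le[OF _ _ _ test])
      show "AE x in M. ennreal (K\<^sup>2) * Q n x \<le> ennreal (K\<^sup>2 * (real n)\<^sup>2)"
        using Qbd[of n] by eventually_elim (simp add: ennreal_mult mult_left_mono)
    qed measurable
    then show ?thesis using Qbd[of n]
    proof eventually_elim
      case (elim x)
      show ?case
      proof (cases "Q n x = 0")
        case False
        have "Q n x < \<infinity>" using elim(2) by (simp add: le_less_trans)
        moreover have "Q n x * (Q n x * ?W x) \<le> Q n x * ennreal (K\<^sup>2)"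
          using elim(1) by (simp add: power2_eq_square mult_ac)
        ultimately show ?thesis using False by (simp add: ennreal_mult_le_mult_iff)
      qed simp
    qed
  qed
  have "AE x in M. ?V x * ?W x \<le> ennreal (K\<^sup>2)"
  proof (rule AE_le_if_set_nn_integrals_le)
    fix A assume A[measurable]: "A \<in> sets F"
    have AM[measurable]: "A \<in> sets M" using A subalg by (auto simp: subalgebra_def)
    let ?h = "\<lambda>x. indicator A x * ?W x"
    have hF[measurable]: "?h \<in> borel_measurable F" by measurable
    have sup: "ennreal ((cmod (u x))\<^sup>2) = (SUP n. ennreal (q n x))" for x
    proof (rule antisym)
      obtain n where "cmod (u x) \<le> real n" using real_arch_simple by blast
      then have "ennreal ((cmod (u x))\<^sup>2) = ennreal (q n x)" by (simp add: q_def)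
      then show "ennreal ((cmod (u x))\<^sup>2) \<le> (SUP n. ennreal (q n x))" by (auto intro: SUP_upper)
      show "(SUP n. ennreal (q n x)) \<le> ennreal ((cmod (u x))\<^sup>2)"
        by (intro SUP_least ennreal_leI) (simp add: q_def)
    qed
    have "(\<integral>\<^sup>+x. indicator A x * (?V x * ?W x) \<partial>M) = (\<integral>\<^sup>+x. ?h x * ?V x \<partial>M)"
      by (simp add: mult_ac)
    also have "\<dots> = (\<integral>\<^sup>+x. ?h x * ennreal ((cmod (u x))\<^sup>2) \<partial>M)"
      by (rule nn_cond_exp_intg) auto
    also have "\<dots> = (\<integral>\<^sup>+x. (SUP n. ?h x * ennreal (q n x)) \<partial>M)"
      unfolding sup by (simp add: SUP_mult_left_ennreal)
    also have "\<dots> = (SUP n. \<integral>\<^sup>+x. ?h x * ennreal (q n x) \<partial>M)"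
    proof (rule nn_integral_monotone_convergence_SUP)
      show "incseq (\<lambda>n x. ?h x * ennreal (q n x))"
        by (auto simp: incseq_def le_fun_def q_def intro!: mult_left_mono ennreal_leI)
    qed measurable
    also have "\<dots> \<le> (\<integral>\<^sup>+x. indicator A x * ennreal (K\<^sup>2) \<partial>M)"
    proof (rule SUP_least)
      fix n
      have "(\<integral>\<^sup>+x. ?h x * ennreal (q n x) \<partial>M) = (\<integral>\<^sup>+x. ?h x * Q n x \<partial>M)"
        unfolding Q_def by (rule nn_cond_exp_intg[symmetric]) auto
      also have "\<dots> \<le> (\<integral>\<^sup>+x. indicator A x * ennreal (K\<^sup>2) \<partial>M)"
        using QW[of n] by (intro nn_integral_mono_AE) (auto elim!: eventually_mono simp: indicator_def mult.commute)
      finally show "(\<integral>\<^sup>+x. ?h x * ennreal (q n x) \<partial>M) \<le> (\<integral>\<^sup>+x. indicator A x * ennreal (K\<^sup>2) \<partial>M)" .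
    qed
    finally show "(\<integral>\<^sup>+x. indicator A x * (?V x * ?W x) \<partial>M) \<le> (\<integral>\<^sup>+x. indicator A x * ennreal (K\<^sup>2) \<partial>M)" .
  qed auto
  then show thesis using K(1) by (intro that[of "K\<^sup>2"]) auto
qed

text \<open>
  Let \<open>V = E(\<bar>u\<bar>\<^sup>2)\<close>, and move the factor \<open>\<surd>V\<close> from \<open>u\<close> to \<open>w\<close> on the set \<open>S\<close> where \<open>0 < V < \<infinity>\<close>. The
  operator vanishes outside \<open>S\<close>: where \<open>V = 0\<close> because \<open>u = 0\<close>, and where \<open>V = \<infinity>\<close> because the bound on
  \<open>V E(\<bar>w\<bar>\<^sup>2)\<close> gives \<open>w = 0\<close>.
\<close>

lemma wct_op_normalize:
  assumes u[measurable]: "u \<in> borel_measurable M" and w[measurable]: "w \<in> borel_measurable M"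
    and dom: "\<forall>f\<in>l2_space M. (\<lambda>x. u x * f x) \<in> cond_exp_dom M F"
    and T: "l2_bounded_op M (wct_op M F w u)"
  obtains \<nu> \<omega> S C where "normalized_wct M F \<nu> \<omega> S C" "l2_op_eq M (wct_op M F w u) (wct_op M F \<omega> \<nu>)"
proof -
  let ?V = "cond_moment u" and ?W = "cond_moment w"
  obtain C where C: "C > 0" and VW: "AE x in M. ?V x * ?W x \<le> ennreal C"
    using wct_op_bounded_moments[OF u w T] by metis
  define S where "S = {x \<in> space F. 0 < ?V x \<and> ?V x < \<infinity>}"
  define s where "s x = (if 0 < ?V x \<and> ?V x < \<infinity> then sqrt (enn2real (?V x)) else 0)" for x
  have sp: "space F = space M" using subalg by (simp add: subalgebra_def)
  have SF: "S \<in> sets F" unfolding S_def by measurable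
  have sF[measurable]: "s \<in> borel_measurable F" unfolding s_def by measurable
  have s2: "ennreal ((s x)\<^sup>2) = ?V x" "s x > 0" if "0 < ?V x" "?V x < \<infinity>" for x
    using that by (auto simp: s_def enn2real_positive_iff)
  define \<nu> where "\<nu> x = inverse (of_real (s x)) * u x" for x
  define \<omega> where "\<omega> x = of_real (s x) * w x" for x
  have aF: "(\<lambda>x. inverse (complex_of_real (s x))) \<in> borel_measurable F" by measurable
  have bF: "(\<lambda>x. complex_of_real (s x)) \<in> borel_measurable F" by measurable
  have num: "\<nu> \<in> borel_measurable M" and omm: "\<omega> \<in> borel_measurable M"
    unfolding \<nu>_def \<omega>_def using F_measurable_M[OF aF] F_measurable_M[OF bF] by measurable
  have "normalized_wct M F \<nu> \<omega> S C"
  proof (unfold_locales)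
    show "AE x in M. cond_moment \<nu> x = indicator S x"
      using cond_moment_mult[OF aF u] AE_space unfolding \<nu>_def
    proof eventually_elim
      case (elim x)
      show ?case
      proof (cases "x \<in> S")
        case True
        then have *: "ennreal ((s x)\<^sup>2) = ?V x" "s x > 0" using s2 by (auto simp: S_def)
        show ?thesis
          unfolding elim(1) *(1)[symmetric] using *(2) True
          by (simp add: norm_inverse power_inverse ennreal_mult[symmetric])
      next
        case False
        then have "s x = 0" using elim(2) sp by (auto simp: s_def S_def)
        then show ?thesis using elim(1) False by simp
      qed
    qed
    have "AE x in M. cond_moment \<omega> x \<le> ennreal C"
      using cond_moment_mult[OF bF w] VW unfolding \<omega>_def
    proof eventually_elim
      case (elim x)
      have "ennreal ((s x)\<^sup>2) \<le> ?V x"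
        using s2(1)[of x] by (cases "0 < ?V x \<and> ?V x < \<infinity>") (auto simp: s_def)
      then have "ennreal ((s x)\<^sup>2) * ?W x \<le> ?V x * ?W x" by (rule mult_right_mono) simp
      then show ?case unfolding elim(1) using elim(2) by simp
    qed
    then show "\<omega> \<in> cond_bdd C" using omm by (simp add: cond_bdd_def)
    show "AE x in M. x \<notin> S \<longrightarrow> \<omega> x = 0"
      using AE_space by eventually_elim (auto simp: S_def \<omega>_def s_def sp)
  qed (use num SF C in auto)
  moreover have "l2_op_eq M (wct_op M F w u) (wct_op M F \<omega> \<nu>)"
    unfolding l2_op_eq_def
  proof
    fix f assume f: "f \<in> l2_space M"
    then have D: "(\<lambda>x. u x * f x) \<in> cond_exp_dom M F" using dom by simp
    have [measurable]: "f \<in> borel_measurable M" using f by (simp add: l2_space_def)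
    let ?c = "complex_cond_exp M F (\<lambda>x. u x * f x)"
    have e1: "AE x in M. complex_cond_exp M F (\<lambda>x. inverse (of_real (s x)) * (u x * f x)) x = inverse (of_real (s x)) * ?c x"
      by (rule complex_cond_exp_mult[OF aF D])
    define i where "i x = (if ?V x = 0 then 1 else 0 :: complex)" for x
    have iF: "i \<in> borel_measurable F" unfolding i_def by measurable
    have [measurable]: "i \<in> borel_measurable M" by (rule F_measurable_M[OF iF])
    have "AE x in M. i x * (u x * f x) = 0"
      using cond_moment_eq_0[OF u] by eventually_elim (simp add: i_def)
    then have "AE x in M. complex_cond_exp M F (\<lambda>x. i x * (u x * f x)) x = complex_cond_exp M F (\<lambda>x. 0) x"
      by (rule complex_cond_exp_cong) auto
    then have z: "AE x in M. i x * ?c x = 0"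
      using complex_cond_exp_zero complex_cond_exp_mult[OF iF D] by eventually_elim simp
    show "AE x in M. wct_op M F w u f x = wct_op M F \<omega> \<nu> f x"
      using e1 z VW cond_moment_eq_0[OF w]
    proof eventually_elim
      case (elim x)
      have T0: "wct_op M F \<omega> \<nu> f x = of_real (s x) * w x * (inverse (of_real (s x)) * ?c x)"
        unfolding wct_op_def \<nu>_def \<omega>_def elim(1)[symmetric] by (simp add: mult.assoc)
      consider "0 < ?V x \<and> ?V x < \<infinity>" | "?V x = 0" | "?V x = \<infinity>"
        by (metis not_gr_zero top.not_eq_extremum infinity_ennreal_def)
      then show ?case
      proof cases
        case 1
        then show ?thesis using s2(2)[of x] unfolding T0 by (simp add: wct_op_def)
      next
        case 2
        then have "?c x = 0" using elim(2) by (simp add: i_def)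
        then show ?thesis unfolding T0 by (simp add: wct_op_def)
      next
        case 3
        then have "?W x = 0" using elim(3) by (auto simp: ennreal_top_mult top_unique split: if_splits)
        then have "w x = 0" using elim(4) by simp
        then show ?thesis unfolding T0 by (simp add: wct_op_def)
      qed
    qed
  qed
  ultimately show thesis by (rule that)
qed

end

theorem theorem4p2:
  fixes M F :: "'a measure" and u w :: "'a \<Rightarrow> complex"
  assumes "complete_measure M"
    and "sigma_finite_measure M"
    and "sigma_finite_subalgebra M F"
    and "u \<in> cond_exp_dom M F"
    and "w \<in> cond_exp_dom M F"
    and "\<forall>f\<in>l2_space M. (\<lambda>x. u x * f x) \<in> cond_exp_dom M F"
    and "l2_bounded_op M (wct_op M F w u)"
    and "weakly_hyponormal M (wct_op M F w u)"
    and "l2_ker M (wct_op M F w u) \<subseteq> l2_ker M (l2_adjoint M (wct_op M F w u))"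
  shows "l2_op_eq M (wct_op M F w u) (aluthge M (wct_op M F w u))"
proof -
  interpret sigma_finite_subalgebra M F by fact
  have meas: "u \<in> borel_measurable M" "w \<in> borel_measurable M"
    using assms(4,5) by (simp_all add: cond_exp_dom_def)
  obtain \<nu> \<omega> S C where n: "normalized_wct M F \<nu> \<omega> S C"
    and T: "l2_op_eq M (wct_op M F w u) (wct_op M F \<omega> \<nu>)"
    using wct_op_normalize[OF meas assms(6,7)] by metis
  show ?thesis
  proof (rule normalized_wct.eq_aluthge[OF n T])
    show "\<forall>f\<in>l2_space M. wct_op M F w u f \<in> l2_space M"
      using l2_bounded_op_in[OF assms(7)] by blast
    show "l2_op_le M (l2_abs M (wct_op M F w u)) (l2_abs M (aluthge M (wct_op M F w u)))"
      using assms(8) by (simp add: weakly_hyponormal_def)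
  qed
qed

end
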